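(* Let $X$ be a closed Riemann surface of genus at least two with its conformal hyperbolic metric, $n\ge2$, $2\le k\le n$, $q_k\in H^0(X,K^k)$, and let $\gamma$ be a simple closed geodesic of length $\ell_\gamma$. At the Fuchsian point of $\mathcal H(\Sigma,n)$ determined by $X$, along the standard Hitchin deformation $\psi^0(q_k)$, the first variation of the largest eigenvalue $\lambda_\gamma$ of the holonomy along $\gamma$ is $$d\log\lambda_\gamma(\psi^0(q_k))=\frac{(-1)^k(n-1)!}{2^{k-2}(n-k)!}\int_0^{\ell_\gamma}\Re\bigl(q_k(\dot\gamma,\dots,\dot\gamma)\bigr)\,ds .$$ More generally, for $1\le p\le n$ the first variation of the $p$-th largest eigenvalue $\lambda^{(p)}_\gamma$ is $$d\log\lambda^{(p)}_\gamma(\psi^0(q_k))=c^{(p)}_{n,k}\int_0^{\ell_\gamma}\Re\bigl(q_k(\dot\gamma,\dots,\dot\gamma)\bigr)\,ds ,$$ where $$c^{(p)}_{n,k}=\frac{(p-1)!\,(n-p)!}{2^{k-2}(n-k)!}\sum_{j=\max(1,k+p-n)}^{\min(k,p)}\binom{n-k}{p-j}\binom{k-1}{j-1}^2(-1)^{j+k+1}.$$ In particular, for $k=n$, $$d\log\lambda^{(p)}_\gamma(\psi^0(q_n))=(-1)^{p+n+1}\frac{(n-1)!}{2^{n-2}}\binom{n-1}{p-1}\int_0^{\ell_\gamma}\Re\bigl(q_n(\dot\gamma,\dots,\dot\gamma)\bigr)\,ds .$$ Here $\gamma$ is parametrized by arc length and $q_k$ is evaluated on $k$ copies of the unit tangent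 vector.
   Context: Setting. $X$ is a closed Riemann surface of genus $\ge2$ with its conformal hyperbolic metric of curvature $-1$ and area form $d\sigma$; $\Sigma$ is the underlying oriented surface, $K$ the canonical bundle. Locally $d\sigma=i\,h\,dz\wedge d\bar z$, and the hermitian metric on $K^k$ is $\langle dz^k,dz^k\rangle=h^{-k}$. $\mathcal H(\Sigma,n)$ (the Hitchin component) is the set of conjugacy classes of representations $\pi_1(\Sigma)\to\mathsf{PSL}(n,\mathbb R)$ (lifted to $\mathsf{SL}(n,\mathbb R)$) that can be continuously deformed to a Fuchsian one; the Fuchsian representation attached to $X$ is $\delta=\iota_n\circ\delta_X$, with $\delta_X$ the monodromy of the hyperbolic metric and $\iota_n$ the irreducible representation of $\mathsf{PSL}(2,\mathbb R)$ in $\mathsf{PSL}(n,\mathbb R)$. For a Hitchin representation, $\delta(\gamma)$ has $n$ distinct positive eigenvalues. Standard deformation. Let $a,x,y$ be generators of $\mathfrak{sl}(2)$ with $[a,x]=x$, $[a,y]=-y$, $[x,y]=-a$, and $\kappa_n:\mathfrak{sl}(2)\to\mathfrak{sl}(n,\mathbb C)$ the irreducible embedding given in a unitary basis $\hat w_1,\dots,\hat w_n$ by $X_n=\kappa_n(x)$, $Y_n=\kappa_n(y)$, $-X_n\hat w_p=c_p\hat w_{p+1}$, $Y_n\hat w_p=c_{p-1}\hat w_{p-1}$, $c_p=(p(n-p)/2)^{1/2}$; so $Y_n=\rho(X_n)$ for $\rho(M)=-M^*$. Put $E^0_k=(-\sqrt2X_n)^k$. With $\mathfrak g_m$ the $m$-eigenspace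 of $\mathrm{ad}\,\kappa_n(a)$ on $\mathfrak{sl}(n,\mathbb C)$, let $\mathcal G=\bigoplus_m\mathfrak g_m\otimes K^m$, with the Cartan involutions $\rho$ induced by the hermitian metric on $K$, the Chern connection $\nabla$, and $\Phi_0=Y_n\otimes1\in\mathfrak g_{-1}\otimes K^{-1}\otimes K$. Then $D=\nabla+\Phi_0-\rho(\Phi_0)$ is flat with monodromy $\delta$. For $q\in H^0(X,K^k)$ set $\phi^0(q)=q\otimes E^0_{k-1}$ and $\psi^0(q)=\phi^0(q)-\rho(\phi^0(q))$; this is a $D$-closed real $1$-form whose class is a tangent vector in $\mathsf T_\delta\mathcal H(\Sigma,n)$.
   Formalization: Length, arc length and unit tangent vectors are measured by the hermitian norm h|dz|², i.e. 1/√2 times the curvature −1 metric 2h|dz|² with area form dσ; for that metric itself the printed constants would be off by the factor 2^{(k−1)/2}. *)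

theory Defs
  imports
    "HOL-Complex_Analysis.Complex_Analysis"
    "HOL-Homology.Homology"
    "Jordan_Normal_Form.Char_Poly"
    "Jordan_Normal_Form.Schur_Decomposition"
begin

section \<open>Calculus in a coordinate\<close>

definition dir_deriv :: "complex \<Rightarrow> (complex \<Rightarrow> 'b::real_normed_vector) \<Rightarrow> complex \<Rightarrow> 'b" where
  "dir_deriv v f w = vector_derivative (\<lambda>t. f (w + of_real t * v)) (at 0)"

primrec C_k :: "nat \<Rightarrow> complex set \<Rightarrow> (complex \<Rightarrow> 'b::real_normed_vector) \<Rightarrow> bool" where
  "C_k 0 S f \<longleftrightarrow> continuous_on S f"
| "C_k (Suc m) S f \<longleftrightarrow> (\<forall>w\<in>S. f differentiable (at w)) \<and>
      C_k m S (dir_deriv 1 f) \<and> C_k m S (dir_deriv \<i> f)"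

definition smooth :: "complex set \<Rightarrow> (complex \<Rightarrow> 'b::real_normed_vector) \<Rightarrow> bool" where
  "smooth S f \<longleftrightarrow> (\<forall>m. C_k m S f)"

definition laplacian :: "(complex \<Rightarrow> real) \<Rightarrow> complex \<Rightarrow> real" where
  "laplacian f w = dir_deriv 1 (dir_deriv 1 f) w + dir_deriv \<i> (dir_deriv \<i> f) w"

definition wirtinger :: "(complex \<Rightarrow> real) \<Rightarrow> complex \<Rightarrow> complex" where
  "wirtinger f w = (of_real (dir_deriv 1 f w) - \<i> * of_real (dir_deriv \<i> f w)) / 2"


section \<open>Riemann surfaces, differentials, conformal metrics\<close>

text \<open>A chart is a pair \<open>(U, z)\<close>. Sections of powers of the canonical bundle \<open>K\<close> (and of bundles
  built from them) are families of local coefficients, indexed by the charts of the atlas and related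
  by the transition rules below. The surface is the whole underlying type.\<close>

type_synonym 'a chart = "'a set \<times> ('a \<Rightarrow> complex)"

definition in_chart :: "'a chart \<Rightarrow> ('a \<Rightarrow> 'b) \<Rightarrow> complex \<Rightarrow> 'b" where
  "in_chart c f w = f (inv_into (fst c) (snd c) w)"

text \<open>For \<open>c = (U, z)\<close> and \<open>c' = (V, w)\<close> this is \<open>dw/dz\<close>.\<close>

definition transition :: "'a chart \<Rightarrow> 'a chart \<Rightarrow> 'a \<Rightarrow> complex" where
  "transition c c' x = deriv (in_chart c (snd c')) (snd c x)"

definition riemann_surface :: "'a::t2_space chart set \<Rightarrow> bool" where
  "riemann_surface atlas \<longleftrightarrow>
     (\<Union>c\<in>atlas. fst c) = UNIV \<and>
     (\<forall>c\<in>atlas. open (fst c) \<and> open (snd c ` fst c) \<and>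
        homeomorphism (fst c) (snd c ` fst c) (snd c) (inv_into (fst c) (snd c))) \<and>
     (\<forall>c\<in>atlas. \<forall>c'\<in>atlas. in_chart c (snd c') holomorphic_on snd c ` (fst c \<inter> fst c'))"

definition closed_riemann_surface :: "'a::t2_space chart set \<Rightarrow> bool" where
  "closed_riemann_surface atlas \<longleftrightarrow>
     riemann_surface atlas \<and> compact (UNIV :: 'a set) \<and> connected (UNIV :: 'a set)"

definition has_genus :: "'a topology \<Rightarrow> nat \<Rightarrow> bool" where
  "has_genus X g \<longleftrightarrow> homology_group 1 X \<cong> free_Abelian_group {..<2 * g}"

text \<open>\<open>H\<^sup>0(X, K\<^sup>k)\<close>: locally \<open>q = q\<^sub>c dz\<^sup>k\<close>.\<close>

definition holomorphic_differential ::
    "'a::t2_space chart set \<Rightarrow> nat \<Rightarrow> ('a chart \<Rightarrow> 'a \<Rightarrow> complex) \<Rightarrow> bool" where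
  "holomorphic_differential atlas k q \<longleftrightarrow>
     (\<forall>c\<in>atlas. in_chart c (q c) holomorphic_on snd c ` fst c) \<and>
     (\<forall>c\<in>atlas. \<forall>c'\<in>atlas. \<forall>x\<in>fst c \<inter> fst c'. q c x = q c' x * transition c c' x ^ k)"

text \<open>Locally the area form is \<open>d\<sigma> = i h dz \<and> d\<zbar> = 2 h dx \<and> dy\<close>.\<close>

definition conformal_metric ::
    "'a::t2_space chart set \<Rightarrow> ('a chart \<Rightarrow> 'a \<Rightarrow> real) \<Rightarrow> bool" where
  "conformal_metric atlas h \<longleftrightarrow>
     (\<forall>c\<in>atlas. (\<forall>x\<in>fst c. h c x > 0) \<and> smooth (snd c ` fst c) (in_chart c (h c))) \<and>
     (\<forall>c\<in>atlas. \<forall>c'\<in>atlas. \<forall>x\<in>fst c \<inter> fst c'. h c x = h c' x * (cmod (transition c c' x))\<^sup>2)"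

text \<open>The Gauss curvature determined by \<open>(curvature form) = (curvature) \<cdot> d\<sigma>\<close>, the curvature form of
  a conformal metric with area density \<open>2 h\<close> being \<open>- (1/2) \<Delta> log h dx \<and> dy\<close>.\<close>

definition curvature :: "('a chart \<Rightarrow> 'a \<Rightarrow> real) \<Rightarrow> 'a chart \<Rightarrow> 'a \<Rightarrow> real" where
  "curvature h c x = - laplacian (in_chart c (\<lambda>y. ln (h c y))) (snd c x) / (4 * h c x)"

definition hyperbolic_metric ::
    "'a::t2_space chart set \<Rightarrow> ('a chart \<Rightarrow> 'a \<Rightarrow> real) \<Rightarrow> bool" where
  "hyperbolic_metric atlas h \<longleftrightarrow>
     conformal_metric atlas h \<and> (\<forall>c\<in>atlas. \<forall>x\<in>fst c. curvature h c x = - 1)"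

text \<open>The connection form \<open>\<partial> log h\<close> (coefficient of \<open>dz\<close>) of the Chern connection on \<open>K\<inverse>\<close>, which is
  also the Christoffel symbol of the Levi-Civita connection.\<close>

definition d_log_h :: "('a chart \<Rightarrow> 'a \<Rightarrow> real) \<Rightarrow> 'a chart \<Rightarrow> 'a \<Rightarrow> complex" where
  "d_log_h h c x = wirtinger (in_chart c (\<lambda>y. ln (h c y))) (snd c x)"


section \<open>Closed geodesics\<close>

definition velocity :: "'a chart \<Rightarrow> (real \<Rightarrow> 'a) \<Rightarrow> real \<Rightarrow> complex" where
  "velocity c \<gamma> s = vector_derivative (snd c \<circ> \<gamma>) (at s)"

text \<open>A closed curve of length \<open>L\<close> is an \<open>L\<close>-periodic curve on the line. Tangent vectors are measured
  by the hermitian metric on \<open>TX = K\<inverse>\<close> dual to \<open>\<langle>dz, dz\<rangle> = h\<inverse>\<close>, so \<open>\<langle>v, v\<rangle> = h \<bar>dz(v)\<bar>\<^sup>2\<close>, and arc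
  length is with respect to this norm. This is \<open>1/\<surd>2\<close> times the Riemannian norm of
  \<open>2 h \<bar>dz\<bar>\<^sup>2\<close>, the tensor whose Riemannian area form is \<open>d\<sigma>\<close>; the geodesics are the same.\<close>

definition simple_closed_geodesic ::
    "'a::t2_space chart set \<Rightarrow> ('a chart \<Rightarrow> 'a \<Rightarrow> real) \<Rightarrow> (real \<Rightarrow> 'a) \<Rightarrow> real \<Rightarrow> bool" where
  "simple_closed_geodesic atlas h \<gamma> L \<longleftrightarrow>
     L > 0 \<and> continuous_on UNIV \<gamma> \<and> (\<forall>s. \<gamma> (s + L) = \<gamma> s) \<and> inj_on \<gamma> {0..<L} \<and>
     (\<forall>c\<in>atlas. \<forall>s. \<gamma> s \<in> fst c \<longrightarrow>
        (snd c \<circ> \<gamma>) differentiable (at s) \<and>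
        h c (\<gamma> s) * (cmod (velocity c \<gamma> s))\<^sup>2 = 1 \<and>
        (velocity c \<gamma> has_vector_derivative
           - d_log_h h c (\<gamma> s) * (velocity c \<gamma> s)\<^sup>2) (at s))"

text \<open>\<open>q(\<gamma>', \<dots>, \<gamma>')\<close>; for a \<open>k\<close>-differential it does not depend on the chosen chart.\<close>

definition eval_differential ::
    "'a::t2_space chart set \<Rightarrow> nat \<Rightarrow> ('a chart \<Rightarrow> 'a \<Rightarrow> complex) \<Rightarrow> (real \<Rightarrow> 'a) \<Rightarrow> real \<Rightarrow> complex" where
  "eval_differential atlas k q \<gamma> s =
     (let c = (SOME c. c \<in> atlas \<and> \<gamma> s \<in> fst c) in q c (\<gamma> s) * velocity c \<gamma> s ^ k)"

definition closed_curve_loop :: "(real \<Rightarrow> 'a) \<Rightarrow> real \<Rightarrow> real \<Rightarrow> 'a" where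
  "closed_curve_loop \<gamma> L = (\<lambda>s. \<gamma> (L * s))"


section \<open>Representations of the fundamental group and the Hitchin component\<close>

definition loops :: "'a::topological_space \<Rightarrow> (real \<Rightarrow> 'a) set" where
  "loops x = {p. path p \<and> pathstart p = x \<and> pathfinish p = x}"

text \<open>Homomorphisms \<open>\<pi>\<^sub>1(X, x) \<rightarrow> SL(n, \<real>)\<close>, as functions of loops. Forward parallel transport along
  \<open>p +++ q\<close> (first \<open>p\<close>) is transport along \<open>q\<close> after transport along \<open>p\<close>, so the product in the
  fundamental group is written from right to left, as for composition of maps.\<close>

definition representation ::
    "nat \<Rightarrow> 'a::topological_space \<Rightarrow> ((real \<Rightarrow> 'a) \<Rightarrow> real mat) \<Rightarrow> bool" where
  "representation n x \<rho> \<longleftrightarrow>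
     (\<forall>p\<in>loops x. \<rho> p \<in> carrier_mat n n \<and> Determinant.det (\<rho> p) = 1) \<and>
     (\<forall>p\<in>loops x. \<forall>q\<in>loops x. homotopic_paths UNIV p q \<longrightarrow> \<rho> p = \<rho> q) \<and>
     (\<forall>p\<in>loops x. \<forall>q\<in>loops x. \<rho> (p +++ q) = \<rho> q * \<rho> p)"

definition discrete_faithful ::
    "'a::topological_space \<Rightarrow> ((real \<Rightarrow> 'a) \<Rightarrow> real mat) \<Rightarrow> bool" where
  "discrete_faithful x \<sigma> \<longleftrightarrow>
     (\<forall>p\<in>loops x. \<sigma> p = 1\<^sub>m 2 \<or> \<sigma> p = - 1\<^sub>m 2 \<longrightarrow> homotopic_paths UNIV p (\<lambda>_. x)) \<and>
     (\<exists>e>0. \<forall>p\<in>loops x.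
        (\<forall>i<2. \<forall>j<2. \<bar>\<sigma> p $$ (i, j) - 1\<^sub>m 2 $$ (i, j)\<bar> < e) \<longrightarrow> \<sigma> p = 1\<^sub>m 2)"

text \<open>The irreducible representation of \<open>SL(2)\<close> on binary forms of degree \<open>n - 1\<close>: with \<open>e\<^sub>1 = 1\<close> and
  \<open>e\<^sub>2 = T\<close>, column \<open>j\<close> lists the coefficients of \<open>(A e\<^sub>1)\<^bsup>n-1-j\<^esup> (A e\<^sub>2)\<^bsup>j\<^esup>\<close>.\<close>

definition irreducible_rep :: "nat \<Rightarrow> real mat \<Rightarrow> real mat" where
  "irreducible_rep n A = Matrix.mat n n (\<lambda>(i, j).
     poly.coeff ([:A $$ (0, 0), A $$ (1, 0):] ^ (n - 1 - j) * [:A $$ (0, 1), A $$ (1, 1):] ^ j) i)"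

text \<open>Representations in the Hitchin component: those that can be deformed to a Fuchsian one.\<close>

definition hitchin_rep ::
    "nat \<Rightarrow> 'a::topological_space \<Rightarrow> ((real \<Rightarrow> 'a) \<Rightarrow> real mat) \<Rightarrow> bool" where
  "hitchin_rep n x \<rho> \<longleftrightarrow>
     (\<exists>r \<sigma>. (\<forall>s\<in>{0..1::real}. representation n x (r s)) \<and>
        (\<forall>p\<in>loops x. \<forall>i<n. \<forall>j<n. continuous_on {0..1} (\<lambda>s. r s p $$ (i, j))) \<and>
        (\<forall>p\<in>loops x. r 0 p = \<rho> p) \<and>
        representation 2 x \<sigma> \<and> discrete_faithful x \<sigma> \<and>
        (\<forall>p\<in>loops x. r 1 p = irreducible_rep n (\<sigma> p)))"

definition moebius :: "real mat \<Rightarrow> complex \<Rightarrow> complex" where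
  "moebius A w = (of_real (A $$ (0, 0)) * w + of_real (A $$ (0, 1))) /
                 (of_real (A $$ (1, 0)) * w + of_real (A $$ (1, 1)))"

text \<open>A developing map to the upper half-plane, as a function of (homotopy classes of) paths issuing
  from \<open>x\<close>; it is holomorphic and pulls the area form \<open>dx \<and> dy / y\<^sup>2\<close> back to \<open>d\<sigma>\<close>. \<open>\<sigma>\<close> is (a lift to
  \<open>SL(2, \<real>)\<close> of) the monodromy; the inverse in the equivariance corresponds to forward transport, see
  the definition of representation.\<close>

definition hyperbolic_monodromy ::
    "'a::t2_space chart set \<Rightarrow> ('a chart \<Rightarrow> 'a \<Rightarrow> real) \<Rightarrow> 'a \<Rightarrow> ((real \<Rightarrow> 'a) \<Rightarrow> real mat) \<Rightarrow> bool" where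
  "hyperbolic_monodromy atlas h x \<sigma> \<longleftrightarrow>
     representation 2 x \<sigma> \<and>
     (\<exists>dev :: (real \<Rightarrow> 'a) \<Rightarrow> complex.
        (\<forall>p. path p \<and> pathstart p = x \<longrightarrow> Im (dev p) > 0) \<and>
        (\<forall>p p'. pathstart p = x \<and> homotopic_paths UNIV p p' \<longrightarrow> dev p = dev p') \<and>
        (\<forall>p. \<forall>c\<in>atlas. path p \<and> pathstart p = x \<and> pathfinish p \<in> fst c \<longrightarrow>
           (\<exists>N f. open N \<and> pathfinish p \<in> N \<and> N \<subseteq> fst c \<and> f holomorphic_on snd c ` N \<and>
              (\<forall>r. path r \<and> path_image r \<subseteq> N \<and> pathstart r = pathfinish p \<longrightarrow>
                   dev (p +++ r) = f (snd c (pathfinish r))) \<and>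
              (\<forall>y\<in>N. (cmod (deriv f (snd c y)))\<^sup>2 / (Im (f (snd c y)))\<^sup>2 = 2 * h c y))) \<and>
        (\<forall>p\<in>loops x. \<forall>r. path r \<and> pathstart r = x \<longrightarrow>
           dev r = moebius (\<sigma> p) (dev (p +++ r))))"

definition fuchsian_point ::
    "'a::t2_space chart set \<Rightarrow> ('a chart \<Rightarrow> 'a \<Rightarrow> real) \<Rightarrow> nat \<Rightarrow> 'a \<Rightarrow> ((real \<Rightarrow> 'a) \<Rightarrow> real mat) \<Rightarrow> bool" where
  "fuchsian_point atlas h n x \<rho> \<longleftrightarrow>
     (\<exists>\<sigma> g g'. hyperbolic_monodromy atlas h x \<sigma> \<and>
        g \<in> carrier_mat n n \<and> g' \<in> carrier_mat n n \<and> g * g' = 1\<^sub>m n \<and> g' * g = 1\<^sub>m n \<and>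
        (\<forall>p\<in>loops x. \<rho> p = g * irreducible_rep n (\<sigma> p) * g'))"

text \<open>The modulus of the \<open>p\<close>-th largest eigenvalue, counted with multiplicity. The eigenvalues of an
  element of the Hitchin component are positive only up to the sign of the lift from
  \<open>PSL(n, \<real>)\<close> to \<open>SL(n, \<real>)\<close>; the modulus is the eigenvalue of the positive lift.\<close>

definition nth_eigenvalue :: "nat \<Rightarrow> real mat \<Rightarrow> real" where
  "nth_eigenvalue p A =
     rev (sorted_list_of_multiset
            (image_mset cmod (proots (char_poly (map_mat complex_of_real A))))) ! (p - 1)"


section \<open>The principal embedding\<close>

text \<open>Matrix indices start at \<open>0\<close>: the basis vector \<open>w\<^sub>p\<close> has index \<open>p - 1\<close>.\<close>

definition c_coef :: "nat \<Rightarrow> nat \<Rightarrow> real" where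
  "c_coef n p = sqrt (real p * (real n - real p) / 2)"

definition X_mat :: "nat \<Rightarrow> complex mat" where
  "X_mat n = Matrix.mat n n (\<lambda>(i, j). if i = j + 1 then - of_real (c_coef n (j + 1)) else 0)"

definition Y_mat :: "nat \<Rightarrow> complex mat" where
  "Y_mat n = Matrix.mat n n (\<lambda>(i, j). if j = i + 1 then of_real (c_coef n j) else 0)"

definition bracket :: "complex mat \<Rightarrow> complex mat \<Rightarrow> complex mat" where
  "bracket A B = A * B - B * A"

text \<open>\<open>\<kappa>\<^sub>n(a)\<close>, from \<open>[x, y] = - a\<close>; it is diagonal with entries \<open>p - (n + 1)/2\<close>, so the matrix unit
  \<open>(i, j)\<close> spans a line in \<open>\<gg>\<^sub>m\<close> for \<open>m = i - j\<close>.\<close>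

definition A_mat :: "nat \<Rightarrow> complex mat" where
  "A_mat n = - bracket (X_mat n) (Y_mat n)"

definition E_mat :: "nat \<Rightarrow> nat \<Rightarrow> complex mat" where
  "E_mat n k = ((- complex_of_real (sqrt 2)) \<cdot>\<^sub>m X_mat n) ^\<^sub>m k"

definition sl :: "nat \<Rightarrow> complex mat set" where
  "sl n = {M \<in> carrier_mat n n. (\<Sum>i<n. M $$ (i, i)) = 0}"


section \<open>The bundle \<open>\<G>\<close> of Lie algebras\<close>

text \<open>In a chart \<open>(U, z)\<close> the matrix \<open>M = \<Sum>\<^sub>m M\<^sub>m\<close>, \<open>M\<^sub>m \<in> \<gg>\<^sub>m\<close>, stands for the element
  \<open>\<Sum>\<^sub>m M\<^sub>m \<otimes> dz\<^sup>m\<close> of \<open>\<G> = \<Oplus>\<^sub>m \<gg>\<^sub>m \<otimes> K\<^sup>m\<close>. The next function multiplies \<open>M\<^sub>m\<close> by \<open>l\<^sup>m\<close>.\<close>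

definition twist :: "nat \<Rightarrow> complex \<Rightarrow> complex mat \<Rightarrow> complex mat" where
  "twist n l M = Matrix.mat n n (\<lambda>(i, j). l powi (int i - int j) * M $$ (i, j))"

text \<open>\<open>\<rho>(M) = - M\<^sup>*\<close> combined with the antilinear isomorphism \<open>K\<^sup>m \<rightarrow> K\<^bsup>-m\<^esup>\<close> given by the hermitian
  metric, \<open>dz\<^sup>m \<mapsto> h\<^bsup>-m\<^esup> dz\<^bsup>-m\<^esup>\<close>.\<close>

definition cartan_involution :: "nat \<Rightarrow> real \<Rightarrow> complex mat \<Rightarrow> complex mat" where
  "cartan_involution n h M = - twist n (of_real h) (mat_adjoint M)"

definition G_section ::
    "'a::t2_space chart set \<Rightarrow> nat \<Rightarrow> ('a chart \<Rightarrow> 'a \<Rightarrow> complex mat) \<Rightarrow> bool" where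
  "G_section atlas n u \<longleftrightarrow>
     (\<forall>c\<in>atlas. (\<forall>x\<in>fst c. u c x \<in> sl n) \<and>
        (\<forall>i<n. \<forall>j<n. smooth (snd c ` fst c) (in_chart c (\<lambda>x. u c x $$ (i, j))))) \<and>
     (\<forall>c\<in>atlas. \<forall>c'\<in>atlas. \<forall>x\<in>fst c \<inter> fst c'. u c x = twist n (transition c c' x) (u c' x))"

text \<open>A \<open>\<G>\<close>-valued \<open>1\<close>-form takes a chart, a point, and the coordinate \<open>v = dz(V)\<close> of a tangent vector
  \<open>V\<close> at this point.\<close>

type_synonym 'a G_form = "'a chart \<Rightarrow> 'a \<Rightarrow> complex \<Rightarrow> complex mat"

definition G_form :: "'a::t2_space chart set \<Rightarrow> nat \<Rightarrow> 'a G_form \<Rightarrow> bool" where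
  "G_form atlas n \<alpha> \<longleftrightarrow>
     (\<forall>c\<in>atlas. (\<forall>x\<in>fst c. (\<forall>v. \<alpha> c x v \<in> sl n) \<and>
          (\<forall>i<n. \<forall>j<n. linear (\<lambda>v. \<alpha> c x v $$ (i, j)))) \<and>
        (\<forall>v. \<forall>i<n. \<forall>j<n. smooth (snd c ` fst c) (in_chart c (\<lambda>x. \<alpha> c x v $$ (i, j))))) \<and>
     (\<forall>c\<in>atlas. \<forall>c'\<in>atlas. \<forall>x\<in>fst c \<inter> fst c'. \<forall>v.
        \<alpha> c x v = twist n (transition c c' x) (\<alpha> c' x (transition c c' x * v)))"

text \<open>The form \<open>\<Theta>\<close> for which \<open>D = \<nabla> + \<Phi>\<^sub>0 - \<rho>(\<Phi>\<^sub>0)\<close> is \<open>d + [\<Theta>, \<cdot>]\<close> in the frames \<open>dz\<^sup>m\<close>: the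
  Chern connection satisfies \<open>\<nabla> dz\<^sup>m = - m \<partial> log h \<otimes> dz\<^sup>m\<close>, and \<open>\<Phi>\<^sub>0 = Y\<^sub>n \<otimes> dz\<inverse> \<otimes> dz\<close>.\<close>

definition D_form :: "nat \<Rightarrow> ('a chart \<Rightarrow> 'a \<Rightarrow> real) \<Rightarrow> 'a G_form" where
  "D_form n h c x v =
     (- d_log_h h c x * v) \<cdot>\<^sub>m A_mat n + v \<cdot>\<^sub>m Y_mat n - cartan_involution n (h c x) (v \<cdot>\<^sub>m Y_mat n)"

definition D_section ::
    "nat \<Rightarrow> ('a chart \<Rightarrow> 'a \<Rightarrow> real) \<Rightarrow> ('a chart \<Rightarrow> 'a \<Rightarrow> complex mat) \<Rightarrow> 'a G_form" where
  "D_section n h u c x v =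
     Matrix.mat n n (\<lambda>(i, j). dir_deriv v (in_chart c (\<lambda>y. u c y $$ (i, j))) (snd c x)) +
     bracket (D_form n h c x v) (u c x)"

definition phi0 :: "nat \<Rightarrow> nat \<Rightarrow> ('a chart \<Rightarrow> 'a \<Rightarrow> complex) \<Rightarrow> 'a G_form" where
  "phi0 n k q c x v = (q c x * v) \<cdot>\<^sub>m E_mat n (k - 1)"

definition psi0 ::
    "nat \<Rightarrow> nat \<Rightarrow> ('a chart \<Rightarrow> 'a \<Rightarrow> real) \<Rightarrow> ('a chart \<Rightarrow> 'a \<Rightarrow> complex) \<Rightarrow> 'a G_form" where
  "psi0 n k h q c x v = phi0 n k q c x v - cartan_involution n (h c x) (phi0 n k q c x v)"


section \<open>Parallel transport and monodromy\<close>

definition C1_path :: "'a::t2_space chart set \<Rightarrow> (real \<Rightarrow> 'a) \<Rightarrow> bool" where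
  "C1_path atlas p \<longleftrightarrow> path p \<and>
     (\<forall>c\<in>atlas. \<forall>s\<in>{0..1}. p s \<in> fst c \<longrightarrow>
        (snd c \<circ> p) differentiable (at s within {0..1}) \<and>
        continuous (at s within {0..1})
          (\<lambda>s. vector_derivative (snd c \<circ> p) (at s within {0..1})))"

text \<open>Sections of \<open>\<G>\<close> along \<open>p\<close> that are parallel for the connection \<open>d + [\<Theta>, \<cdot>]\<close>.\<close>

definition parallel_along ::
    "'a::t2_space chart set \<Rightarrow> nat \<Rightarrow> 'a G_form \<Rightarrow> (real \<Rightarrow> 'a) \<Rightarrow> ('a chart \<Rightarrow> real \<Rightarrow> complex mat) \<Rightarrow> bool" where
  "parallel_along atlas n \<Theta> p S \<longleftrightarrow>
     (\<forall>c\<in>atlas. \<forall>s\<in>{0..1}. p s \<in> fst c \<longrightarrow> S c s \<in> sl n \<and>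
        (\<forall>i<n. \<forall>j<n.
           ((\<lambda>s. S c s $$ (i, j)) has_vector_derivative
              - bracket (\<Theta> c (p s) (vector_derivative (snd c \<circ> p) (at s within {0..1}))) (S c s) $$ (i, j))
             (at s within {0..1}))) \<and>
     (\<forall>c\<in>atlas. \<forall>c'\<in>atlas. \<forall>s\<in>{0..1}. p s \<in> fst c \<inter> fst c' \<longrightarrow>
        S c s = twist n (transition c c' (p s)) (S c' s))"

text \<open>\<open>\<rho>\<close> is the monodromy of \<open>d + [\<Theta>, \<cdot>]\<close>: for some inner identification \<open>M \<mapsto> g M g\<inverse>\<close> of the fibre
  of \<open>\<G>\<close> at \<open>x\<close> with \<open>sl(n, \<complex>)\<close>, parallel transport along each loop \<open>p\<close> is \<open>Ad (\<rho> p)\<close>.\<close>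

definition monodromy ::
    "'a::t2_space chart set \<Rightarrow> nat \<Rightarrow> 'a G_form \<Rightarrow> 'a \<Rightarrow> ((real \<Rightarrow> 'a) \<Rightarrow> real mat) \<Rightarrow> bool" where
  "monodromy atlas n \<Theta> x \<rho> \<longleftrightarrow>
     (\<exists>c\<in>atlas. x \<in> fst c \<and>
        (\<exists>g g'. g \<in> carrier_mat n n \<and> g' \<in> carrier_mat n n \<and> g * g' = 1\<^sub>m n \<and> g' * g = 1\<^sub>m n \<and>
           (\<forall>p\<in>loops x. C1_path atlas p \<longrightarrow> (\<forall>S. parallel_along atlas n \<Theta> p S \<longrightarrow>
              (let R = map_mat complex_of_real (\<rho> p)
               in (g * S c 1 * g') * R = R * (g * S c 0 * g'))))))"

definition C1_family ::
    "'a::t2_space chart set \<Rightarrow> nat \<Rightarrow> real \<Rightarrow> (real \<Rightarrow> 'a G_form) \<Rightarrow> (real \<Rightarrow> 'a G_form) \<Rightarrow> bool" where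
  "C1_family atlas n \<epsilon> \<alpha> \<alpha>' \<longleftrightarrow>
     (\<forall>t\<in>{- \<epsilon><..<\<epsilon>}. G_form atlas n (\<alpha> t) \<and> G_form atlas n (\<alpha>' t)) \<and>
     (\<forall>c\<in>atlas. \<forall>v. \<forall>i<n. \<forall>j<n.
        (\<forall>t\<in>{- \<epsilon><..<\<epsilon>}. \<forall>x\<in>fst c.
           ((\<lambda>t. \<alpha> t c x v $$ (i, j)) has_vector_derivative \<alpha>' t c x v $$ (i, j)) (at t)) \<and>
        continuous_on ({- \<epsilon><..<\<epsilon>} \<times> fst c) (\<lambda>(t, x). \<alpha>' t c x v $$ (i, j)))"

text \<open>A curve \<open>\<delta>\<^sub>t\<close> in the Hitchin component whose tangent vector at \<open>t = 0\<close> is the class of the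
  \<open>D\<close>-closed form \<open>\<psi>\<close>: \<open>\<delta>\<^sub>t\<close> is the monodromy of a family of connections \<open>D + \<alpha>\<^sub>t\<close> (flat, because
  \<open>\<delta>\<^sub>t\<close> only depends on homotopy classes) with \<open>\<alpha>\<^sub>0 = 0\<close> and derivative cohomologous to
  \<open>\<psi>\<close> at \<open>0\<close>. The curve starts at the Fuchsian point given by the hyperbolic metric.\<close>

definition hitchin_deformation ::
    "'a::t2_space chart set \<Rightarrow> ('a chart \<Rightarrow> 'a \<Rightarrow> real) \<Rightarrow> nat \<Rightarrow> 'a \<Rightarrow> 'a G_form \<Rightarrow>
     (real \<Rightarrow> (real \<Rightarrow> 'a) \<Rightarrow> real mat) \<Rightarrow> bool" where
  "hitchin_deformation atlas h n x \<psi> \<delta> \<longleftrightarrow>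
     fuchsian_point atlas h n x (\<delta> 0) \<and>
     (\<exists>\<epsilon>>0. \<exists>\<alpha> \<alpha>' u.
        C1_family atlas n \<epsilon> \<alpha> \<alpha>' \<and> G_section atlas n u \<and>
        (\<forall>c\<in>atlas. \<forall>y\<in>fst c. \<forall>v.
           \<alpha> 0 c y v = 0\<^sub>m n n \<and> \<alpha>' 0 c y v = \<psi> c y v + D_section n h u c y v) \<and>
        (\<forall>t\<in>{- \<epsilon><..<\<epsilon>}. hitchin_rep n x (\<delta> t) \<and>
           monodromy atlas n (\<lambda>c y v. D_form n h c y v + \<alpha> t c y v) x (\<delta> t)))"

text \<open>\<open>d log \<lambda>\<^sup>(\<^sup>p\<^sup>)\<^sub>\<gamma> (\<psi>) = r\<close> at the Fuchsian point: the derivative along every curve with tangent vector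
  the class of \<open>\<psi>\<close>. The base point of the fundamental group is put on the closed curve.\<close>

definition first_variation_log_eigenvalue ::
    "'a::t2_space chart set \<Rightarrow> ('a chart \<Rightarrow> 'a \<Rightarrow> real) \<Rightarrow> nat \<Rightarrow> (real \<Rightarrow> 'a) \<Rightarrow> real \<Rightarrow> nat \<Rightarrow>
     'a G_form \<Rightarrow> real \<Rightarrow> bool" where
  "first_variation_log_eigenvalue atlas h n \<gamma> L p \<psi> r \<longleftrightarrow>
     (\<forall>\<delta>. hitchin_deformation atlas h n (\<gamma> 0) \<psi> \<delta> \<longrightarrow>
        ((\<lambda>t. ln (nth_eigenvalue p (\<delta> t (closed_curve_loop \<gamma> L)))) has_real_derivative r) (at 0))"

definition eigenvalue_const :: "nat \<Rightarrow> nat \<Rightarrow> nat \<Rightarrow> real" where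
  "eigenvalue_const n k p =
     fact (p - 1) * fact (n - p) / (2 ^ (k - 2) * fact (n - k)) *
     (\<Sum>j = max 1 (k + p - n)..min k p.
        real ((n - k) choose (p - j)) * (real ((k - 1) choose (j - 1)))\<^sup>2 * (- 1) ^ (j + k + 1))"

end

(*
  Along the geodesic use the frame dz^m of the bundle in which dz(gamma') = 1. By the geodesic
  equation D becomes d/ds + [H, .] there, with the constant symmetric matrix H = Y_n - X_n, and a
  deformation D + alpha_t becomes d/ds + [H + B_t(s), .] with B_t periodic. In an eigenbasis of H
  the transport along gamma is exp(-L H) (1 - t int_0^L e^{sH} B' e^{-sH} ds + o(t)), and since only
  scalars commute with sl(n), it is conjugate to a multiple of the holonomy. The eigenvalues of H
  are simple, so d log lambda^(p) is minus the integral of the p-th diagonal entry of B' in the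
  eigenbasis. The exact part D u of B' contributes the integral of a derivative of a periodic
  function, and psi0(q) contributes 2 Re q(gamma', ..., gamma') times the p-th diagonal entry of
  E_{k-1}. In the model of polynomials of degree < n, where -sqrt(2) X_n is d/dT, the eigenvectors
  of H are (1 + T)^a (1 - T)^(n-1-a), and this entry follows from the Leibniz rule.
*)
theory Submission
  imports Defs
begin

section \<open>Linear differential equations with small coefficients\<close>

text \<open>\<open>monodromy\<close> only constrains whatever parallel sections exist, and the curve
  \<open>\<delta> t\<close> carries no regularity in t. So parallel sections have to be constructed,
  and differentiability has to be extracted from them. Conjugating by e^(sH), the interaction
  picture, removes the constant part H exactly, however long the loop is, and leaves a coefficient
  of size O(t). For such a small coefficient the Picard series is dominated by a geometric one, and
  its tail gives the first-order term of the transport with an error O(t^2). The eigenvalues of the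
  holonomy are then read off from a similar matrix, known up to a scalar; the modulus of the scalar
  follows from det = 1, and it has no first-order effect because the forms are traceless. The power
  of 2 in the constant: restoring the degree lost in the (k-1)-st derivative with ((1 + T) + (1 -
  T)) / 2 gives 2^(k-1) in the denominator, and the 2 of twice the real part leaves 2^(k-2).\<close>

lemma has_vector_derivative_series:
  fixes f :: "nat \<Rightarrow> real \<Rightarrow> 'b::banach"
  assumes S: "convex S" "z \<in> S" "summable (\<lambda>k. f k z)"
    and der: "\<And>k x. x \<in> S \<Longrightarrow> (f k has_vector_derivative f' k x) (at x within S)"
    and bound: "\<And>k x. x \<in> S \<Longrightarrow> norm (f' k x) \<le> b k" "summable b"
    and x: "x \<in> S"
  shows "summable (\<lambda>k. f k x)" "((\<lambda>x. suminf (\<lambda>k. f k x)) has_vector_derivative (suminf (\<lambda>k. f' k x))) (at x within S)"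
proof -
  \<comment> \<open>The M-test supplies the uniform convergence of the derivatives on which termwise
    differentiation rests.\<close>
  have unif: "uniform_limit S (\<lambda>N x. \<Sum>k<N. f' k x) (\<lambda>x. suminf (\<lambda>k. f' k x)) sequentially"
    using bound by (rule Weierstrass_m_test)
  have "\<exists>g. \<forall>x\<in>S. (\<lambda>k. f k x) sums g x \<and> (g has_derivative (\<lambda>h. h *\<^sub>R (suminf (\<lambda>k. f' k x)))) (at x within S)"
  proof (rule has_derivative_series[OF S(1)])
    show "(f k has_derivative (\<lambda>h. h *\<^sub>R f' k x)) (at x within S)" if "x \<in> S" for k x
      using der[OF that] by (simp add: has_vector_derivative_def)
    show "\<forall>\<^sub>F N in sequentially. \<forall>x\<in>S. \<forall>h. norm ((\<Sum>i<N. h *\<^sub>R f' i x) - h *\<^sub>R (suminf (\<lambda>k. f' k x))) \<le> e * norm h"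
      if "e > 0" for e
      using uniform_limitD[OF unif that]
    proof eventually_elim
      case (elim N)
      show ?case
      proof (intro ballI allI)
        fix x h assume "x \<in> S"
        have "norm ((\<Sum>i<N. h *\<^sub>R f' i x) - h *\<^sub>R (suminf (\<lambda>k. f' k x))) = \<bar>h\<bar> * dist (\<Sum>i<N. f' i x) (suminf (\<lambda>k. f' k x))"
          by (simp add: dist_norm scaleR_sum_right[symmetric] scaleR_diff_right[symmetric] del: scaleR_sum_right)
        also have "\<dots> \<le> \<bar>h\<bar> * e"
          using elim \<open>x \<in> S\<close> by (intro mult_left_mono) (auto intro: less_imp_le)
        finally show "norm ((\<Sum>i<N. h *\<^sub>R f' i x) - h *\<^sub>R (suminf (\<lambda>k. f' k x))) \<le> e * norm h"
          by (simp add: mult.commute)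
      qed
    qed
  qed (use S in \<open>auto simp: summable_sums\<close>)
  then obtain g where g: "\<And>x. x \<in> S \<Longrightarrow> (\<lambda>k. f k x) sums g x"
    "\<And>x. x \<in> S \<Longrightarrow> (g has_vector_derivative (suminf (\<lambda>k. f' k x))) (at x within S)"
    by (auto simp: has_vector_derivative_def)
  show "summable (\<lambda>k. f k x)" using g(1)[OF x] by (rule sums_summable)
  show "((\<lambda>x. suminf (\<lambda>k. f k x)) has_vector_derivative (suminf (\<lambda>k. f' k x))) (at x within S)"
    using g(2)[OF x]
    by (rule has_vector_derivative_transform[rotated 2]) (use g(1) x in \<open>auto simp: sums_iff\<close>)
qed

text \<open>The k-th term of the Peano-Baker series, an iterated integral, rather than the k-th
  Picard iterate: the solution of Q' = C Q with Q 0 = 1 is the sum of these terms.\<close>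

primrec picard :: "(real \<Rightarrow> nat \<Rightarrow> nat \<Rightarrow> complex) \<Rightarrow> nat \<Rightarrow> nat \<Rightarrow> real \<Rightarrow> nat \<Rightarrow> nat \<Rightarrow> complex" where
  "picard C n 0 s i j = (if i = j then 1 else 0)"
| "picard C n (Suc k) s i j = integral {0..s} (\<lambda>r. \<Sum>l<n. C r i l * picard C n k r l j)"

context
  fixes C :: "real \<Rightarrow> nat \<Rightarrow> nat \<Rightarrow> complex" and n :: nat and \<beta> :: real
  assumes cont: "\<And>i j. i < n \<Longrightarrow> j < n \<Longrightarrow> continuous_on {0..1} (\<lambda>s. C s i j)"
    and bound: "\<And>s i j. s \<in> {0..1} \<Longrightarrow> i < n \<Longrightarrow> j < n \<Longrightarrow> norm (C s i j) \<le> \<beta>"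
begin

text \<open>The bound for k is an explicit premise, so that the same facts serve the induction in
  \<open>picard_bound\<close> and, once that is done, hold unconditionally as
  \<open>picard_derivative\<close>.\<close>

lemma picard_step:
  assumes P: "\<forall>i<n. \<forall>j<n. continuous_on {0..1} (\<lambda>s. picard C n k s i j) \<and>
      (\<forall>s\<in>{0..1}. norm (picard C n k s i j) \<le> (real n * \<beta>) ^ k)"
    and ij: "i < n" "j < n"
  shows "continuous_on {0..1} (\<lambda>s. \<Sum>l<n. C s i l * picard C n k s l j)"
    and "s \<in> {0..1} \<Longrightarrow> ((\<lambda>s. picard C n (Suc k) s i j) has_vector_derivative
        (\<Sum>l<n. C s i l * picard C n k s l j)) (at s within {0..1})"
    and "s \<in> {0..1} \<Longrightarrow> norm (\<Sum>l<n. C s i l * picard C n k s l j) \<le> (real n * \<beta>) ^ Suc k"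
proof -
  show c: "continuous_on {0..1} (\<lambda>s. \<Sum>l<n. C s i l * picard C n k s l j)"
    using P ij cont by (intro continuous_intros) auto
  assume s: "s \<in> {0..1}"
  show "((\<lambda>s. picard C n (Suc k) s i j) has_vector_derivative
      (\<Sum>l<n. C s i l * picard C n k s l j)) (at s within {0..1})"
    using integral_has_vector_derivative[OF c s] by simp
  have "0 \<le> \<beta>" using bound[OF s ij] norm_ge_zero order_trans by blast
  have "norm (C s i l * picard C n k s l j) \<le> \<beta> * (real n * \<beta>) ^ k" if "l < n" for l
    unfolding norm_mult using P ij s bound \<open>0 \<le> \<beta>\<close> that by (intro mult_mono) auto
  then have "norm (\<Sum>l<n. C s i l * picard C n k s l j) \<le> (\<Sum>l<n. \<beta> * (real n * \<beta>) ^ k)"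
    by (intro sum_norm_le) auto
  then show "norm (\<Sum>l<n. C s i l * picard C n k s l j) \<le> (real n * \<beta>) ^ Suc k"
    by (simp add: mult_ac)
qed

lemma picard_bound:
  "\<forall>i<n. \<forall>j<n. continuous_on {0..1} (\<lambda>s. picard C n k s i j) \<and>
      (\<forall>s\<in>{0..1}. norm (picard C n k s i j) \<le> (real n * \<beta>) ^ k)"
proof (induction k)
  case (Suc k)
  note step = picard_step[OF Suc]
  show ?case
  proof (intro allI impI conjI ballI)
    fix i j assume ij: "i < n" "j < n"
    show "continuous_on {0..1} (\<lambda>s. picard C n (Suc k) s i j)"
      by (rule continuous_on_vector_derivative[OF step(2)[OF ij]])
    fix s :: real assume s: "s \<in> {0..1}"
    have "0 \<le> \<beta>" using bound[OF s ij] norm_ge_zero order_trans by blast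
    \<comment> \<open>The interval has length s <= 1, so integrating keeps the bound; the gain 1/k!
      of the sharp estimate is given up.\<close>
    have "norm (picard C n (Suc k) s i j) \<le> (real n * \<beta>) ^ Suc k * (s - 0)"
      unfolding picard.simps
      using s step(1,3)[OF ij] 
      by (intro integral_bound) (auto intro: continuous_on_subset simp del: power_Suc)
    also have "\<dots> \<le> (real n * \<beta>) ^ Suc k * 1"
      using s \<open>0 \<le> \<beta>\<close> by (intro mult_left_mono) auto
    finally show "norm (picard C n (Suc k) s i j) \<le> (real n * \<beta>) ^ Suc k" by simp
  qed
qed auto

lemmas picard_derivative = picard_step(2,3)[OF picard_bound]

text \<open>The Picard series is dominated by a geometric series, which also controls its tail.\<close>

lemma small_linear_ode:
  assumes \<beta>: "0 \<le> \<beta>" "real n * \<beta> \<le> 1 / 2"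
  obtains Q where
    "\<And>i j. i < n \<Longrightarrow> j < n \<Longrightarrow> Q 0 i j = (if i = j then 1 else 0)"
    "\<And>s i j. s \<in> {0..1} \<Longrightarrow> i < n \<Longrightarrow> j < n \<Longrightarrow>
       ((\<lambda>s. Q s i j) has_vector_derivative (\<Sum>l<n. C s i l * Q s l j)) (at s within {0..1})"
    "\<And>i j. i < n \<Longrightarrow> j < n \<Longrightarrow>
       norm (Q 1 i j - (if i = j then 1 else 0) - integral {0..1} (\<lambda>s. C s i j)) \<le> 2 * (real n * \<beta>)\<^sup>2"
proof -
  define Q where "Q s i j = (suminf (\<lambda>k. picard C n k s i j))" for s i j
  let ?b = "real n * \<beta>"
  have b: "0 \<le> ?b" "?b < 1" using \<beta> by auto
  have sumb: "summable (\<lambda>k. ?b ^ k)" using b by (intro summable_geometric) auto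
  have summ: "summable (\<lambda>k. norm (picard C n k s i j))" if "s \<in> {0..1}" "i < n" "j < n" for s i j
    using sumb by (rule summable_comparison_test') (use picard_bound that in auto)
  have Q0: "Q 0 i j = (if i = j then 1 else 0)" if "i < n" "j < n" for i j
  proof -
    have "picard C n k 0 i j = (if k = 0 then if i = j then 1 else 0 else 0)" for k
      by (cases k) auto
    then show ?thesis unfolding Q_def by (subst suminf_finite[of "{0}"]) auto
  qed
  have dQ: "((\<lambda>s. Q s i j) has_vector_derivative (\<Sum>l<n. C s i l * Q s l j)) (at s within {0..1})"
    if s: "s \<in> {0..1}" and ij: "i < n" "j < n" for s i j
  proof -
    \<comment> \<open>Term 0 is constant and term k + 1 has derivative C times term k, so the series
      of derivatives is a shift of the original series.\<close>
    define f' where "f' k s = (case k of 0 \<Rightarrow> 0 | Suc k \<Rightarrow> \<Sum>l<n. C s i l * picard C n k s l j)" for k s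
    have "((\<lambda>s. suminf (\<lambda>k. picard C n k s i j)) has_vector_derivative (suminf (\<lambda>k. f' k s))) (at s within {0..1})"
    proof (rule has_vector_derivative_series(2)[where f = "\<lambda>k s. picard C n k s i j" and f' = f' and b = "\<lambda>k. ?b ^ k" and z = 0])
      show "((\<lambda>s. picard C n k s i j) has_vector_derivative f' k x) (at x within {0..1})" if "x \<in> {0..1}" for k x
        using picard_derivative(1)[OF ij that, of "k - 1"] by (cases k) (simp_all add: f'_def del: picard.simps(2))
      show "norm (f' k x) \<le> ?b ^ k" if "x \<in> {0..1}" for k x
        using picard_derivative(2)[OF ij that, of "k - 1"] by (cases k) (simp_all add: f'_def del: picard.simps(2))
      show "summable (\<lambda>k. picard C n k 0 i j)" using summ[of 0 i j] ij by (simp add: summable_norm_cancel)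
    qed (use s sumb in \<open>simp_all\<close>)
    moreover have "(suminf (\<lambda>k. f' k s)) = (\<Sum>l<n. C s i l * Q s l j)"
    proof -
      have sl: "summable (\<lambda>k. C s i l * picard C n k s l j)" if "l < n" for l
        using summ[OF s that ij(2)] by (intro summable_mult) (rule summable_norm_cancel)
      have "summable (\<lambda>k. f' (Suc k) s)"
        unfolding f'_def nat.case using sl by (intro summable_sum) auto
      then have "(suminf (\<lambda>k. f' k s)) = (suminf (\<lambda>k. f' (Suc k) s))"
        using suminf_split_head[of "\<lambda>k. f' k s"] summable_Suc_iff[of "\<lambda>k. f' k s"] by (simp add: f'_def)
      also have "\<dots> = (\<Sum>l<n. suminf (\<lambda>k. C s i l * picard C n k s l j))"
        unfolding f'_def nat.case using sl by (intro suminf_sum) auto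
      also have "\<dots> = (\<Sum>l<n. C s i l * Q s l j)"
        unfolding Q_def using summ[OF s _ ij(2)]
        by (intro sum.cong suminf_mult) (auto intro: summable_norm_cancel)
      finally show ?thesis .
    qed
    ultimately show ?thesis unfolding Q_def by simp
  qed
  have est: "norm (Q 1 i j - (if i = j then 1 else 0) - integral {0..1} (\<lambda>s. C s i j)) \<le> 2 * ?b\<^sup>2"
    if ij: "i < n" "j < n" for i j
  proof -
    have s: "summable (\<lambda>k. picard C n k 1 i j)" using summ[of 1] ij by (auto intro: summable_norm_cancel)
    have p1: "picard C n 1 1 i j = integral {0..1} (\<lambda>s. C s i j)"
      using ij by (auto intro!: Henstock_Kurzweil_Integration.integral_cong simp: if_distrib cong: if_cong)
    \<comment> \<open>Terms 0 and 1 are the identity and the integral of C. The remaining tail is at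
      most b^2 / (1 - b), hence at most 2 b^2 because b <= 1/2.\<close>
    have "(suminf (\<lambda>k. picard C n (k + 2) 1 i j)) = Q 1 i j - (if i = j then 1 else 0) - integral {0..1} (\<lambda>s. C s i j)"
      unfolding Q_def suminf_minus_initial_segment[OF s] p1[symmetric] by (simp add: numeral_2_eq_2)
    moreover have "norm (suminf (\<lambda>k. picard C n (k + 2) 1 i j)) \<le> (suminf (\<lambda>k. ?b\<^sup>2 * ?b ^ k))"
    proof -
      have *: "norm (picard C n (k + 2) 1 i j) \<le> ?b\<^sup>2 * ?b ^ k" for k
        using picard_bound[of "k+2"] ij by (simp add: power_add power2_eq_square mult_ac del: picard.simps)
      have sm: "summable (\<lambda>k. ?b\<^sup>2 * ?b ^ k)" using sumb by (rule summable_mult)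
      show ?thesis
        using * sm by (rule norm_suminf_le)
    qed
    moreover have "(suminf (\<lambda>k. ?b\<^sup>2 * ?b ^ k)) = ?b\<^sup>2 * (1 / (1 - ?b))"
      using sumb b by (simp add: suminf_mult suminf_geometric)
    moreover have "?b\<^sup>2 * (1 / (1 - ?b)) \<le> ?b\<^sup>2 * 2"
      using b \<beta> by (intro mult_left_mono) (auto simp: field_simps)
    ultimately show ?thesis by (simp only: mult.commute[of 2])
  qed
  from that[OF Q0 dQ est] show thesis .
qed

end

section \<open>Perturbation of simple eigenvalues\<close>

lemma has_vector_derivative_at_0_iff:
  fixes f :: "real \<Rightarrow> 'b::real_normed_vector"
  shows "(f has_vector_derivative d) (at 0) \<longleftrightarrow> ((\<lambda>t. (f t - f 0) /\<^sub>R t) \<longlongrightarrow> d) (at 0)"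
proof -
  have "(f has_vector_derivative d) (at 0) \<longleftrightarrow>
      ((\<lambda>t. norm (f t - f 0 - t *\<^sub>R d) / norm t) \<longlongrightarrow> 0) (at 0)"
    unfolding has_vector_derivative_def has_derivative_iff_norm by (simp add: bounded_linear_scaleR_left)
  also have "\<dots> \<longleftrightarrow> ((\<lambda>t. norm ((f t - f 0) /\<^sub>R t - d)) \<longlongrightarrow> 0) (at 0)"
  proof (rule filterlim_cong[OF refl refl])
    show "\<forall>\<^sub>F t in at 0. norm (f t - f 0 - t *\<^sub>R d) / norm t = norm ((f t - f 0) /\<^sub>R t - d)"
      unfolding eventually_at_filter
    proof (intro always_eventually allI impI)
      fix t :: real assume "t \<noteq> 0"
      then have "f t - f 0 - t *\<^sub>R d = t *\<^sub>R ((f t - f 0) /\<^sub>R t - d)"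
        by (simp add: scaleR_diff_right)
      then show "norm (f t - f 0 - t *\<^sub>R d) / norm t = norm ((f t - f 0) /\<^sub>R t - d)"
        using \<open>t \<noteq> 0\<close> by (simp only: norm_scaleR) simp
    qed
  qed
  also have "\<dots> \<longleftrightarrow> ((\<lambda>t. (f t - f 0) /\<^sub>R t) \<longlongrightarrow> d) (at 0)"
    by (simp add: tendsto_norm_zero_iff LIM_zero_iff)
  finally show ?thesis .
qed

text \<open>As F vanishes at 0, the difference quotient of F G is that of F times G, so a limit of G
  is enough. Here G will be the inverse of a product of root differences, known at that stage to be
  continuous only.\<close>

lemma has_vector_derivative_times_continuous:
  fixes F G :: "real \<Rightarrow> complex"
  assumes "(F has_vector_derivative d) (at 0)" "F 0 = 0" "(G \<longlongrightarrow> c) (at 0)"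
  shows "((\<lambda>t. F t * G t) has_vector_derivative d * c) (at 0)"
  using tendsto_mult[OF assms(1)[unfolded has_vector_derivative_at_0_iff] assms(3)] assms(2)
  unfolding has_vector_derivative_at_0_iff by simp

text \<open>To first order at a diagonal matrix with a zero in place p, only the identity
  permutation contributes, and in it only the term that differentiates the factor p.\<close>

lemma det_has_vector_derivative_diag:
  fixes B :: "real \<Rightarrow> complex mat"
  assumes B: "\<And>t. B t \<in> carrier_mat n n" and p: "p < n" "B 0 $$ (p, p) = 0"
    and diag: "\<And>i j. i < n \<Longrightarrow> j < n \<Longrightarrow> i \<noteq> j \<Longrightarrow> B 0 $$ (i, j) = 0"
    and der: "\<And>i j. i < n \<Longrightarrow> j < n \<Longrightarrow> ((\<lambda>t. B t $$ (i, j)) has_vector_derivative M i j) (at 0)"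
  shows "((\<lambda>t. Determinant.det (B t)) has_vector_derivative M p p * (\<Prod>i\<in>{..<n} - {p}. B 0 $$ (i, i))) (at 0)"
proof -
  let ?I = "{0..<n}" let ?S = "{\<pi>. \<pi> permutes ?I}"
  let ?P = "\<lambda>\<pi> i. \<Prod>j\<in>?I - {i}. B 0 $$ (j, \<pi> j)"
  have fin: "finite ?S" by (rule finite_permutations) simp
  have perm: "\<pi> i < n" if "\<pi> permutes ?I" "i < n" for \<pi> i
    using permutes_in_image[OF that(1), of i] that(2) by simp
  have "((\<lambda>t. \<Sum>\<pi>\<in>?S. signof \<pi> * (\<Prod>i\<in>?I. B t $$ (i, \<pi> i))) has_derivative
      (\<lambda>y. \<Sum>\<pi>\<in>?S. signof \<pi> * (\<Sum>i\<in>?I. (y *\<^sub>R M i (\<pi> i)) * ?P \<pi> i))) (at 0)"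
    by (intro has_derivative_sum has_derivative_mult_right has_derivative_prod
        der[unfolded has_vector_derivative_def]) (auto simp: perm)
  moreover have "(\<Sum>\<pi>\<in>?S. signof \<pi> * (\<Sum>i\<in>?I. (y *\<^sub>R M i (\<pi> i)) * ?P \<pi> i)) =
      y *\<^sub>R (M p p * (\<Prod>i\<in>{..<n} - {p}. B 0 $$ (i, i)))" for y
  proof -
    \<comment> \<open>A permutation other than the identity moves at least two points, so after
      removing the factor i an off-diagonal zero remains.\<close>
    have zero: "?P \<pi> i = 0" if pi: "\<pi> permutes ?I" and ne: "\<pi> \<noteq> id" for \<pi> i
    proof -
      obtain a where a: "a < n" "\<pi> a \<noteq> a"
        using pi ne by (metis atLeastLessThan_iff order_refl permutes_natset_le)
      have "\<pi> (\<pi> a) \<noteq> \<pi> a" using permutes_inj[OF pi] a by (auto dest: injD)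
      then obtain b where b: "b < n" "\<pi> b \<noteq> b" "b \<noteq> i"
        using a perm[OF pi] by metis
      then show ?thesis using diag perm[OF pi] by (intro prod_zero) (auto intro!: bexI[of _ b])
    qed
    have zero_id: "?P id i = 0" if "i \<noteq> p" for i
      using that p by (intro prod_zero) (auto intro!: bexI[of _ p])
    have "(\<Sum>\<pi>\<in>?S. signof \<pi> * (\<Sum>i\<in>?I. (y *\<^sub>R M i (\<pi> i)) * ?P \<pi> i)) =
        (\<Sum>\<pi>\<in>{id}. signof \<pi> * (\<Sum>i\<in>?I. (y *\<^sub>R M i (\<pi> i)) * ?P \<pi> i))"
      using fin by (intro sum.mono_neutral_right) (auto simp: permutes_id zero)
    also have "\<dots> = (\<Sum>i\<in>?I. (y *\<^sub>R M i i) * ?P id i)" by simp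
    also have "\<dots> = (\<Sum>i\<in>{p}. (y *\<^sub>R M i i) * ?P id i)"
      using p zero_id by (intro sum.mono_neutral_right) auto
    finally show ?thesis by (simp add: lessThan_atLeast0)
  qed
  ultimately show ?thesis
    unfolding has_vector_derivative_def det_def'[OF B] by simp
qed

lemma finite_positive_lower_bound:
  fixes g :: "'b \<Rightarrow> real"
  assumes "finite F" "\<And>x. x \<in> F \<Longrightarrow> g x > 0"
  shows "\<exists>e>0. \<forall>x\<in>F. e \<le> g x"
  using assms
proof (induction F rule: finite_induct)
  case (insert x F)
  then obtain e where "e > 0" "\<forall>x\<in>F. e \<le> g x" by auto
  then show ?case using insert.prems[of x] by (intro exI[of _ "min e (g x)"]) auto
qed (auto intro: exI[of _ 1])

text \<open>Simple roots of a monic polynomial: for small \<open>t\<close> there is one root near each \<open>\<mu> p\<close>, hence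
  these are all roots, and \<open>poly (f t) (\<mu> p)\<close> is \<open>\<mu> p - r t p\<close> times a factor bounded away from \<open>0\<close>.\<close>

lemma simple_roots_differentiable:
  fixes f :: "real \<Rightarrow> complex poly" and \<mu> :: "nat \<Rightarrow> complex"
  assumes monic: "\<And>t. degree (f t) = n" "\<And>t. lead_coeff (f t) = 1"
    and inj: "inj_on \<mu> {..<n}"
    and zero: "\<And>p. p < n \<Longrightarrow> poly (f 0) (\<mu> p) = 0"
    and der: "\<And>p. p < n \<Longrightarrow> ((\<lambda>t. poly (f t) (\<mu> p)) has_vector_derivative d p) (at 0)"
  obtains r where "\<And>p. p < n \<Longrightarrow> r 0 p = \<mu> p"
    "\<forall>\<^sub>F t in nhds 0. f t = (\<Prod>p<n. [:- r t p, 1:])"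
    "\<And>p. p < n \<Longrightarrow> ((\<lambda>t. r t p) has_vector_derivative - d p / (\<Prod>i\<in>{..<n} - {p}. \<mu> p - \<mu> i)) (at 0)"
proof -
  have "\<exists>e>0. \<forall>x\<in>{(i, j). i < n \<and> j < n \<and> i \<noteq> j}. e \<le> dist (\<mu> (fst x)) (\<mu> (snd x))"
    by (rule finite_positive_lower_bound, rule finite_subset[of _ "{..<n} \<times> {..<n}"])
       (use inj in \<open>auto dest: inj_onD\<close>)
  then obtain e' where "e' > 0" and e': "\<And>i j. i < n \<Longrightarrow> j < n \<Longrightarrow> i \<noteq> j \<Longrightarrow> e' \<le> dist (\<mu> i) (\<mu> j)"
    by fastforce
  define e where "e = e' / 2"
  \<comment> \<open>The radius is half a lower bound for the distances of the \<mu> p, so the discs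
    of radius e around them are disjoint.\<close>
  have e: "e > 0" using \<open>e' > 0\<close> by (simp add: e_def)
  have gap: "2 * e \<le> dist (\<mu> i) (\<mu> j)" if "i < n" "j < n" "i \<noteq> j" for i j
    using e'[OF that] by (simp add: e_def)
  define r where "r t p = (SOME z. poly (f t) z = 0 \<and> dist z (\<mu> p) < e)" for t p
  have r: "poly (f t) (r t p) = 0 \<and> dist (r t p) (\<mu> p) < e"
    if "\<exists>z. poly (f t) z = 0 \<and> dist z (\<mu> p) < e" for t p
    unfolding r_def using that by (rule someI_ex)
  have factors: thesis if "\<And>as. f t = (\<Prod>a\<leftarrow>as. [:- a, 1:]) \<Longrightarrow> length as = n \<Longrightarrow> thesis" for t thesis
  proof -
    obtain as where "Polynomial.smult (lead_coeff (f t)) (\<Prod>a\<leftarrow>as. [:- a, 1:]) = f t" "length as = degree (f t)"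
      using fundamental_theorem_algebra_factorized by blast
    then show ?thesis using monic by (intro that[of as]) auto
  qed
  \<comment> \<open>Without a root within e of \<mu> p, the product of the n distances from \<mu> p
    to the roots would be at least e^n.\<close>
  have near: "\<exists>z. poly (f t) z = 0 \<and> dist z (\<mu> p) < e" if "cmod (poly (f t) (\<mu> p)) < e ^ n" for t p
  proof (rule ccontr)
    assume "\<not> ?thesis"
    then have far: "e \<le> dist z (\<mu> p)" if "poly (f t) z = 0" for z using that by force
    obtain as where fe: "f t = (\<Prod>a\<leftarrow>as. [:- a, 1:])" "length as = n" by (rule factors)
    have "poly (f t) (\<mu> p) = (\<Prod>a\<leftarrow>as. \<mu> p - a)"
      unfolding fe by (simp add: poly_prod_list o_def)
    moreover have "poly (f t) a = 0" if "a \<in> set as" for a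
      unfolding fe using that by (auto simp: poly_prod_list prod_list_zero_iff o_def)
    then have "e ^ length as \<le> cmod (\<Prod>a\<leftarrow>as. \<mu> p - a)"
      using far
    proof (induction as)
      case (Cons a as)
      have "e * e ^ length as \<le> cmod (\<mu> p - a) * cmod (\<Prod>a\<leftarrow>as. \<mu> p - a)"
        using Cons.IH Cons.prems(1)[of a] Cons.prems e
        by (intro mult_mono) (auto simp: dist_norm norm_minus_commute)
      then show ?case by (simp add: norm_mult)
    qed auto
    ultimately show False using that fe by simp
  qed
  have ptend: "((\<lambda>t. poly (f t) (\<mu> p)) \<longlongrightarrow> 0) (nhds 0)" if "p < n" for p
  proof -
    have "isCont (\<lambda>t. poly (f t) (\<mu> p)) 0"
      using der[OF that] by (rule has_vector_derivative_continuous)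
    then have "((\<lambda>t. poly (f t) (\<mu> p)) \<longlongrightarrow> poly (f 0) (\<mu> p)) (at 0)"
      by (simp add: isCont_def)
    then have "((\<lambda>t. poly (f t) (\<mu> p)) \<longlongrightarrow> poly (f 0) (\<mu> p)) (nhds 0)"
      by (rule tendsto_at_iff_tendsto_nhds[THEN iffD1])
    then show ?thesis by (simp only: zero[OF that])
  qed
  have ev0: "\<forall>\<^sub>F t in nhds 0. cmod (poly (f t) (\<mu> p)) < e ^ n" if "p < n" for p
  proof -
    from tendsto_norm[OF ptend[OF that]] show ?thesis by (rule order_tendstoD) (use e in simp)
  qed
  then have ev: "\<forall>\<^sub>F t in nhds 0. \<forall>p\<in>{..<n}. cmod (poly (f t) (\<mu> p)) < e ^ n"
    by (intro eventually_ball_finite) auto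
  have fact: "f t = (\<Prod>p<n. [:- r t p, 1:]) \<and> (\<forall>p<n. dist (r t p) (\<mu> p) < e)"
    if "\<forall>p\<in>{..<n}. cmod (poly (f t) (\<mu> p)) < e ^ n" for t
  proof -
    have R: "poly (f t) (r t p) = 0" "dist (r t p) (\<mu> p) < e" if "p < n" for p
      using r[OF near] \<open>\<forall>p\<in>_. _\<close> that by auto
    \<comment> \<open>The chosen roots lie in disjoint discs. Being n in number, they exhaust the
      list \<open>as\<close> of all roots below, which therefore has no repetition.\<close>
    have injr: "inj_on (r t) {..<n}"
    proof (rule inj_onI, rule ccontr)
      fix i j assume ij: "i \<in> {..<n}" "j \<in> {..<n}" "r t i = r t j" "i \<noteq> j"
      have "dist (\<mu> i) (\<mu> j) \<le> dist (r t i) (\<mu> i) + dist (r t j) (\<mu> j)"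
        using ij(3) by (metis dist_commute dist_triangle)
      then show False using R(2)[of i] R(2)[of j] gap[of i j] ij by auto
    qed
    obtain as where as: "f t = (\<Prod>a\<leftarrow>as. [:- a, 1:])" "length as = n" by (rule factors)
    have "r t ` {..<n} \<subseteq> set as"
      using R(1) unfolding as by (force simp: poly_prod_list prod_list_zero_iff o_def)
    moreover have "card (r t ` {..<n}) = n" using card_image[OF injr] by simp
    moreover from calculation have "card (set as) = n"
      using card_length[of as] as(2) card_mono[of "set as" "r t ` {..<n}"] by simp
    ultimately have "r t ` {..<n} = set as" "card (set as) = length as"
      using as(2) card_subset_eq[of "set as" "r t ` {..<n}"] by simp_all
    then have "f t = (\<Prod>a\<in>r t ` {..<n}. [:- a, 1:])"
      unfolding as(1) by (simp add: prod.distinct_set_conv_list card_distinct)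
    then show ?thesis using R(2) by (simp add: prod.reindex[OF injr])
  qed
  have ev1: "\<forall>\<^sub>F t in nhds 0. f t = (\<Prod>p<n. [:- r t p, 1:]) \<and> (\<forall>p<n. dist (r t p) (\<mu> p) < e)"
    using ev by eventually_elim (rule fact)
  have cof: "cmod (\<Prod>i\<in>{..<n} - {p}. \<mu> p - r t i) \<ge> e ^ (n - 1)"
    if "p < n" "\<forall>p<n. dist (r t p) (\<mu> p) < e" for t p
  proof -
    \<comment> \<open>The centres are \<open>2 * e\<close> apart and the root has moved by less than
      \<open>e\<close>.\<close>
    have "e \<le> cmod (\<mu> p - r t i)" if "i < n" "i \<noteq> p" for i
      using gap[OF \<open>p < n\<close> that(1)] that \<open>\<forall>p<n. _\<close> dist_triangle2[of "\<mu> p" "\<mu> i" "r t i"]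
      by (fastforce simp: dist_norm norm_minus_commute)
    then have "(\<Prod>i\<in>{..<n} - {p}. e) \<le> (\<Prod>i\<in>{..<n} - {p}. cmod (\<mu> p - r t i))"
      using e by (intro prod_mono) auto
    then show ?thesis using that(1) by (simp add: prod_norm)
  qed
  have r_eq: "r t p - \<mu> p = poly (f t) (\<mu> p) * (- inverse (\<Prod>i\<in>{..<n} - {p}. \<mu> p - r t i))"
    if "p < n" "f t = (\<Prod>p<n. [:- r t p, 1:])" "\<forall>p<n. dist (r t p) (\<mu> p) < e" for t p
  proof -
    have "poly (f t) (\<mu> p) = (\<Prod>i<n. \<mu> p - r t i)"
      by (subst that(2)) (simp add: poly_prod)
    also have "\<dots> = (\<mu> p - r t p) * (\<Prod>i\<in>{..<n} - {p}. \<mu> p - r t i)"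
      using that(1) by (subst prod.remove[of _ p]) auto
    finally have "poly (f t) (\<mu> p) = (\<mu> p - r t p) * (\<Prod>i\<in>{..<n} - {p}. \<mu> p - r t i)" .
    moreover have "(\<Prod>i\<in>{..<n} - {p}. \<mu> p - r t i) \<noteq> 0"
      using cof[OF that(1,3)] e by (metis linorder_not_le norm_zero zero_less_power)
    ultimately show ?thesis by (simp add: field_simps)
  qed
  have r0: "r 0 p = \<mu> p" if "p < n" for p
    using r_eq[OF that, of 0] zero[OF that] eventually_nhds_x_imp_x[OF ev1] by simp
  have lim: "((\<lambda>t. r t p) \<longlongrightarrow> \<mu> p) (nhds 0)" if p: "p < n" for p
  proof -
    from tendsto_divide[OF tendsto_norm_zero[OF ptend[OF p]] tendsto_const[of "e ^ (n - 1)"]]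
    have "((\<lambda>t. cmod (poly (f t) (\<mu> p)) / e ^ (n - 1)) \<longlongrightarrow> 0) (nhds 0)"
      using e by simp
    then have "((\<lambda>t. r t p - \<mu> p) \<longlongrightarrow> 0) (nhds 0)"
    proof (rule Lim_null_comparison[rotated])
      show "\<forall>\<^sub>F t in nhds 0. norm (r t p - \<mu> p) \<le> cmod (poly (f t) (\<mu> p)) / e ^ (n - 1)"
        using ev1
      proof eventually_elim
        case (elim t)
        have "cmod (poly (f t) (\<mu> p)) / cmod (\<Prod>i\<in>{..<n} - {p}. \<mu> p - r t i) \<le> cmod (poly (f t) (\<mu> p)) / e ^ (n - 1)"
          using cof[OF p] elim less_le_trans[of 0 "e ^ (n - 1)" "cmod (\<Prod>i\<in>{..<n} - {p}. \<mu> p - r t i)"] e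
          by (intro divide_left_mono mult_pos_pos) auto
        then show ?case
          using r_eq[OF p] elim by (simp add: norm_mult norm_inverse divide_inverse)
      qed
    qed
    then show ?thesis by (simp add: Lim_null[symmetric] LIM_zero_iff)
  qed
  have dr: "((\<lambda>t. r t p) has_vector_derivative - d p / (\<Prod>i\<in>{..<n} - {p}. \<mu> p - \<mu> i)) (at 0)" if p: "p < n" for p
  proof -
    have "((\<lambda>t. - inverse (\<Prod>i\<in>{..<n} - {p}. \<mu> p - r t i)) \<longlongrightarrow> - inverse (\<Prod>i\<in>{..<n} - {p}. \<mu> p - \<mu> i)) (at 0)"
    proof (intro tendsto_minus tendsto_inverse tendsto_prod tendsto_diff tendsto_const)
      show "((\<lambda>t. r t i) \<longlongrightarrow> \<mu> i) (at 0)" if "i \<in> {..<n} - {p}" for i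
        using lim[of i] that filterlim_mono[OF _ order_refl at_within_le_nhds] by auto
      show "(\<Prod>i\<in>{..<n} - {p}. \<mu> p - \<mu> i) \<noteq> 0" using inj p by (auto dest: inj_onD)
    qed
    from has_vector_derivative_times_continuous[OF der[OF p] zero[OF p] this]
    have "((\<lambda>t. r t p - \<mu> p) has_vector_derivative d p * (- inverse (\<Prod>i\<in>{..<n} - {p}. \<mu> p - \<mu> i))) (at 0)"
      unfolding has_vector_derivative_def
    proof (rule has_derivative_transform_eventually)
      show "\<forall>\<^sub>F t in at 0. poly (f t) (\<mu> p) * (- inverse (\<Prod>i\<in>{..<n} - {p}. \<mu> p - r t i)) = r t p - \<mu> p"
        using eventually_nhds_conv_at[THEN iffD1, OF ev1, THEN conjunct1]
        by eventually_elim (use r_eq[OF p] in simp)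
    qed (use r0[OF p] zero[OF p] in auto)
    from has_vector_derivative_add[OF this has_vector_derivative_const[of "\<mu> p"]]
    show ?thesis by (simp add: divide_inverse)
  qed
  show thesis
    by (rule that[OF r0 eventually_mono[OF ev1] dr]) auto
qed


section \<open>Characteristic polynomials and moduli of eigenvalues\<close>

lemma char_poly_smult_linear_factors:
  fixes A :: "complex mat"
  assumes A: "A \<in> carrier_mat n n" and c: "c \<noteq> 0" and cp: "char_poly A = (\<Prod>i<n. [:- r i, 1:])"
  shows "char_poly (c \<cdot>\<^sub>m A) = (\<Prod>i<n. [:- (c * r i), 1:])"
proof -
  have "poly (char_poly (c \<cdot>\<^sub>m A)) z = poly (\<Prod>i<n. [:- (c * r i), 1:]) z" for z
  proof -
    \<comment> \<open>The identity z - c A = c (z/c - A), which yields det (z - c A) = c^n det (z/c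
      - A).\<close>
    have "- char_matrix (c \<cdot>\<^sub>m A) z = c \<cdot>\<^sub>m (- char_matrix A (z / c))"
      using A c unfolding char_matrix_def by (intro eq_matI) (auto simp: field_simps)
    then have "poly (char_poly (c \<cdot>\<^sub>m A)) z = c ^ n * poly (char_poly A) (z / c)"
      using A carrier_matD(2)[OF char_matrix_closed[OF A, of "z / c"]] by (simp add: char_poly_matrix[of _ n])
    also have "\<dots> = (\<Prod>i<n. c * (z / c - r i))"
      unfolding cp by (simp add: poly_prod prod.distrib)
    also have "\<dots> = poly (\<Prod>i<n. [:- (c * r i), 1:]) z"
      using c by (simp add: poly_prod algebra_simps)
    finally show ?thesis .
  qed
  then show ?thesis by (simp add: poly_eq_poly_eq_iff[symmetric] fun_eq_iff)
qed

lemma det_eq_prod_roots: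
  fixes A :: "complex mat"
  assumes A: "A \<in> carrier_mat n n" and cp: "char_poly A = (\<Prod>i<n. [:- r i, 1:])"
  shows "Determinant.det A = (\<Prod>i<n. r i)"
proof -
  have "- char_matrix A 0 = (- 1) \<cdot>\<^sub>m A"
    using A unfolding char_matrix_def by (intro eq_matI) auto
  then have "(- 1) ^ n * Determinant.det A = poly (char_poly A) 0"
    using A by (simp add: char_poly_matrix[of _ n])
  also have "\<dots> = (\<Prod>i<n. - 1 * r i)" unfolding cp by (simp add: poly_prod)
  also have "\<dots> = (- 1) ^ n * (\<Prod>i<n. r i)" by (subst prod.distrib) simp
  finally show ?thesis by simp
qed

text \<open>Strictly decreasing moduli make the given enumeration the reverse of the sorted list, so
  the p-th largest sits at index p - 1.\<close>

lemma nth_eigenvalue_eq: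
  fixes A :: "real mat"
  assumes cp: "char_poly (map_mat complex_of_real A) = (\<Prod>i<n. [:- a i, 1:])"
    and anti: "\<And>i j. i < j \<Longrightarrow> j < n \<Longrightarrow> cmod (a j) < cmod (a i)"
    and p: "1 \<le> p" "p \<le> n"
  shows "nth_eigenvalue p A = cmod (a (p - 1))"
proof -
  let ?xs = "map (\<lambda>i. cmod (a i)) [0..<n]"
  have "proots (char_poly (map_mat complex_of_real A)) = (\<Sum>i<n. {#a i#})"
    unfolding cp by (subst proots_prod) auto
  also have "\<dots> = mset (map a [0..<n])"
    by (induction n) auto
  finally have "image_mset cmod (proots (char_poly (map_mat complex_of_real A))) = mset ?xs"
    by (simp add: image_mset.compositionality o_def flip: mset_map)
  moreover have "sort ?xs = rev ?xs"
  proof (rule properties_for_sort)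
    show "sorted (rev ?xs)"
      unfolding sorted_wrt_rev sorted_wrt_map
      by (auto simp: sorted_wrt_iff_nth_less intro!: less_imp_le anti)
  qed simp
  ultimately have "rev (sorted_list_of_multiset (image_mset cmod
      (proots (char_poly (map_mat complex_of_real A))))) = ?xs"
    by (simp only: sorted_list_of_multiset_mset rev_rev_ident)
  then show ?thesis
    using p nth_upt[of 0 "p - 1" n] unfolding nth_eigenvalue_def by simp
qed

text \<open>Near 0 the function is Re (Ln (f t)), and the principal branch is holomorphic at the
  positive number f 0.\<close>

lemma has_real_derivative_ln_cmod:
  fixes f :: "real \<Rightarrow> complex"
  assumes "(f has_vector_derivative d) (at 0)" "f 0 = of_real m" "m > 0"
  shows "((\<lambda>t. ln (cmod (f t))) has_real_derivative Re d / m) (at 0)"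
proof -
  have "(Ln has_field_derivative inverse (of_real m)) (at (f 0))"
    using assms by (auto intro!: has_field_derivative_Ln simp: complex_nonpos_Reals_iff)
  from field_vector_diff_chain_at[OF assms(1) this]
  have "((\<lambda>t. Re ((Ln \<circ> f) t)) has_vector_derivative Re (d * inverse (of_real m))) (at 0)"
    by (rule bounded_linear.has_vector_derivative[OF bounded_linear_Re])
  moreover have "Re (d * inverse (of_real m)) = Re d / m"
    by (metis Re_divide_of_real divide_inverse)
  ultimately have d: "((\<lambda>t. Re ((Ln \<circ> f) t)) has_real_derivative Re d / m) (at 0)"
    by (simp add: has_real_derivative_iff_has_vector_derivative)
  have "(f \<longlongrightarrow> f 0) (at 0)"
    using has_vector_derivative_continuous[OF assms(1)] by (simp add: isCont_def)
  then have "(f \<longlongrightarrow> f 0) (nhds 0)" by (rule tendsto_at_iff_tendsto_nhds[THEN iffD1])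
  then have "\<forall>\<^sub>F t in nhds 0. f t \<noteq> 0"
    by (rule tendsto_imp_eventually_ne) (use assms in auto)
  then have "\<forall>\<^sub>F t in nhds 0. Re ((Ln \<circ> f) t) = ln (cmod (f t))"
    by eventually_elim simp
  from DERIV_cong_ev[OF refl this refl, THEN iffD1, OF d] show ?thesis .
qed

text \<open>The scalar \<open>c\<close> is only controlled through \<open>det (R t) = 1\<close>; as the logarithmic derivatives
  \<open>Re (M i i) / \<mu> i\<close> add up to \<open>0\<close>, it does not contribute.\<close>

lemma ln_nth_eigenvalue_has_real_derivative:
  fixes A :: "real \<Rightarrow> complex mat" and R :: "real \<Rightarrow> real mat" and \<mu> :: "nat \<Rightarrow> real"
  assumes A: "\<And>t. A t \<in> carrier_mat n n" "A 0 = mat_diag n (\<lambda>i. of_real (\<mu> i))"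
    and \<mu>: "\<And>i. i < n \<Longrightarrow> \<mu> i > 0" "\<And>i j. i < j \<Longrightarrow> j < n \<Longrightarrow> \<mu> j < \<mu> i"
    and der: "\<And>i j. i < n \<Longrightarrow> j < n \<Longrightarrow> ((\<lambda>t. A t $$ (i, j)) has_vector_derivative M i j) (at 0)"
    and trace: "(\<Sum>i<n. Re (M i i) / \<mu> i) = 0"
    and R: "\<forall>\<^sub>F t in nhds 0. R t \<in> carrier_mat n n \<and> Determinant.det (R t) = 1 \<and>
      (\<exists>c. similar_mat (map_mat complex_of_real (R t)) (c \<cdot>\<^sub>m A t))"
    and p: "1 \<le> p" "p \<le> n"
  shows "((\<lambda>t. ln (nth_eigenvalue p (R t))) has_real_derivative Re (M (p - 1) (p - 1)) / \<mu> (p - 1)) (at 0)"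
proof -
  let ?m = "\<lambda>i. complex_of_real (\<mu> i)"
  let ?f = "\<lambda>t. char_poly (A t)"
  have f0: "poly (?f 0) z = (\<Prod>i<n. z - ?m i)" for z
  proof -
    have "?f 0 = (\<Prod>a\<leftarrow>diag_mat (A 0). [:- a, 1:])"
      by (rule char_poly_upper_triangular[of _ n]) (auto simp: A(2) mat_diag_def)
    also have "diag_mat (A 0) = map ?m [0..<n]"
      unfolding A(2) diag_mat_def by (auto simp: mat_diag_def)
    also have "(\<Prod>a\<leftarrow>map ?m [0..<n]. [:- a, 1:]) = (\<Prod>i<n. [:- ?m i, 1:])"
      by (simp add: o_def prod.distinct_set_conv_list[symmetric] lessThan_atLeast0)
    finally show ?thesis by (simp add: poly_prod)
  qed
  have inj: "inj_on ?m {..<n}"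
    by (rule linorder_inj_onI) (use \<mu>(2) in force)+
  have A0: "A 0 $$ (i, j) = (if i = j then ?m i else 0)" if "i < n" "j < n" for i j
    using that by (auto simp: A(2) mat_diag_def)
  have d: "((\<lambda>t. poly (?f t) (?m p)) has_vector_derivative
      - M p p * (\<Prod>i\<in>{..<n} - {p}. ?m p - ?m i)) (at 0)" if p: "p < n" for p
  proof -
    \<comment> \<open>Its determinant is the value of the characteristic polynomial at \<mu> p, and
      at t = 0 it is diagonal with a zero in place p.\<close>
    let ?B = "\<lambda>t. - char_matrix (A t) (?m p)"
    have B: "?B t $$ (i, j) = (if i = j then ?m p else 0) - A t $$ (i, j)" if "i < n" "j < n" for t i j
      using A(1)[of t] that by (auto simp: char_matrix_def)
    have "((\<lambda>t. Determinant.det (?B t)) has_vector_derivative - M p p * (\<Prod>i\<in>{..<n} - {p}. ?B 0 $$ (i, i))) (at 0)"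
    proof (rule det_has_vector_derivative_diag[where n = n and M = "\<lambda>i j. - M i j"])
      show "((\<lambda>t. ?B t $$ (i, j)) has_vector_derivative - M i j) (at 0)" if "i < n" "j < n" for i j
        using has_vector_derivative_diff[OF has_vector_derivative_const der[OF that]] that by (simp add: B)
    qed (use p A(1) in \<open>auto simp: B A0\<close>)
    then show ?thesis
      using p by (simp add: char_poly_matrix[OF A(1)] B A0)
  qed
  obtain r where r0: "\<And>p. p < n \<Longrightarrow> r 0 p = ?m p"
    and fr: "\<forall>\<^sub>F t in nhds 0. ?f t = (\<Prod>p<n. [:- r t p, 1:])"
    and r: "\<And>p. p < n \<Longrightarrow> ((\<lambda>t. r t p) has_vector_derivative
       - (- M p p * (\<Prod>i\<in>{..<n} - {p}. ?m p - ?m i)) / (\<Prod>i\<in>{..<n} - {p}. ?m p - ?m i)) (at 0)"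
  proof (rule simple_roots_differentiable[where f = ?f and \<mu> = ?m and n = n and
        d = "\<lambda>p. - M p p * (\<Prod>i\<in>{..<n} - {p}. ?m p - ?m i)"])
    show "poly (?f 0) (?m p) = 0" if "p < n" for p using that by (auto simp: f0)
  qed (use degree_monic_char_poly[OF A(1)] inj d in auto)
  have r': "((\<lambda>t. r t p) has_vector_derivative M p p) (at 0)" if p: "p < n" for p
  proof -
    have "(\<Prod>i\<in>{..<n} - {p}. ?m p - ?m i) \<noteq> 0"
      using inj p by (auto simp: inj_on_def)
    then show ?thesis using r[OF p] by simp
  qed
  have lnr: "((\<lambda>t. ln (cmod (r t i))) has_real_derivative Re (M i i) / \<mu> i) (at 0)" if "i < n" for i
    using has_real_derivative_ln_cmod[OF r' r0 \<mu>(1)] that by simp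
  have lim: "((\<lambda>t. cmod (r t i)) \<longlongrightarrow> \<mu> i) (nhds 0)" if "i < n" for i
  proof -
    have "isCont (\<lambda>t. r t i) 0" using r'[OF that] by (rule has_vector_derivative_continuous)
    then have "((\<lambda>t. r t i) \<longlongrightarrow> r 0 i) (at 0)" by (simp add: isCont_def)
    then have "((\<lambda>t. r t i) \<longlongrightarrow> r 0 i) (nhds 0)" by (rule tendsto_at_iff_tendsto_nhds[THEN iffD1])
    from tendsto_norm[OF this] show ?thesis using r0[OF that] \<mu>(1)[OF that] by simp
  qed
  have pos: "\<forall>\<^sub>F t in nhds 0. \<forall>i\<in>{..<n}. 0 < cmod (r t i)"
    by (intro eventually_ball_finite ballI order_tendstoD(1)[OF lim]) (use \<mu> in auto)
  have "\<forall>\<^sub>F t in nhds 0. \<forall>i\<in>{..<n}. \<forall>j\<in>{i<..<n}. cmod (r t j) < cmod (r t i)"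
  proof (intro eventually_ball_finite ballI)
    fix i j assume ij: "i \<in> {..<n}" "j \<in> {i<..<n}"
    then have "((\<lambda>t. cmod (r t i) - cmod (r t j)) \<longlongrightarrow> \<mu> i - \<mu> j) (nhds 0)"
      by (intro tendsto_diff lim) auto
    then have "\<forall>\<^sub>F t in nhds 0. 0 < cmod (r t i) - cmod (r t j)"
      by (rule order_tendstoD) (use ij \<mu>(2) in auto)
    then show "\<forall>\<^sub>F t in nhds 0. cmod (r t j) < cmod (r t i)" by simp
  qed auto
  \<comment> \<open>Strict inequalities between the moduli persist for small t, so r t (p - 1)
    remains the p-th in size.\<close>
  then have anti: "\<forall>\<^sub>F t in nhds 0. \<forall>i j. i < j \<longrightarrow> j < n \<longrightarrow> cmod (r t j) < cmod (r t i)"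
    by (rule eventually_mono) auto
  \<comment> \<open>From det (R t) = 1 it follows that ln |c| is minus the mean of the ln |r t i|;
    so \<open>?g\<close> is the logarithm of |c * r t (p - 1)| with c eliminated.\<close>
  let ?g = "\<lambda>t. ln (cmod (r t (p - 1))) - (\<Sum>i<n. ln (cmod (r t i))) / n"
  have eq: "\<forall>\<^sub>F t in nhds 0. ?g t = ln (nth_eigenvalue p (R t))"
    using R fr pos anti
  proof eventually_elim
    case (elim t)
    then obtain c where c: "similar_mat (map_mat complex_of_real (R t)) (c \<cdot>\<^sub>m A t)" by blast
    let ?R = "map_mat complex_of_real (R t)"
    have "complex_of_real (Determinant.det (R t)) = Determinant.det ?R"
      by (simp add: of_real_hom.hom_det)
    then have "1 = c ^ n * Determinant.det (A t)"
      using elim det_similar[OF c] A(1)[of t] by simp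
    then have det: "1 = c ^ n * (\<Prod>i<n. r t i)"
      using det_eq_prod_roots[OF A(1)] elim by simp
    have c0: "c \<noteq> 0" using det p by (auto simp: power_0_left)
    have cpR: "char_poly ?R = (\<Prod>i<n. [:- (c * r t i), 1:])"
      using char_poly_similar[OF c] char_poly_smult_linear_factors[OF A(1) c0] elim by simp
    have "nth_eigenvalue p (R t) = cmod (c * r t (p - 1))"
      using elim p c0 by (intro nth_eigenvalue_eq[OF cpR]) (auto simp: norm_mult)
    moreover have "cmod (r t (p - 1)) > 0" using elim p by auto
    ultimately have "ln (nth_eigenvalue p (R t)) = ln (cmod c) + ln (cmod (r t (p - 1)))"
      using c0 by (simp add: norm_mult ln_mult)
    moreover have "real n * ln (cmod c) + (\<Sum>i<n. ln (cmod (r t i))) = 0"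
    proof -
      have "0 = ln (cmod (c ^ n * (\<Prod>i<n. r t i)))" unfolding det[symmetric] by simp
      also have "\<dots> = ln (cmod c ^ n * (\<Prod>i<n. cmod (r t i)))" by (simp add: norm_mult norm_power prod_norm)
      also have "\<dots> = real n * ln (cmod c) + (\<Sum>i<n. ln (cmod (r t i)))"
        using elim(3) c0 by (subst ln_mult) (auto simp: ln_realpow intro!: prod_pos ln_prod)
      finally show ?thesis by simp
    qed
    ultimately show ?case using p by (simp add: field_simps)
  qed
  have "(?g has_real_derivative Re (M (p - 1) (p - 1)) / \<mu> (p - 1) - (\<Sum>i<n. Re (M i i) / \<mu> i) / n) (at 0)"
    using p by (intro DERIV_diff DERIV_cdivide DERIV_sum lnr) auto
  then have g': "(?g has_real_derivative Re (M (p - 1) (p - 1)) / \<mu> (p - 1)) (at 0)"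
    by (simp add: trace)
  show ?thesis
    by (rule DERIV_cong_ev[OF refl eq refl, THEN iffD1, OF g'])
qed

section \<open>Eigenvectors of the symmetric matrix of the principal embedding\<close>

lemma higher_pderiv_mult:
  fixes p q :: "'b::idom poly"
  shows "(pderiv ^^ m) (p * q) = (\<Sum>i\<le>m. of_nat (m choose i) * ((pderiv ^^ (m - i)) p * (pderiv ^^ i) q))"
proof (induction m)
  case (Suc m)
  let ?A = "\<lambda>i. (pderiv ^^ i) p" let ?B = "\<lambda>i. (pderiv ^^ i) q"
  have "(pderiv ^^ Suc m) (p * q) = pderiv (\<Sum>i\<le>m. of_nat (m choose i) * (?A (m - i) * ?B i))"
    by (simp add: Suc.IH)
  also have "\<dots> = (\<Sum>i\<le>m. of_nat (m choose i) * (?A (Suc m - i) * ?B i)) +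
      (\<Sum>i\<le>m. of_nat (m choose i) * (?A (m - i) * ?B (Suc i)))"
    by (simp add: pderiv_sum pderiv_mult Suc_diff_le algebra_simps sum.distrib)
  also have "(\<Sum>i\<le>m. of_nat (m choose i) * (?A (Suc m - i) * ?B i)) =
      (\<Sum>i\<le>Suc m. of_nat (m choose i) * (?A (Suc m - i) * ?B i))" by (simp add: binomial_eq_0)
  also have "\<dots> = ?A (Suc m) * ?B 0 + (\<Sum>i\<le>m. of_nat (m choose Suc i) * (?A (m - i) * ?B (Suc i)))"
    by (subst sum.atMost_Suc_shift) simp
  also have "?A (Suc m) * ?B 0 + (\<Sum>i\<le>m. of_nat (m choose Suc i) * (?A (m - i) * ?B (Suc i))) +
      (\<Sum>i\<le>m. of_nat (m choose i) * (?A (m - i) * ?B (Suc i))) =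
      ?A (Suc m) * ?B 0 + (\<Sum>i\<le>m. of_nat (Suc m choose Suc i) * (?A (m - i) * ?B (Suc i)))"
    unfolding add.assoc sum.distrib[symmetric] by (simp add: distrib_right add.commute)
  also have "\<dots> = (\<Sum>i\<le>Suc m. of_nat (Suc m choose i) * (?A (Suc m - i) * ?B i))"
    by (subst sum.atMost_Suc_shift) simp
  finally show ?case .
qed simp

text \<open>The coefficient k! (a choose k) is the falling factorial. It vanishes for k > a, so the
  truncated exponent a - k does no harm.\<close>

lemma higher_pderiv_linear_power:
  "(pderiv ^^ k) ([:1, c:] ^ a) = Polynomial.smult (c ^ k * (fact k * of_nat (a choose k))) ([:1, c:] ^ (a - k))"
  for c :: real
proof (induction k)
  case (Suc k)
  have ch: "real (a - k) * real (a choose k) = real (Suc k) * real (a choose Suc k)"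
    using binomial_absorb_comp[of a k] binomial_absorption[of k a] by (simp only: flip: of_nat_mult)
  have "(pderiv ^^ Suc k) ([:1, c:] ^ a) =
      Polynomial.smult (c ^ Suc k * (fact k * (real (a - k) * real (a choose k)))) ([:1, c:] ^ (a - Suc k))"
    by (simp add: Suc.IH pderiv_smult pderiv_power pderiv_pCons mult_ac)
  also have "c ^ Suc k * (fact k * (real (a - k) * real (a choose k))) = c ^ Suc k * (fact (Suc k) * of_nat (a choose Suc k))"
    unfolding ch by (simp add: algebra_simps)
  finally show ?case .
qed simp


text \<open>In the basis \<open>w\<^sub>j / \<surd>(n - 1 choose j) = T\<^bsup>n-1-j\<^esup>\<close> the matrix \<open>- \<surd>2 X\<^sub>n\<close> is \<open>d/dT\<close> and \<open>\<surd>2 (Y\<^sub>n - X\<^sub>n)\<close>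
  is \<open>(1 - T\<^sup>2) d/dT + (n - 1) T\<close>, which has the eigenvectors \<open>(1 + T)\<^sup>a (1 - T)\<^bsup>n-1-a\<^esup>\<close>.\<close>

definition unitary_coeff :: "nat \<Rightarrow> real poly \<Rightarrow> nat \<Rightarrow> real" where
  "unitary_coeff n f j = poly.coeff f (n - 1 - j) / sqrt (real ((n - 1) choose j))"

definition eigenpoly :: "nat \<Rightarrow> nat \<Rightarrow> real poly" where
  "eigenpoly n a = [:1, 1:] ^ a * [:1, - 1:] ^ (n - 1 - a)"

text \<open>The differential operator above represents sqrt 2 H and has the eigenvalue 2 a - (n -
  1). The values increase with a, so e^(-L H) decreases with a, and a = p - 1 belongs to the p-th
  largest eigenvalue.\<close>

definition H_eigenvalue :: "nat \<Rightarrow> nat \<Rightarrow> real" where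
  "H_eigenvalue n a = (2 * real a - (real n - 1)) / sqrt 2"

lemma degree_eigenpoly: "a < n \<Longrightarrow> degree (eigenpoly n a) = n - 1"
  by (simp add: eigenpoly_def degree_mult_eq degree_power_eq)

text \<open>With x = 1 + T, y = 1 - T and b = n - 1 - a, the operator x y d/dT multiplies x^a y^b by
  a y - b x = (a - b) - (a + b) T, and a + b = n - 1, so the term (n - 1) T cancels the part linear
  in T.\<close>

lemma eigenpoly_ode:
  assumes "a < n"
  shows "[:1, 0, - 1:] * pderiv (eigenpoly n a) + Polynomial.smult (real n - 1) ([:0, 1:] * eigenpoly n a) =
    Polynomial.smult (2 * real a - (real n - 1)) (eigenpoly n a)"
proof -
  let ?x = "[:1, 1::real:]" let ?y = "[:1, - 1::real:]" let ?b = "n - 1 - a"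
  have *: "?x * pderiv (?x ^ a) = Polynomial.smult (real a) (?x ^ a)"
    unfolding pderiv_power by (cases a) (simp_all add: pderiv_pCons del: mult_pCons_left)
  have **: "?y * pderiv (?y ^ ?b) = Polynomial.smult (- real ?b) (?y ^ ?b)"
    unfolding pderiv_power by (cases "?b") (simp_all add: pderiv_pCons del: mult_pCons_left smult_minus_left flip: smult_minus_left)
  have xy: "[:1, 0, - 1::real:] = ?x * ?y" by simp
  have "[:1, 0, - 1:] * pderiv (eigenpoly n a) =
      ?x ^ a * ?x * (?y * pderiv (?y ^ ?b)) + ?y * ?y ^ ?b * (?x * pderiv (?x ^ a))"
    unfolding xy eigenpoly_def pderiv_mult by (simp only: algebra_simps)
  also have "\<dots> = (Polynomial.smult (- real ?b) ?x + Polynomial.smult (real a) ?y) * eigenpoly n a"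
    unfolding * ** eigenpoly_def by (simp only: algebra_simps mult_smult_left mult_smult_right)
  finally have eq: "[:1, 0, - 1:] * pderiv (eigenpoly n a) =
      (Polynomial.smult (- real ?b) ?x + Polynomial.smult (real a) ?y) * eigenpoly n a" .
  have "[:1, 0, - 1:] * pderiv (eigenpoly n a) + Polynomial.smult (real n - 1) ([:0, 1:] * eigenpoly n a) =
     (Polynomial.smult (- real ?b) ?x + Polynomial.smult (real a) ?y + [:0, real n - 1:]) * eigenpoly n a"
    unfolding eq distrib_right by simp
  also have "Polynomial.smult (- real ?b) ?x + Polynomial.smult (real a) ?y + [:0, real n - 1:] = [:2 * real a - (real n - 1):]"
    using assms by (simp add: of_nat_diff)
  finally show ?thesis by simp
qed

text \<open>By (n-1-j) C(n-1, j) = (j+1) C(n-1, j+1), the square roots combine and the matrix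
  entries become the integer coefficients of d/dT (first claim) and of (n-1) T - T^2 d/dT (second
  claim).\<close>

lemma unitary_coeff_Suc:
  assumes "Suc j < n"
  shows "c_coef n (Suc j) * unitary_coeff n f j * sqrt 2 = 
    real (n - 1 - j) * poly.coeff f (n - 1 - j) / sqrt (real ((n - 1) choose Suc j))"
    and "c_coef n (Suc j) * unitary_coeff n f (Suc j) * sqrt 2 =
    real (Suc j) * poly.coeff f (n - 1 - Suc j) / sqrt (real ((n - 1) choose j))"
proof -
  let ?c = "real ((n - 1) choose j)" and ?d = "real ((n - 1) choose Suc j)"
  have pos: "?c > 0" "?d > 0" using assms by auto
  have rel: "real (n - 1 - j) * ?c = real (Suc j) * ?d"
    using binomial_absorb_comp[of "n - 1" j] binomial_absorption[of j "n - 1"] by (simp only: flip: of_nat_mult)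
  have c: "c_coef n (Suc j) * sqrt 2 = sqrt (real (Suc j)) * sqrt (real (n - 1 - j))"
    unfolding c_coef_def real_sqrt_mult[symmetric] using assms by (simp add: of_nat_diff)
  have s: "sqrt (real (n - 1 - j)) * sqrt ?c = sqrt (real (Suc j)) * sqrt ?d"
    unfolding real_sqrt_mult[symmetric] rel ..
  have "sqrt (real (Suc j)) * sqrt (real (n - 1 - j)) * sqrt ?d = sqrt (real (n - 1 - j)) * (sqrt (real (Suc j)) * sqrt ?d)"
    by (simp only: mult_ac)
  also have "\<dots> = real (n - 1 - j) * sqrt ?c"
    unfolding s[symmetric] by (simp only: mult.assoc[symmetric] real_sqrt_mult_self abs_of_nat)
  finally have "sqrt (real (Suc j)) * sqrt (real (n - 1 - j)) * sqrt ?d = real (n - 1 - j) * sqrt ?c" .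
  then have "sqrt (real (Suc j)) * sqrt (real (n - 1 - j)) / sqrt ?c = real (n - 1 - j) / sqrt ?d"
    using pos by (simp add: field_simps)
  from arg_cong[OF this, of "\<lambda>x. x * poly.coeff f (n - 1 - j)"]
  show "c_coef n (Suc j) * unitary_coeff n f j * sqrt 2 =
    real (n - 1 - j) * poly.coeff f (n - 1 - j) / sqrt ?d"
    unfolding unitary_coeff_def c[symmetric] by (simp only: times_divide_eq_left times_divide_eq_right mult_ac)
  have "sqrt (real (Suc j)) * sqrt (real (n - 1 - j)) * sqrt ?c = sqrt (real (Suc j)) * (sqrt (real (n - 1 - j)) * sqrt ?c)"
    by (simp only: mult_ac)
  also have "\<dots> = real (Suc j) * sqrt ?d"
    unfolding s by (simp only: mult.assoc[symmetric] real_sqrt_mult_self abs_of_nat)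
  finally have "sqrt (real (Suc j)) * sqrt (real (n - 1 - j)) * sqrt ?c = real (Suc j) * sqrt ?d" .
  then have "sqrt (real (Suc j)) * sqrt (real (n - 1 - j)) / sqrt ?d = real (Suc j) / sqrt ?c"
    using pos by (simp add: field_simps)
  from arg_cong[OF this, of "\<lambda>x. x * poly.coeff f (n - 1 - Suc j)"]
  show "c_coef n (Suc j) * unitary_coeff n f (Suc j) * sqrt 2 =
    real (Suc j) * poly.coeff f (n - 1 - Suc j) / sqrt ?c"
    unfolding unitary_coeff_def c[symmetric] by (simp only: times_divide_eq_left times_divide_eq_right mult_ac)
qed


lemma sum_two_diagonals:
  fixes f g :: "nat \<Rightarrow> 'b::comm_monoid_add"
  assumes "j < n"
  shows "(\<Sum>l<n. (if j = l + 1 then f l else 0) + (if l = j + 1 then g l else 0)) =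
    (if 0 < j then f (j - 1) else 0) + (if j + 1 < n then g (j + 1) else 0)"
proof -
  have "(\<Sum>l<n. if j = l + 1 then f l else 0) = (if 0 < j then f (j - 1) else 0)"
  proof (cases j)
    case (Suc i)
    then show ?thesis using assms by (simp add: sum.delta')
  qed simp
  moreover have "(\<Sum>l<n. if l = j + 1 then g l else 0) = (if j + 1 < n then g (j + 1) else 0)"
    by (simp add: sum.delta)
  ultimately show ?thesis by (simp add: sum.distrib)
qed

text \<open>The entries of \<open>Y_mat n - X_mat n\<close>, kept real so that symmetry gives
  orthogonality of the eigenvectors without conjugations.\<close>

definition H_entry :: "nat \<Rightarrow> nat \<Rightarrow> nat \<Rightarrow> real" where
  "H_entry n j l = (if j = l + 1 then c_coef n j else 0) + (if l = j + 1 then c_coef n l else 0)"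

lemma H_entry_commute: "H_entry n j l = H_entry n l j"
  by (simp add: H_entry_def)

text \<open>This is \<open>eigenpoly_ode\<close> read at the coefficient of T^(n-1-j), after
  multiplication by sqrt 2.\<close>

lemma H_entry_eigenvector:
  assumes "a < n" "j < n"
  shows "(\<Sum>l<n. H_entry n j l * unitary_coeff n (eigenpoly n a) l) =
    H_eigenvalue n a * unitary_coeff n (eigenpoly n a) j"
proof -
  let ?f = "eigenpoly n a" let ?u = "unitary_coeff n ?f" let ?C = "sqrt (real ((n - 1) choose j))"
  let ?i = "n - 1 - j"
  have "(\<Sum>l<n. H_entry n j l * ?u l) =
      (\<Sum>l<n. (if j = l + 1 then c_coef n j * ?u l else 0) + (if l = j + 1 then c_coef n l * ?u l else 0))"
    unfolding H_entry_def by (intro sum.cong) auto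
  also have "\<dots> = (if 0 < j then c_coef n j * ?u (j - 1) else 0) + (if j + 1 < n then c_coef n (j + 1) * ?u (j + 1) else 0)"
    using assms(2) by (rule sum_two_diagonals)
  finally have "(\<Sum>l<n. H_entry n j l * ?u l) * sqrt 2 =
      (if 0 < j then c_coef n j * ?u (j - 1) * sqrt 2 else 0) +
      (if j + 1 < n then c_coef n (j + 1) * ?u (j + 1) * sqrt 2 else 0)"
    by (simp add: distrib_right)
  also have "(if 0 < j then c_coef n j * ?u (j - 1) * sqrt 2 else 0) = real (Suc ?i) * poly.coeff ?f (Suc ?i) / ?C"
  proof (cases j)
    case 0
    \<comment> \<open>In row 0 the missing neighbour corresponds to the coefficient of T^n, beyond
      the degree n - 1.\<close>
    have "poly.coeff ?f (Suc (n - 1)) = 0"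
      using degree_eigenpoly[OF assms(1)] by (intro coeff_eq_0) simp
    then show ?thesis using 0 by simp
  next
    case (Suc j')
    then have e: "n - 1 - j' = Suc ?i" using assms by simp
    show ?thesis using unitary_coeff_Suc(1)[of j' n ?f] assms Suc unfolding e by simp
  qed
  also have "(if j + 1 < n then c_coef n (j + 1) * ?u (j + 1) * sqrt 2 else 0) =
      (if ?i = 0 then 0 else real (Suc j) * poly.coeff ?f (?i - 1)) / ?C"
    using unitary_coeff_Suc(2)[of j n ?f] assms by auto
  also have "real (Suc ?i) * poly.coeff ?f (Suc ?i) / ?C +
      (if ?i = 0 then 0 else real (Suc j) * poly.coeff ?f (?i - 1)) / ?C =
      (2 * real a - (real n - 1)) * poly.coeff ?f ?i / ?C"
  proof -
    have "poly.coeff ([:1, 0, - 1:] * pderiv ?f + Polynomial.smult (real n - 1) ([:0, 1:] * ?f)) ?i =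
       real (Suc ?i) * poly.coeff ?f (Suc ?i) + (if ?i = 0 then 0 else real (Suc j) * poly.coeff ?f (?i - 1))"
    proof (cases ?i)
      case (Suc i)
      have "real n = real j + 2 + real i" using Suc assms by simp
      then show ?thesis
        unfolding Suc by (cases i) (simp_all add: coeff_pderiv coeff_pCons \<open>real n = _\<close> algebra_simps)
    qed (simp add: coeff_pderiv)
    then have "real (Suc ?i) * poly.coeff ?f (Suc ?i) + (if ?i = 0 then 0 else real (Suc j) * poly.coeff ?f (?i - 1)) =
      (2 * real a - (real n - 1)) * poly.coeff ?f ?i"
      unfolding eigenpoly_ode[OF assms(1)] by simp
    then show ?thesis by (simp only: add_divide_distrib[symmetric])
  qed
  also have "\<dots> = H_eigenvalue n a * ?u j * sqrt 2"
    by (simp add: H_eigenvalue_def unitary_coeff_def)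
  finally show ?thesis by simp
qed

definition eigen_norm :: "nat \<Rightarrow> nat \<Rightarrow> real" where
  "eigen_norm n a = (\<Sum>j<n. (unitary_coeff n (eigenpoly n a) j)\<^sup>2)"

lemma eigen_norm_pos:
  assumes "a < n"
  shows "eigen_norm n a > 0"
proof -
  have "eigenpoly n a \<noteq> 0" by (simp add: eigenpoly_def)
  then have "lead_coeff (eigenpoly n a) \<noteq> 0" by simp
  then have "unitary_coeff n (eigenpoly n a) 0 \<noteq> 0"
    unfolding unitary_coeff_def degree_eigenpoly[OF assms] by simp
  then have "(unitary_coeff n (eigenpoly n a) 0)\<^sup>2 > 0" by simp
  also have "\<dots> \<le> eigen_norm n a"
    unfolding eigen_norm_def using assms by (intro member_le_sum) auto
  finally show ?thesis .
qed

text \<open>The usual argument for a symmetric matrix: moving it from one factor of the pairing to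
  the other compares two distinct eigenvalues.\<close>

lemma eigenpoly_orthogonal:
  assumes "a < n" "b < n" "a \<noteq> b"
  shows "(\<Sum>j<n. unitary_coeff n (eigenpoly n a) j * unitary_coeff n (eigenpoly n b) j) = 0"
proof -
  let ?u = "unitary_coeff n (eigenpoly n a)" and ?v = "unitary_coeff n (eigenpoly n b)"
  have "H_eigenvalue n a * (\<Sum>j<n. ?u j * ?v j) = (\<Sum>j<n. (\<Sum>l<n. H_entry n j l * ?u l) * ?v j)"
    using assms by (simp add: H_entry_eigenvector sum_distrib_left mult_ac)
  also have "\<dots> = (\<Sum>l<n. ?u l * (\<Sum>j<n. H_entry n l j * ?v j))"
    unfolding sum_distrib_left sum_distrib_right
    by (subst sum.swap) (simp add: H_entry_commute[of n] mult_ac)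
  also have "\<dots> = H_eigenvalue n b * (\<Sum>j<n. ?u j * ?v j)"
    using assms by (simp add: H_entry_eigenvector sum_distrib_left mult_ac)
  finally have "(H_eigenvalue n a - H_eigenvalue n b) * (\<Sum>j<n. ?u j * ?v j) = 0"
    by (simp add: left_diff_distrib)
  moreover have "H_eigenvalue n a \<noteq> H_eigenvalue n b"
    using assms(3) by (simp add: H_eigenvalue_def divide_simps)
  ultimately show ?thesis by simp
qed

lemma unitary_coeff_linear:
  "unitary_coeff n (Polynomial.smult c f) j = c * unitary_coeff n f j"
  "unitary_coeff n (sum F I) j = (\<Sum>i\<in>I. unitary_coeff n (F i) j)"
  by (simp_all add: unitary_coeff_def coeff_sum sum_divide_distrib)

text \<open>The a-th diagonal entry of \<open>E_mat n m\<close> in the eigenbasis, as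
  \<open>E_mat_diag\<close> shows.\<close>

definition E_diag :: "nat \<Rightarrow> nat \<Rightarrow> nat \<Rightarrow> real" where
  "E_diag n m a = fact m / 2 ^ m *
    (\<Sum>i\<le>m. (- 1) ^ i * real (m choose i) * real (a choose (m - i)) * real ((n - 1 - a) choose i))"

text \<open>Multiplying \<open>(d/dT)\<^sup>m\<close> of an eigenvector by \<open>1 = (((1 + T) + (1 - T)) / 2)\<^sup>m\<close> expands it in the eigenbasis.\<close>

lemma E_diag_eq:
  assumes a: "a < n"
  shows "(\<Sum>j<n. unitary_coeff n (eigenpoly n a) j * unitary_coeff n ((pderiv ^^ m) (eigenpoly n a)) j) =
    eigen_norm n a * E_diag n m a"
proof -
  let ?x = "[:1, 1::real:]" let ?y = "[:1, - 1::real:]" let ?b = "n - 1 - a"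
  \<comment> \<open>On combinations of the \<open>eigenpoly n c\<close>, this functional reads off
    the coefficient at c = a, times \<open>eigen_norm n a\<close>.\<close>
  define \<Lambda> where "\<Lambda> f = (\<Sum>j<n. unitary_coeff n (eigenpoly n a) j * unitary_coeff n f j)" for f
  have \<Lambda>_smult: "\<Lambda> (Polynomial.smult c f) = c * \<Lambda> f" for c f
    by (simp add: \<Lambda>_def unitary_coeff_linear sum_distrib_left mult_ac)
  have \<Lambda>_sum: "\<Lambda> (sum F I) = (\<Sum>i\<in>I. \<Lambda> (F i))" for F :: "nat \<Rightarrow> real poly" and I
    unfolding \<Lambda>_def unitary_coeff_linear sum_distrib_left by (rule sum.swap)
  have \<Lambda>_eigen: "\<Lambda> (eigenpoly n c) = (if c = a then eigen_norm n a else 0)" if "c < n" for c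
    using eigenpoly_orthogonal[OF a that] by (auto simp: \<Lambda>_def eigen_norm_def power2_eq_square)
  have gen: "c * (c / t * e * (s * (u * x) * (v * y))) = e * (c * v * u / t * (s * c * x * y))"
    for c t e s u x v y :: real
    by (simp only: times_divide_eq_left times_divide_eq_right mult_ac)
  have const: "[:c:] * f = Polynomial.smult c f" for c and f :: "real poly" by simp
  define k where "k i = (- 1) ^ i * (fact (m - i) * real (a choose (m - i))) * (fact i * real (?b choose i))" for i
  have "\<Lambda> (?x ^ (a - (m - i)) * ?y ^ (?b - i)) * k i = (m choose i) / 2 ^ m * eigen_norm n a * k i" if i: "i \<le> m" for i
  \<comment> \<open>In the opposite case a binomial in \<open>k i\<close> vanishes, which takes care
    of truncated exponents.\<close>
  proof (cases "m - i \<le> a \<and> i \<le> ?b")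
    case True
    have "[:2:] ^ m = (?x + ?y) ^ m" by simp
    also have "\<dots> = (\<Sum>l\<le>m. of_nat (m choose l) * ?x ^ l * ?y ^ (m - l))" by (rule binomial_ring)
    finally have 2: "[:2 ^ m:] = (\<Sum>l\<le>m. of_nat (m choose l) * ?x ^ l * ?y ^ (m - l))"
      by (simp add: poly_const_pow)
    have "Polynomial.smult (2 ^ m) (?x ^ (a - (m - i)) * ?y ^ (?b - i)) = [:2 ^ m:] * (?x ^ (a - (m - i)) * ?y ^ (?b - i))"
      by simp
    also have "\<dots> = (\<Sum>l\<le>m. Polynomial.smult (real (m choose l)) (eigenpoly n (a - (m - i) + l)))"
      unfolding 2 sum_distrib_right
    proof (rule sum.cong[OF refl])
      fix l assume "l \<in> {..m}"
      then have e: "n - 1 - (a - (m - i) + l) = (?b - i) + (m - l)" using True i a by auto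
      show "of_nat (m choose l) * ?x ^ l * ?y ^ (m - l) * (?x ^ (a - (m - i)) * ?y ^ (?b - i)) =
          Polynomial.smult (real (m choose l)) (eigenpoly n (a - (m - i) + l))"
        unfolding eigenpoly_def e power_add by (simp add: of_nat_poly const mult_ac del: mult_pCons_left mult_pCons_right)
    qed
    finally have eq: "Polynomial.smult (2 ^ m) (?x ^ (a - (m - i)) * ?y ^ (?b - i)) =
        (\<Sum>l\<le>m. Polynomial.smult (real (m choose l)) (eigenpoly n (a - (m - i) + l)))" .
    have "2 ^ m * \<Lambda> (?x ^ (a - (m - i)) * ?y ^ (?b - i)) =
        (\<Sum>l\<le>m. (m choose l) * \<Lambda> (eigenpoly n (a - (m - i) + l)))"
      using arg_cong[OF eq, of \<Lambda>] by (simp only: \<Lambda>_smult \<Lambda>_sum)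
    \<comment> \<open>Of the m + 1 eigenvectors in the expansion, only the one with l = m - i has
      index a again.\<close>
    also have "\<dots> = (\<Sum>l\<le>m. if l = m - i then (m choose l) * eigen_norm n a else 0)"
      using True i a by (intro sum.cong refl) (subst \<Lambda>_eigen, auto)
    also have "\<dots> = (m choose i) * eigen_norm n a"
      using i by (simp add: sum.delta binomial_symmetric[symmetric])
    finally show ?thesis by (simp add: field_simps)
  next
    case False
    then show ?thesis by (auto simp: k_def binomial_eq_0)
  qed note main = this
  have "(pderiv ^^ m) (eigenpoly n a) =
      (\<Sum>i\<le>m. Polynomial.smult (real (m choose i) * k i) (?x ^ (a - (m - i)) * ?y ^ (?b - i)))"
    unfolding eigenpoly_def higher_pderiv_mult higher_pderiv_linear_power k_def
    by (simp add: of_nat_poly const mult_ac del: mult_pCons_left mult_pCons_right)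
  then have "\<Lambda> ((pderiv ^^ m) (eigenpoly n a)) = (\<Sum>i\<le>m. real (m choose i) * (\<Lambda> (?x ^ (a - (m - i)) * ?y ^ (?b - i)) * k i))"
    by (simp only: \<Lambda>_sum \<Lambda>_smult mult_ac)
  also have "\<dots> = (\<Sum>i\<le>m. real (m choose i) * ((m choose i) / 2 ^ m * eigen_norm n a * k i))"
    by (intro sum.cong refl) (simp only: main atMost_iff)
  also have "\<dots> = (\<Sum>i\<le>m. eigen_norm n a * (fact m / 2 ^ m *
      ((- 1) ^ i * real (m choose i) * real (a choose (m - i)) * real (?b choose i))))"
  proof (rule sum.cong[OF refl])
    fix i assume "i \<in> {..m}"
    then have "real (fact i * fact (m - i) * (m choose i)) = real (fact m)"
      using binomial_fact_lemma[of i m] by simp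
    \<comment> \<open>One of the two binomials C(m, i), from the Leibniz rule and from the
      expansion, is absorbed into m!; the other stays in \<open>E_diag\<close>.\<close>
    then have f: "fact m = real (m choose i) * fact i * fact (m - i)"
      by (simp only: of_nat_mult of_nat_fact mult_ac)
    show "real (m choose i) * ((m choose i) / 2 ^ m * eigen_norm n a * k i) = eigen_norm n a * (fact m / 2 ^ m *
      ((- 1) ^ i * real (m choose i) * real (a choose (m - i)) * real (?b choose i)))"
      unfolding k_def f by (rule gen)
  qed
  also have "\<dots> = eigen_norm n a * E_diag n m a"
    unfolding E_diag_def sum_distrib_left ..
  finally show ?thesis unfolding \<Lambda>_def .
qed

section \<open>Change of basis to the eigenvectors of H\<close>

lemma index_mult_mat_sum:
  "A \<in> carrier_mat n n \<Longrightarrow> B \<in> carrier_mat n n \<Longrightarrow> i < n \<Longrightarrow> j < n \<Longrightarrow>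
    (A * B) $$ (i, j) = (\<Sum>l<n. A $$ (i, l) * B $$ (l, j))"
  by (simp add: scalar_prod_def lessThan_atLeast0)

definition eigenbasis :: "nat \<Rightarrow> complex mat" where
  "eigenbasis n = Matrix.mat n n (\<lambda>(j, a). complex_of_real (unitary_coeff n (eigenpoly n a) j))"

text \<open>The columns of \<open>eigenbasis n\<close> are orthogonal but not normalised, so the
  inverse is the transpose with its rows divided by the squared lengths.\<close>

definition eigenbasis_inv :: "nat \<Rightarrow> complex mat" where
  "eigenbasis_inv n = Matrix.mat n n (\<lambda>(a, j). complex_of_real (unitary_coeff n (eigenpoly n a) j / eigen_norm n a))"

definition H_mat :: "nat \<Rightarrow> complex mat" where
  "H_mat n = Matrix.mat n n (\<lambda>(i, j). complex_of_real (H_entry n i j))"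

lemma eigenbasis_carrier [simp]:
  "eigenbasis n \<in> carrier_mat n n" "eigenbasis_inv n \<in> carrier_mat n n" "H_mat n \<in> carrier_mat n n"
  "E_mat n m \<in> carrier_mat n n"
  by (simp_all add: eigenbasis_def eigenbasis_inv_def H_mat_def E_mat_def X_mat_def)

lemma eigenbasis_inverse: 
  "eigenbasis_inv n * eigenbasis n = 1\<^sub>m n" "eigenbasis n * eigenbasis_inv n = 1\<^sub>m n"
proof -
  show *: "eigenbasis_inv n * eigenbasis n = 1\<^sub>m n"
  proof (rule eq_matI)
    fix a b assume "a < dim_row (1\<^sub>m n)" "b < dim_col (1\<^sub>m n)"
    then have ab: "a < n" "b < n" by auto
    have "(eigenbasis_inv n * eigenbasis n) $$ (a, b) = complex_of_real
      ((\<Sum>j<n. unitary_coeff n (eigenpoly n a) j * unitary_coeff n (eigenpoly n b) j) / eigen_norm n a)"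
      using ab by (subst index_mult_mat_sum[of _ n]) (simp_all add: eigenbasis_def eigenbasis_inv_def sum_divide_distrib)
    also have "(\<Sum>j<n. unitary_coeff n (eigenpoly n a) j * unitary_coeff n (eigenpoly n b) j) / eigen_norm n a =
        (if a = b then 1 else 0)"
      using eigenpoly_orthogonal[OF ab] eigen_norm_pos[OF ab(1)] by (auto simp: eigen_norm_def power2_eq_square)
    also have "complex_of_real (if a = b then 1 else 0) = 1\<^sub>m n $$ (a, b)" using ab by simp
    finally show "(eigenbasis_inv n * eigenbasis n) $$ (a, b) = 1\<^sub>m n $$ (a, b)" .
  qed (simp_all add: eigenbasis_def eigenbasis_inv_def)
  show "eigenbasis n * eigenbasis_inv n = 1\<^sub>m n"
    by (rule mat_mult_left_right_inverse[OF _ _ *]) auto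
qed

lemma H_mat_eigenbasis:
  "H_mat n * eigenbasis n = eigenbasis n * mat_diag n (\<lambda>a. complex_of_real (H_eigenvalue n a))"
proof (rule eq_matI)
  fix j a assume "j < dim_row (eigenbasis n * mat_diag n (\<lambda>a. complex_of_real (H_eigenvalue n a)))"
    "a < dim_col (eigenbasis n * mat_diag n (\<lambda>a. complex_of_real (H_eigenvalue n a)))"
  then have ja: "j < n" "a < n" by (auto simp: eigenbasis_def mat_diag_def)
  have "(H_mat n * eigenbasis n) $$ (j, a) =
      complex_of_real (\<Sum>l<n. H_entry n j l * unitary_coeff n (eigenpoly n a) l)"
    using ja by (subst index_mult_mat_sum[of _ n]) (simp_all add: eigenbasis_def H_mat_def)
  then show "(H_mat n * eigenbasis n) $$ (j, a) =
      (eigenbasis n * mat_diag n (\<lambda>a. complex_of_real (H_eigenvalue n a))) $$ (j, a)"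
    using ja by (simp add: H_entry_eigenvector mat_diag_mult_right[of _ n n] eigenbasis_def mult.commute)
qed (simp_all add: mat_diag_def eigenbasis_def H_mat_def)

text \<open>On unitary coefficients \<open>X_mat n\<close> times - sqrt 2 is d/dT. The power unfolds
  with the new factor on the right, so that the derivative is taken first and f has to vary in the
  induction.\<close>

lemma E_mat_action:
  assumes "degree f < n" "j < n"
  shows "(\<Sum>l<n. E_mat n m $$ (j, l) * complex_of_real (unitary_coeff n f l)) =
    complex_of_real (unitary_coeff n ((pderiv ^^ m) f) j)"
  using assms(1)
proof (induction m arbitrary: f)
  case 0
  then show ?case using assms(2) by (simp add: E_mat_def X_mat_def if_distrib if_distribR sum.delta cong: if_cong)
next
  case (Suc m)
  let ?N = "(- complex_of_real (sqrt 2)) \<cdot>\<^sub>m X_mat n"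
  have N: "?N \<in> carrier_mat n n" by (simp add: X_mat_def)
  have step: "(\<Sum>l<n. ?N $$ (r, l) * complex_of_real (unitary_coeff n f l)) = complex_of_real (unitary_coeff n (pderiv f) r)"
    if r: "r < n" for r
  proof -
    have "(\<Sum>l<n. ?N $$ (r, l) * complex_of_real (unitary_coeff n f l)) =
       (\<Sum>l<n. if r = l + 1 then complex_of_real (sqrt 2 * c_coef n r * unitary_coeff n f l) else 0)"
      using r by (intro sum.cong) (auto simp: X_mat_def)
    also have "\<dots> = complex_of_real (unitary_coeff n (pderiv f) r)"
    proof (cases r)
      case 0
      have "poly.coeff f (Suc (n - 1)) = 0" using Suc.prems by (intro coeff_eq_0) simp
      then show ?thesis using 0 by (simp add: unitary_coeff_def coeff_pderiv)
    next
      case (Suc r')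
      then have e: "n - 1 - r' = Suc (n - 1 - Suc r')" using r by simp
      show ?thesis
        using arg_cong[OF unitary_coeff_Suc(1)[of r' n f], of complex_of_real] r e
        unfolding Suc unitary_coeff_def coeff_pderiv by (simp add: sum.delta' e mult_ac)
    qed
    finally show ?thesis .
  qed
  have "E_mat n (Suc m) $$ (j, l) = (\<Sum>r<n. E_mat n m $$ (j, r) * ?N $$ (r, l))" if "l < n" for l
    unfolding E_mat_def pow_mat.simps using assms(2) N that
    by (intro index_mult_mat_sum) auto
  then have "(\<Sum>l<n. E_mat n (Suc m) $$ (j, l) * complex_of_real (unitary_coeff n f l)) =
     (\<Sum>l<n. \<Sum>r<n. E_mat n m $$ (j, r) * (?N $$ (r, l) * complex_of_real (unitary_coeff n f l)))"
    by (simp add: sum_distrib_right mult.assoc)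
  also have "\<dots> = (\<Sum>r<n. E_mat n m $$ (j, r) * (\<Sum>l<n. ?N $$ (r, l) * complex_of_real (unitary_coeff n f l)))"
    unfolding sum_distrib_left by (rule sum.swap)
  also have "\<dots> = (\<Sum>r<n. E_mat n m $$ (j, r) * complex_of_real (unitary_coeff n (pderiv f) r))"
    using step by simp
  also have "\<dots> = complex_of_real (unitary_coeff n ((pderiv ^^ m) (pderiv f)) j)"
    using Suc.prems by (intro Suc.IH) (simp add: degree_pderiv)
  finally show ?case by (simp add: funpow_swap1)
qed

text \<open>Reality turns the adjoint into the transpose, and the support on a single subdiagonal,
  weight m, makes a twist act on \<open>E_mat n m\<close> by one power.\<close>

lemma E_mat_entry:
  assumes "i < n" "j < n"
  shows "cnj (E_mat n m $$ (i, j)) = E_mat n m $$ (i, j)" "i \<noteq> j + m \<Longrightarrow> E_mat n m $$ (i, j) = 0"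
proof -
  have "(\<forall>i<n. \<forall>j<n. cnj (E_mat n m $$ (i, j)) = E_mat n m $$ (i, j) \<and> (i \<noteq> j + m \<longrightarrow> E_mat n m $$ (i, j) = 0))"
  proof (induction m)
    case 0
    then show ?case by (auto simp: E_mat_def X_mat_def)
  next
    case (Suc m)
    let ?N = "(- complex_of_real (sqrt 2)) \<cdot>\<^sub>m X_mat n"
    have N: "?N \<in> carrier_mat n n" by (simp add: X_mat_def)
    have E: "E_mat n (Suc m) $$ (i, j) = (\<Sum>r<n. E_mat n m $$ (i, r) * ?N $$ (r, j))" if "i < n" "j < n" for i j
      unfolding E_mat_def pow_mat.simps using that N by (intro index_mult_mat_sum) auto
    have N1: "cnj (?N $$ (r, j)) = ?N $$ (r, j)" "r \<noteq> j + 1 \<Longrightarrow> ?N $$ (r, j) = 0" if "r < n" "j < n" for r j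
      using that by (auto simp: X_mat_def)
    show ?case
    proof (intro allI impI conjI)
      fix i j assume ij: "i < n" "j < n"
      show "cnj (E_mat n (Suc m) $$ (i, j)) = E_mat n (Suc m) $$ (i, j)"
        unfolding E[OF ij] cnj_sum using Suc ij N1(1) by (intro sum.cong) (auto simp del: index_smult_mat)
      show "E_mat n (Suc m) $$ (i, j) = 0" if "i \<noteq> j + Suc m"
        unfolding E[OF ij]
      proof (intro sum.neutral ballI)
        fix r assume r: "r \<in> {..<n}"
        show "E_mat n m $$ (i, r) * ?N $$ (r, j) = 0"
          using Suc ij r that N1(2)[of r j] by (cases "r = j + 1") (auto simp del: index_smult_mat)
      qed
    qed
  qed
  then show "cnj (E_mat n m $$ (i, j)) = E_mat n m $$ (i, j)" "i \<noteq> j + m \<Longrightarrow> E_mat n m $$ (i, j) = 0"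
    using assms by auto
qed

text \<open>The transpose has the same diagonal entries because the eigenbasis is real and
  orthogonal; this is why q and its conjugate will contribute with equal coefficients.\<close>

lemma E_mat_diag:
  assumes a: "a < n"
  shows "(\<Sum>i<n. \<Sum>j<n. eigenbasis_inv n $$ (a, i) * E_mat n m $$ (i, j) * eigenbasis n $$ (j, a)) = complex_of_real (E_diag n m a)" (is ?A)
    and "(\<Sum>i<n. \<Sum>j<n. eigenbasis_inv n $$ (a, i) * cnj (E_mat n m $$ (j, i)) * eigenbasis n $$ (j, a)) = complex_of_real (E_diag n m a)" (is ?B)
proof -
  let ?u = "\<lambda>j. complex_of_real (unitary_coeff n (eigenpoly n a) j)" let ?g = "complex_of_real (eigen_norm n a)"
  have deg: "degree (eigenpoly n a) < n" using a by (simp add: degree_eigenpoly)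
  have main: "(\<Sum>i<n. ?u i / ?g * (\<Sum>j<n. E_mat n m $$ (i, j) * ?u j)) = complex_of_real (E_diag n m a)"
  proof -
    have "(\<Sum>i<n. ?u i / ?g * (\<Sum>j<n. E_mat n m $$ (i, j) * ?u j)) = complex_of_real
        ((\<Sum>i<n. unitary_coeff n (eigenpoly n a) i * unitary_coeff n ((pderiv ^^ m) (eigenpoly n a)) i) / eigen_norm n a)"
      by (simp add: E_mat_action[OF deg] sum_divide_distrib)
    then show ?thesis using E_diag_eq[OF a] eigen_norm_pos[OF a] by simp
  qed
  show ?A using a by (simp add: main[symmetric] eigenbasis_def eigenbasis_inv_def sum_distrib_left mult.assoc)
  have "(\<Sum>i<n. \<Sum>j<n. eigenbasis_inv n $$ (a, i) * cnj (E_mat n m $$ (j, i)) * eigenbasis n $$ (j, a)) =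
      (\<Sum>i<n. \<Sum>j<n. ?u j / ?g * (E_mat n m $$ (j, i) * ?u i))"
    using a by (intro sum.cong refl) (simp add: eigenbasis_def eigenbasis_inv_def E_mat_entry mult_ac)
  also have "\<dots> = (\<Sum>j<n. ?u j / ?g * (\<Sum>i<n. E_mat n m $$ (j, i) * ?u i))"
    unfolding sum_distrib_left by (rule sum.swap)
  finally show ?B using main by simp
qed

text \<open>Substitute i = k - j. Written in factorials, (p-1)! (n-p)! / (n-k)! C(n-k, p-j) C(k-1,
  j-1)^2 equals (k-1)! C(k-1, i) C(p-1, k-1-i) C(n-p, i), and the sign is -(-1)^i.\<close>

lemma eigenvalue_const_eq_E_diag:
  assumes "2 \<le> k" "k \<le> n" "1 \<le> p" "p \<le> n"
  shows "eigenvalue_const n k p = - 2 * E_diag n (k - 1) (p - 1)"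
proof -
  let ?m = "k - 1" and ?a = "p - 1" and ?b = "n - p"
  define F where "F i = (- 1) ^ i * real (?m choose i) * real (?a choose (?m - i)) * real (?b choose i)" for i
  define J where "J = {max 1 (k + p - n)..min k p}"
  have summand: "fact ?a * fact ?b / fact (n - k) * (real ((n - k) choose (p - j)) * (real (?m choose (j - 1)))\<^sup>2 * (- 1) ^ (j + k + 1)) =
      - (fact ?m * F (k - j))" if j: "j \<in> J" for j
  proof -
    have j': "1 \<le> j" "k + p - n \<le> j" "j \<le> k" "j \<le> p" using j by (auto simp: J_def)
    define i where "i = k - j"
    have i: "i \<le> ?m" "?m - i = j - 1" "j - 1 \<le> ?a" "i \<le> ?b" "?a - (j - 1) = p - j" "?b - i = n - k - (p - j)"
      "p - j \<le> n - k" "?m choose (j - 1) = ?m choose i"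
      using j' assms binomial_symmetric[of i ?m] by (auto simp: i_def)
    have s: "(- 1 :: real) ^ (j + k + 1) = - ((- 1) ^ i)"
    proof -
      have "j + k + 1 = i + 2 * j + 1" using j' by (simp add: i_def)
      then show ?thesis by (simp add: power_add power_mult)
    qed
    have 1: "real ((n - k) choose (p - j)) = fact (n - k) / (fact (p - j) * fact (n - k - (p - j)))"
      using i by (simp add: binomial_fact)
    have 2: "real (?a choose (j - 1)) = fact ?a / (fact (j - 1) * fact (p - j))"
      using i by (simp add: binomial_fact)
    have 3: "real (?b choose i) = fact ?b / (fact i * fact (n - k - (p - j)))"
      using i by (simp add: binomial_fact)
    have 4: "real (?m choose i) = fact ?m / (fact i * fact (j - 1))"
      using i by (simp add: binomial_fact)
    show ?thesis
      unfolding F_def i_def[symmetric] i(2) i(8) s 1 2 3 4 power2_eq_square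
      by (simp add: field_simps)
  qed
  have bij: "(\<Sum>j\<in>J. F (k - j)) = (\<Sum>i\<le>?m. F i)"
  proof -
    have "(\<Sum>j\<in>J. F (k - j)) = (\<Sum>i\<in>(\<lambda>j. k - j) ` J. F i)"
      by (subst sum.reindex) (auto simp: J_def inj_on_def)
    also have "\<dots> = (\<Sum>i\<le>?m. F i)"
    proof (rule sum.mono_neutral_left)
      \<comment> \<open>The limits of J cut off exactly those i for which k - 1 - i > p - 1 or i > n
        - p, where a binomial is zero.\<close>
      show "\<forall>i\<in>{..?m} - (\<lambda>j. k - j) ` J. F i = 0"
      proof
        fix i assume i: "i \<in> {..?m} - (\<lambda>j. k - j) ` J"
        then have "k - i \<notin> J" using assms by (metis DiffE atMost_iff diff_diff_cancel diff_le_self image_eqI le_trans)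
        then have "?m - i > ?a \<or> i > ?b" using i assms by (auto simp: J_def)
        then show "F i = 0" by (auto simp: F_def binomial_eq_0)
      qed
    qed (use assms in \<open>auto simp: J_def\<close>)
    finally show ?thesis .
  qed
  have S: "(\<Sum>j\<in>J. fact ?a * fact ?b / fact (n - k) *
      (real ((n - k) choose (p - j)) * (real (?m choose (j - 1)))\<^sup>2 * (- 1) ^ (j + k + 1))) =
      (\<Sum>j\<in>J. - (fact ?m * F (k - j)))"
    by (rule sum.cong[OF refl summand])
  have "eigenvalue_const n k p = (\<Sum>j\<in>J. fact ?a * fact ?b / fact (n - k) *
      (real ((n - k) choose (p - j)) * (real (?m choose (j - 1)))\<^sup>2 * (- 1) ^ (j + k + 1))) / 2 ^ (k - 2)"
    unfolding eigenvalue_const_def J_def[symmetric] sum_distrib_left sum_divide_distrib by (simp add: field_simps)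
  also have "\<dots> = - (fact ?m * (\<Sum>i\<le>?m. F i)) / 2 ^ (k - 2)"
    unfolding S by (simp only: sum_negf sum_distrib_left[symmetric] bij)
  also have "\<dots> = - 2 * E_diag n ?m ?a"
  proof -
    \<comment> \<open>From k >= 2 one gets 2^(k-1) = 2 * 2^(k-2), which absorbs the factor
      2.\<close>
    have "?m = Suc (k - 2)" using assms by simp
    then have "(2::real) ^ ?m = 2 * 2 ^ (k - 2)" by (simp only: power_Suc)
    moreover have "n - 1 - ?a = ?b" using assms by simp
    ultimately show ?thesis unfolding E_diag_def F_def by simp
  qed
  finally show ?thesis .
qed

text \<open>For p = 1 the sum has the single index j = 1, both binomials are 1, and the sign is
  (-1)^(k+2).\<close>

lemma eigenvalue_const_first:
  assumes "2 \<le> k" "k \<le> n"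
  shows "eigenvalue_const n k 1 = (- 1) ^ k * fact (n - 1) / (2 ^ (k - 2) * fact (n - k))"
proof -
  have "{max 1 (k + 1 - n)..min k 1} = {1::nat}" using assms by auto
  then show ?thesis by (simp add: eigenvalue_const_def)
qed

text \<open>For k = n the sum has the single index j = p, and (p-1)! (n-p)! times one of the two
  equal binomials is (n-1)!.\<close>

lemma eigenvalue_const_top:
  assumes "2 \<le> n" "1 \<le> p" "p \<le> n"
  shows "eigenvalue_const n n p = (- 1) ^ (p + n + 1) * (fact (n - 1) / 2 ^ (n - 2)) * real ((n - 1) choose (p - 1))"
proof -
  have J: "{max 1 (n + p - n)..min n p} = {p}" using assms by auto
  have "real ((n - 1) choose (p - 1)) = fact (n - 1) / (fact (p - 1) * fact (n - p))"
    using assms by (simp add: binomial_fact)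
  then show ?thesis unfolding eigenvalue_const_def J by (simp add: field_simps power2_eq_square)
qed

section \<open>Twists\<close>

lemma index_twist [simp]:
  "i < n \<Longrightarrow> j < n \<Longrightarrow> twist n l M $$ (i, j) = l powi (int i - int j) * M $$ (i, j)"
  "dim_row (twist n l M) = n" "dim_col (twist n l M) = n" "twist n l M \<in> carrier_mat n n"
  by (simp_all add: twist_def)

lemma twist_twist: "twist n a (twist n b M) = twist n (a * b) M"
  by (rule eq_matI) (simp_all add: power_int_mult_distrib mult_ac)

lemma twist_one: "M \<in> carrier_mat n n \<Longrightarrow> twist n 1 M = M"
  by (rule eq_matI) simp_all

text \<open>A twist by l is conjugation by the diagonal matrix of the powers l^i; entrywise this is
  additivity of the weight i - j, with l nonzero because weights may be negative.\<close>

lemma twist_mult: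
  assumes "l \<noteq> 0" and M: "M \<in> carrier_mat n n" and N: "N \<in> carrier_mat n n"
  shows "twist n l (M * N) = twist n l M * twist n l N"
proof (rule eq_matI)
  fix i j assume "i < dim_row (twist n l M * twist n l N)" "j < dim_col (twist n l M * twist n l N)"
  then have ij: "i < n" "j < n" by auto
  have e: "int i - int j = (int i - int r) + (int r - int j)" for r by simp
  have "l powi (int i - int j) * (M $$ (i, r) * N $$ (r, j)) =
      l powi (int i - int r) * M $$ (i, r) * (l powi (int r - int j) * N $$ (r, j))" for r
    unfolding e[of r] using assms(1) by (subst power_int_add) simp_all
  then show "twist n l (M * N) $$ (i, j) = (twist n l M * twist n l N) $$ (i, j)"
    using ij M N by (simp only: index_mult_mat_sum[of _ n] index_twist sum_distrib_left) simp
qed (use M N in auto)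

lemma twist_add:
  "M \<in> carrier_mat n n \<Longrightarrow> N \<in> carrier_mat n n \<Longrightarrow> twist n l (M + N) = twist n l M + twist n l N"
  by (rule eq_matI) (simp_all add: distrib_left)

lemma twist_bracket:
  assumes "l \<noteq> 0" "M \<in> carrier_mat n n" "N \<in> carrier_mat n n"
  shows "twist n l (bracket M N) = bracket (twist n l M) (twist n l N)"
proof -
  have "twist n l (bracket M N) = twist n l (M * N) - twist n l (N * M)"
    unfolding bracket_def using assms by (intro eq_matI) (simp_all add: right_diff_distrib del: index_mult_mat(1))
  then show ?thesis using assms by (simp add: bracket_def twist_mult)
qed

lemma bracket_carrier [simp]: "M \<in> carrier_mat n n \<Longrightarrow> N \<in> carrier_mat n n \<Longrightarrow> bracket M N \<in> carrier_mat n n"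
  unfolding bracket_def by (intro minus_carrier_mat mult_carrier_mat)

lemma bracket_add_left:
  "M \<in> carrier_mat n n \<Longrightarrow> N \<in> carrier_mat n n \<Longrightarrow> P \<in> carrier_mat n n \<Longrightarrow>
    bracket (M + N) P = bracket M P + bracket N P"
  unfolding bracket_def
  by (intro eq_matI) (simp_all add: add_mult_distrib_mat[of _ n n] mult_add_distrib_mat[of _ n n] del: index_mult_mat(1))

lemma index_bracket:
  "M \<in> carrier_mat n n \<Longrightarrow> N \<in> carrier_mat n n \<Longrightarrow> i < n \<Longrightarrow> j < n \<Longrightarrow>
    bracket M N $$ (i, j) = (\<Sum>l<n. M $$ (i, l) * N $$ (l, j)) - (\<Sum>l<n. N $$ (i, l) * M $$ (l, j))"
  unfolding bracket_def by (simp add: index_mult_mat_sum[of _ n] del: index_mult_mat(1))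

section \<open>The forms of D and of the deformation in a frame of unit speed\<close>

lemma index_mat_adjoint:
  fixes M :: "complex mat"
  assumes "M \<in> carrier_mat n n" "i < n" "j < n"
  shows "mat_adjoint M $$ (i, j) = cnj (M $$ (j, i))" "mat_adjoint M \<in> carrier_mat n n"
  using assms by (auto simp: mat_adjoint_def mat_of_rows_def)

text \<open>X Y and Y X are diagonal with entries - c_i^2 and - c_(i+1)^2, so the entry of A is
  c_i^2 - c_(i+1)^2; since c_0 = c_n = 0, the formula also holds in the first and last row.\<close>

lemma A_mat_entry:
  assumes "i < n" "j < n"
  shows "A_mat n $$ (i, j) = (if i = j then of_real (real i - (real n - 1) / 2) else 0)"
proof -
  have c: "X_mat n \<in> carrier_mat n n" "Y_mat n \<in> carrier_mat n n"
    by (simp_all add: X_mat_def Y_mat_def)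
  have "(\<Sum>l<n. X_mat n $$ (i, l) * Y_mat n $$ (l, j)) =
      (\<Sum>l<n. if i = l + 1 then if i = j then - of_real ((c_coef n i)\<^sup>2) else 0 else 0)"
    using assms by (intro sum.cong) (auto simp: X_mat_def Y_mat_def power2_eq_square)
  also have "\<dots> = (if i = j then - of_real ((c_coef n i)\<^sup>2) else 0)"
    using assms by (cases i) (auto simp: sum.delta' c_coef_def)
  also have "(c_coef n i)\<^sup>2 = real i * (real n - real i) / 2"
    using assms by (simp add: c_coef_def)
  finally have XY: "(\<Sum>l<n. X_mat n $$ (i, l) * Y_mat n $$ (l, j)) = (if i = j then - of_real (real i * (real n - real i) / 2) else 0)" .
  have "(\<Sum>l<n. Y_mat n $$ (i, l) * X_mat n $$ (l, j)) =
      (\<Sum>l<n. if l = i + 1 then if i = j then - of_real ((c_coef n (i + 1))\<^sup>2) else 0 else 0)"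
    using assms by (intro sum.cong) (auto simp: X_mat_def Y_mat_def power2_eq_square)
  also have "\<dots> = (if i = j then - of_real ((c_coef n (i + 1))\<^sup>2) else 0)"
  proof (cases "i + 1 < n")
    case False
    then have "i + 1 = n" using assms by simp
    then have "c_coef n (i + 1) = 0" by (simp add: c_coef_def)
    then show ?thesis using False by (auto intro!: sum.neutral)
  qed (simp add: sum.delta)
  also have "(c_coef n (i + 1))\<^sup>2 = (real i + 1) * (real n - real i - 1) / 2"
  proof -
    have "0 \<le> (real i + 1) * (real n - real i - 1)" using assms by (intro mult_nonneg_nonneg) auto
    then have "0 \<le> (real i + 1) * (real n - real i - 1) / 2" by simp
    moreover have "c_coef n (i + 1) = sqrt ((real i + 1) * (real n - real i - 1) / 2)"
      by (simp add: c_coef_def algebra_simps)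
    ultimately show ?thesis by (simp only: real_sqrt_pow2)
  qed
  finally have YX: "(\<Sum>l<n. Y_mat n $$ (i, l) * X_mat n $$ (l, j)) =
    (if i = j then - of_real ((real i + 1) * (real n - real i - 1) / 2) else 0)" .
  have "A_mat n $$ (i, j) = - ((\<Sum>l<n. X_mat n $$ (i, l) * Y_mat n $$ (l, j)) - (\<Sum>l<n. Y_mat n $$ (i, l) * X_mat n $$ (l, j)))"
    using assms carrier_matD[OF bracket_carrier[OF c]] unfolding A_mat_def by (simp add: index_bracket[OF c])
  also have "\<dots> = (if i = j then of_real (real i * (real n - real i) / 2 - (real i + 1) * (real n - real i - 1) / 2) else 0)"
    unfolding XY YX by simp
  also have "real i * (real n - real i) / 2 - (real i + 1) * (real n - real i - 1) / 2 = real i - (real n - 1) / 2"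
    by (simp add: field_simps)
  finally show ?thesis .
qed

lemma A_mat_carrier: "A_mat n \<in> carrier_mat n n"
  unfolding A_mat_def by (simp add: X_mat_def Y_mat_def)

lemma bracket_A_mat:
  assumes "M \<in> carrier_mat n n" "i < n" "j < n"
  shows "bracket (A_mat n) M $$ (i, j) = of_int (int i - int j) * M $$ (i, j)"
proof -
  have "(\<Sum>l<n. A_mat n $$ (i, l) * M $$ (l, j)) = (\<Sum>l<n. if l = i then of_real (real i - (real n - 1) / 2) * M $$ (i, j) else 0)"
    using assms by (intro sum.cong) (auto simp: A_mat_entry)
  also have "\<dots> = of_real (real i - (real n - 1) / 2) * M $$ (i, j)"
    using assms by (simp only: sum.delta' sum.delta finite_lessThan lessThan_iff if_True)
  finally have 1: "(\<Sum>l<n. A_mat n $$ (i, l) * M $$ (l, j)) = of_real (real i - (real n - 1) / 2) * M $$ (i, j)" .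
  have "(\<Sum>l<n. M $$ (i, l) * A_mat n $$ (l, j)) = (\<Sum>l<n. if l = j then of_real (real j - (real n - 1) / 2) * M $$ (i, j) else 0)"
    using assms by (intro sum.cong) (auto simp: A_mat_entry)
  also have "\<dots> = of_real (real j - (real n - 1) / 2) * M $$ (i, j)"
    using assms by (simp only: sum.delta' sum.delta finite_lessThan lessThan_iff if_True)
  finally have 2: "(\<Sum>l<n. M $$ (i, l) * A_mat n $$ (l, j)) = of_real (real j - (real n - 1) / 2) * M $$ (i, j)" .
  show ?thesis unfolding index_bracket[OF A_mat_carrier assms] 1 2 by (simp add: algebra_simps)
qed

text \<open>For a vector v of unit length, r * cnj v is the inverse of v; this cancels the metric
  coefficient in the twisted frame.\<close>

lemma cnj_mult_eq_inverse:
  assumes "r * (cmod v)\<^sup>2 = 1"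
  shows "complex_of_real r * cnj v * v = 1" "complex_of_real r * v * cnj v = 1"
proof -
  have "complex_of_real (r * (cmod v)\<^sup>2) = 1" by (simp only: assms of_real_1)
  then show "complex_of_real r * v * cnj v = 1" by (simp only: of_real_mult complex_norm_square mult_ac)
  then show "complex_of_real r * cnj v * v = 1" by (simp only: mult_ac)
qed

lemma D_form_entry:
  assumes "i < n" "j < n"
  shows "D_form n h c x v $$ (i, j) = - d_log_h h c x * v * A_mat n $$ (i, j) + v * Y_mat n $$ (i, j) +
      of_real (h c x) powi (int i - int j) * cnj (v * Y_mat n $$ (j, i))"
proof -
  have c: "v \<cdot>\<^sub>m Y_mat n \<in> carrier_mat n n" by (simp add: Y_mat_def)
  show ?thesis
    unfolding D_form_def cartan_involution_def
    using assms c carrier_matD[OF A_mat_carrier[of n]] index_mat_adjoint[OF c assms] by (simp add: Y_mat_def)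
qed

lemma D_form_carrier [simp]: "D_form n h c x v \<in> carrier_mat n n"
  unfolding D_form_def cartan_involution_def by (intro minus_carrier_mat) simp

lemma D_form_dim [simp]: "dim_row (D_form n h c x v) = n" "dim_col (D_form n h c x v) = n"
  using D_form_carrier[of n h c x v] by (rule carrier_matD)+

text \<open>Twisting by v multiplies the superdiagonal by 1/v and the subdiagonal by v. Against the
  entries v c and h (cnj v) c this leaves the constants c, so only the Chern term still depends on
  the point.\<close>

lemma twist_D_form:
  assumes v: "v \<noteq> 0" "h c x * (cmod v)\<^sup>2 = 1"
  shows "twist n v (D_form n h c x v) = (- d_log_h h c x * v) \<cdot>\<^sub>m A_mat n + H_mat n"
proof -
  have c: "A_mat n \<in> carrier_mat n n" by (rule A_mat_carrier)
  have hv: "complex_of_real (h c x) * cnj v * v = 1"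
    using v(2) by (rule cnj_mult_eq_inverse)
  show "twist n v (D_form n h c x v) = (- d_log_h h c x * v) \<cdot>\<^sub>m A_mat n + H_mat n"
  proof (rule eq_matI)
    fix i j assume "i < dim_row ((- d_log_h h c x * v) \<cdot>\<^sub>m A_mat n + H_mat n)"
      "j < dim_col ((- d_log_h h c x * v) \<cdot>\<^sub>m A_mat n + H_mat n)"
    then have ij: "i < n" "j < n" by (auto simp: H_mat_def)
    consider "i = j" | "j = i + 1" | "i = j + 1" | "i \<noteq> j" "j \<noteq> i + 1" "i \<noteq> j + 1" by blast
    then show "twist n v (D_form n h c x v) $$ (i, j) = ((- d_log_h h c x * v) \<cdot>\<^sub>m A_mat n + H_mat n) $$ (i, j)"
    proof cases
      case 2
      then show ?thesis using ij v c by (simp add: D_form_entry A_mat_entry Y_mat_def H_mat_def H_entry_def power_int_minus)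
    next
      case 3
      then show ?thesis using ij v c hv by (simp add: D_form_entry A_mat_entry Y_mat_def H_mat_def H_entry_def mult_ac)
    qed (use ij c in \<open>simp_all add: D_form_entry A_mat_entry Y_mat_def H_mat_def H_entry_def\<close>)
  qed (simp_all add: H_mat_def)
qed

text \<open>The weight k - 1 of \<open>E_mat n (k - 1)\<close> gives v^(k-1), and evaluating the
  form gives one more v. For the adjoint part, h v = 1 / cnj v turns the negative weight into powers
  of cnj v.\<close>

lemma twist_psi0:
  assumes v: "v \<noteq> 0" "h c x * (cmod v)\<^sup>2 = 1" and k: "1 \<le> k" and ij: "i < n" "j < n"
  shows "twist n v (psi0 n k h q c x v) $$ (i, j) =
    q c x * v ^ k * E_mat n (k - 1) $$ (i, j) + cnj (q c x * v ^ k) * cnj (E_mat n (k - 1) $$ (j, i))"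
    and "psi0 n k h q c x v \<in> carrier_mat n n"
proof -
  let ?E = "E_mat n (k - 1)"
  have c: "phi0 n k q c x v \<in> carrier_mat n n" by (simp add: phi0_def)
  then show "psi0 n k h q c x v \<in> carrier_mat n n" unfolding psi0_def cartan_involution_def by (intro minus_carrier_mat) simp
  have hv: "complex_of_real (h c x) * v = inverse (cnj v)"
    using cnj_mult_eq_inverse(2)[OF v(2)] v(1) by (simp add: field_simps)
  have sub: "psi0 n k h q c x v $$ (i, j) = q c x * v * ?E $$ (i, j) + of_real (h c x) powi (int i - int j) * cnj (q c x * v * ?E $$ (j, i))"
    using ij c index_mat_adjoint[OF c ij] carrier_matD[OF eigenbasis_carrier(4)[of n "k - 1"]]
    unfolding psi0_def cartan_involution_def by (simp add: phi0_def)
  have 1: "v powi (int i - int j) * (q c x * v * ?E $$ (i, j)) = q c x * v ^ k * ?E $$ (i, j)"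
  proof (cases "i = j + (k - 1)")
    case True
    then have "int i - int j = int (k - 1)" by simp
    then have "v powi (int i - int j) * v = v ^ (k - 1) * v" by (simp only: power_int_of_nat)
    also have "\<dots> = v ^ k" using k by (simp flip: power_Suc2)
    finally show ?thesis by (simp add: mult_ac)
  qed (simp add: E_mat_entry(2)[OF ij])
  have 2: "v powi (int i - int j) * (of_real (h c x) powi (int i - int j) * cnj (q c x * v * ?E $$ (j, i))) =
      cnj (q c x * v ^ k) * cnj (?E $$ (j, i))"
  proof (cases "j = i + (k - 1)")
    case True
    have d: "int i - int j = - int (k - 1)" using True by simp
    have "v powi (int i - int j) * of_real (h c x) powi (int i - int j) * cnj v =
        (inverse (cnj v)) powi (- int (k - 1)) * cnj v"
      unfolding hv[symmetric] power_int_mult_distrib d by (simp only: mult_ac)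
    also have "\<dots> = cnj v ^ (k - 1) * cnj v"
      by (simp only: power_int_minus power_int_of_nat power_inverse inverse_inverse_eq)
    also have "\<dots> = cnj v ^ k" using k by (simp flip: power_Suc2)
    finally have "v powi (int i - int j) * of_real (h c x) powi (int i - int j) * cnj v = cnj v ^ k" .
    then show ?thesis by (simp add: mult_ac)
  qed (simp add: E_mat_entry(2)[OF ij(2,1)])
  show "twist n v (psi0 n k h q c x v) $$ (i, j) =
    q c x * v ^ k * ?E $$ (i, j) + cnj (q c x * v ^ k) * cnj (?E $$ (j, i))"
    using ij by (simp only: index_twist sub distrib_left 1 2)
qed

section \<open>Frames along a closed geodesic\<close>

lemma G_formD:
  assumes \<alpha>: "G_form atlas n \<alpha>" and c: "c \<in> atlas"
  shows "x \<in> fst c \<Longrightarrow> \<alpha> c x v \<in> sl n"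
    and "x \<in> fst c \<Longrightarrow> i < n \<Longrightarrow> j < n \<Longrightarrow> linear (\<lambda>v. \<alpha> c x v $$ (i, j))"
    and "i < n \<Longrightarrow> j < n \<Longrightarrow> smooth (snd c ` fst c) (in_chart c (\<lambda>x. \<alpha> c x v $$ (i, j)))"
    and "c' \<in> atlas \<Longrightarrow> x \<in> fst c \<inter> fst c' \<Longrightarrow>
      \<alpha> c x v = twist n (transition c c' x) (\<alpha> c' x (transition c c' x * v))"
proof -
  note 1 = conjunct1[OF \<alpha>[unfolded G_form_def], THEN bspec, OF c]
  note 2 = conjunct2[OF \<alpha>[unfolded G_form_def], THEN bspec, OF c]
  show "\<alpha> c x v \<in> sl n" if "x \<in> fst c"
    using conjunct1[OF 1, THEN bspec, OF that, THEN conjunct1] by (rule spec)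
  show "linear (\<lambda>v. \<alpha> c x v $$ (i, j))" if "x \<in> fst c" "i < n" "j < n"
    by (rule conjunct1[OF 1, THEN bspec, OF that(1), THEN conjunct2, THEN spec, THEN mp, OF that(2), THEN spec, THEN mp, OF that(3)])
  show "smooth (snd c ` fst c) (in_chart c (\<lambda>x. \<alpha> c x v $$ (i, j)))" if "i < n" "j < n"
    by (rule conjunct2[OF 1, THEN spec, THEN spec, THEN mp, OF that(1), THEN spec, THEN mp, OF that(2)])
  show "\<alpha> c x v = twist n (transition c c' x) (\<alpha> c' x (transition c c' x * v))"
    if "c' \<in> atlas" "x \<in> fst c \<inter> fst c'"
    using 2[THEN bspec, OF that(1), THEN bspec, OF that(2)] by (rule spec)
qed

locale geodesic_on_surface =
  fixes atlas :: "'a::t2_space chart set" and h :: "'a chart \<Rightarrow> 'a \<Rightarrow> real" and \<gamma> :: "real \<Rightarrow> 'a" and L :: real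
  assumes surface: "riemann_surface atlas"
    and geodesic: "simple_closed_geodesic atlas h \<gamma> L"
begin

lemma L_pos: "L > 0" and continuous_\<gamma>: "continuous_on UNIV \<gamma>" and periodic: "\<gamma> (s + L) = \<gamma> s"
  using geodesic by (auto simp: simple_closed_geodesic_def)

lemma chart_exists: "\<exists>c. c \<in> atlas \<and> x \<in> fst c"
  using surface UNIV_I[of x] unfolding riemann_surface_def by blast

lemma chart:
  assumes "c \<in> atlas"
  shows "open (fst c)" "open (snd c ` fst c)" "continuous_on (fst c) (snd c)"
    "homeomorphism (fst c) (snd c ` fst c) (snd c) (inv_into (fst c) (snd c))"
    "x \<in> fst c \<Longrightarrow> in_chart c f (snd c x) = f x"
  using surface assms unfolding riemann_surface_def in_chart_def homeomorphism_def by auto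

lemma open_chart_times: "c \<in> atlas \<Longrightarrow> open (\<gamma> -` fst c)"
  using continuous_\<gamma> by (intro open_vimage chart)

lemma velocity:
  assumes "c \<in> atlas" "\<gamma> s \<in> fst c"
  shows "((snd c \<circ> \<gamma>) has_vector_derivative velocity c \<gamma> s) (at s)"
    and "h c (\<gamma> s) * (cmod (velocity c \<gamma> s))\<^sup>2 = 1" "velocity c \<gamma> s \<noteq> 0"
    and "(velocity c \<gamma> has_vector_derivative - d_log_h h c (\<gamma> s) * (velocity c \<gamma> s)\<^sup>2) (at s)"
proof -
  have *: "(snd c \<circ> \<gamma>) differentiable (at s) \<and> h c (\<gamma> s) * (cmod (velocity c \<gamma> s))\<^sup>2 = 1 \<and>
      (velocity c \<gamma> has_vector_derivative - d_log_h h c (\<gamma> s) * (velocity c \<gamma> s)\<^sup>2) (at s)"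
    using geodesic assms unfolding simple_closed_geodesic_def by blast
  show "((snd c \<circ> \<gamma>) has_vector_derivative velocity c \<gamma> s) (at s)"
    using * unfolding velocity_def by (simp only: vector_derivative_works)
  show "h c (\<gamma> s) * (cmod (velocity c \<gamma> s))\<^sup>2 = 1" 
    "(velocity c \<gamma> has_vector_derivative - d_log_h h c (\<gamma> s) * (velocity c \<gamma> s)\<^sup>2) (at s)"
    using * by auto
  then show "velocity c \<gamma> s \<noteq> 0" by auto
qed

lemma velocity_transition:
  assumes c: "c \<in> atlas" "c' \<in> atlas" and s: "\<gamma> s \<in> fst c \<inter> fst c'"
  shows "velocity c' \<gamma> s = transition c c' (\<gamma> s) * velocity c \<gamma> s"
proof -
  let ?f = "in_chart c (snd c')" and ?S = "snd c ` (fst c \<inter> fst c')"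
  have "openin (top_of_set (snd c ` fst c)) ?S"
    using homeomorphism_imp_open_map[OF chart(4)[OF c(1)], of "fst c \<inter> fst c'"] chart(1) c
    by (simp add: openin_open_Int)
  then have "open ?S" using chart(2)[OF c(1)] by (simp add: openin_open_eq)
  moreover have "?f holomorphic_on ?S" using surface c unfolding riemann_surface_def by blast
  ultimately have "(?f has_field_derivative deriv ?f (snd c (\<gamma> s))) (at (snd c (\<gamma> s)))"
    using s by (intro holomorphic_derivI) auto
  then have f: "(?f has_field_derivative transition c c' (\<gamma> s)) (at ((snd c \<circ> \<gamma>) s))"
    by (simp add: transition_def)
  have "((?f \<circ> (snd c \<circ> \<gamma>)) has_vector_derivative velocity c \<gamma> s * transition c c' (\<gamma> s)) (at s)"
    by (rule field_vector_diff_chain_at[where f = "snd c \<circ> \<gamma>", OF velocity(1)[OF c(1)] f]) (use s in simp)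
  then have "((snd c' \<circ> \<gamma>) has_vector_derivative velocity c \<gamma> s * transition c c' (\<gamma> s)) (at s)"
  proof (rule has_vector_derivative_transform_within_open)
    show "open (\<gamma> -` fst c)" using c(1) by (rule open_chart_times)
    show "s \<in> \<gamma> -` fst c" using s by simp
    show "(?f \<circ> (snd c \<circ> \<gamma>)) t = (snd c' \<circ> \<gamma>) t" if "t \<in> \<gamma> -` fst c" for t
      using that chart(5)[OF c(1)] by simp
  qed
  then show ?thesis
    using velocity(1)[of c' s] c s by (auto dest: vector_derivative_unique_at simp: mult.commute)
qed

lemma velocity_periodic:
  assumes c: "c \<in> atlas" "\<gamma> s \<in> fst c"
  shows "velocity c \<gamma> (s + L) = velocity c \<gamma> s"
proof -
  have sL: "\<gamma> (s + L) \<in> fst c" using c periodic by simp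
  have "((snd c \<circ> \<gamma> \<circ> (\<lambda>t. t + L)) has_vector_derivative (1 *\<^sub>R velocity c \<gamma> (s + L))) (at s)"
    by (rule vector_diff_chain_at) (auto intro!: derivative_eq_intros velocity(1)[OF c(1) sL])
  moreover have "snd c \<circ> \<gamma> \<circ> (\<lambda>t. t + L) = snd c \<circ> \<gamma>" by (simp add: fun_eq_iff periodic)
  ultimately show ?thesis using velocity(1)[OF c] by (auto dest: vector_derivative_unique_at)
qed

text \<open>The same choice as in \<open>eval_differential\<close>, so that both refer to the same
  chart.\<close>

definition chart_at :: "real \<Rightarrow> 'a chart" where
  "chart_at s = (SOME c. c \<in> atlas \<and> \<gamma> s \<in> fst c)"

lemma chart_at: "chart_at s \<in> atlas" "\<gamma> s \<in> fst (chart_at s)"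
  using someI_ex[OF chart_exists[of "\<gamma> s"]] by (simp_all add: chart_at_def)

text \<open>Sections and forms along \<open>\<gamma>\<close> in the frame \<open>dz\<^sup>m\<close> with \<open>dz(\<gamma>') = 1\<close>; here \<open>D\<close> has constant
  coefficients, by the geodesic equation.\<close>

definition section_along :: "nat \<Rightarrow> ('a chart \<Rightarrow> 'a \<Rightarrow> complex mat) \<Rightarrow> real \<Rightarrow> complex mat" where
  "section_along n u s = twist n (velocity (chart_at s) \<gamma> s) (u (chart_at s) (\<gamma> s))"

definition form_along :: "nat \<Rightarrow> 'a G_form \<Rightarrow> real \<Rightarrow> complex mat" where
  "form_along n \<alpha> s = section_along n (\<lambda>c x. \<alpha> c x (velocity c \<gamma> s)) s"

lemma section_along_carrier [simp]: "section_along n u s \<in> carrier_mat n n" "form_along n \<alpha> s \<in> carrier_mat n n"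
  by (simp_all add: section_along_def form_along_def)

text \<open>The transition factor of the section cancels against that of the velocity. Since
  \<open>chart_at\<close> may jump with s, continuity and derivatives are studied after passing to
  one fixed chart in this way.\<close>

lemma section_along_eq:
  assumes u: "\<And>c c'. c \<in> atlas \<Longrightarrow> c' \<in> atlas \<Longrightarrow> \<gamma> s \<in> fst c \<inter> fst c' \<Longrightarrow>
      u c (\<gamma> s) = twist n (transition c c' (\<gamma> s)) (u c' (\<gamma> s))"
    and c: "c \<in> atlas" "\<gamma> s \<in> fst c"
  shows "section_along n u s = twist n (velocity c \<gamma> s) (u c (\<gamma> s))"
  using u[of c "chart_at s"] velocity_transition[of c "chart_at s" s] chart_at[of s] c
  by (simp add: section_along_def twist_twist mult.commute)

lemma form_along_eq:
  assumes \<alpha>: "G_form atlas n \<alpha>" and c: "c \<in> atlas" "\<gamma> s \<in> fst c"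
  shows "form_along n \<alpha> s = twist n (velocity c \<gamma> s) (\<alpha> c (\<gamma> s) (velocity c \<gamma> s))"
  unfolding form_along_def
proof (rule section_along_eq[OF _ c])
  fix c c' assume c: "c \<in> atlas" "c' \<in> atlas" "\<gamma> s \<in> fst c \<inter> fst c'"
  then show "\<alpha> c (\<gamma> s) (velocity c \<gamma> s) = twist n (transition c c' (\<gamma> s)) (\<alpha> c' (\<gamma> s) (velocity c' \<gamma> s))"
    using G_formD(4)[OF \<alpha> c] by (simp only: velocity_transition[OF c])
qed

lemma linear_complex_expand:
  assumes "linear (f :: complex \<Rightarrow> complex)"
  shows "f v = of_real (Re v) * f 1 + of_real (Im v) * f \<i>"
proof -
  have "f v = f (Re v *\<^sub>R 1 + Im v *\<^sub>R \<i>)" by (rule arg_cong[of _ _ f]) (simp add: complex_eq_iff)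
  also have "\<dots> = Re v *\<^sub>R f 1 + Im v *\<^sub>R f \<i>"
    using assms by (simp only: linear_add linear_scale)
  finally show ?thesis by (simp add: scaleR_conv_of_real)
qed

text \<open>Regularity of a form is available for each fixed vector; expanding the moving velocity
  over the basis 1, \<i> reduces to two such vectors.\<close>

lemma form_along_entry:
  assumes \<alpha>: "G_form atlas n \<alpha>" and c: "c \<in> atlas" "\<gamma> s \<in> fst c" and ij: "i < n" "j < n"
  shows "form_along n \<alpha> s $$ (i, j) = velocity c \<gamma> s powi (int i - int j) *
    (of_real (Re (velocity c \<gamma> s)) * \<alpha> c (\<gamma> s) 1 $$ (i, j) + of_real (Im (velocity c \<gamma> s)) * \<alpha> c (\<gamma> s) \<i> $$ (i, j))"
proof -
  have "linear (\<lambda>v. \<alpha> c (\<gamma> s) v $$ (i, j))" by (rule G_formD(2)[OF \<alpha> c ij])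
  note e = linear_complex_expand[OF this, of "velocity c \<gamma> s"]
  show ?thesis using ij by (simp only: form_along_eq[OF \<alpha> c] index_twist e)
qed

lemma trace_form_along:
  assumes \<alpha>: "G_form atlas n \<alpha>"
  shows "(\<Sum>i<n. form_along n \<alpha> s $$ (i, i)) = 0"
proof -
  have "\<alpha> (chart_at s) (\<gamma> s) v \<in> sl n" for v
    by (rule G_formD(1)[OF \<alpha> chart_at])
  then show ?thesis by (simp add: form_along_def section_along_def sl_def)
qed

lemma isCont_velocity:
  assumes "c \<in> atlas" "\<gamma> s \<in> fst c"
  shows "isCont (velocity c \<gamma>) s"
  using velocity(4)[OF assms] by (rule has_vector_derivative_continuous)

text \<open>Continuity is local: near (t, s) the one chart chosen at s serves for all neighbouring
  parameters.\<close>

lemma continuous_form_along: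
  fixes \<alpha> :: "'t::t2_space \<Rightarrow> 'a G_form"
  assumes T: "open T" and \<alpha>: "\<And>t. t \<in> T \<Longrightarrow> G_form atlas n (\<alpha> t)"
    and cont: "\<And>c v. c \<in> atlas \<Longrightarrow> continuous_on (T \<times> fst c) (\<lambda>(t, x). \<alpha> t c x v $$ (i, j))"
    and ij: "i < n" "j < n"
  shows "continuous_on (T \<times> UNIV) (\<lambda>(t, s). form_along n (\<alpha> t) s $$ (i, j))"
proof (rule continuous_at_imp_continuous_on, rule ballI)
  fix z assume "z \<in> T \<times> (UNIV :: real set)"
  then obtain t s where z: "z = (t, s)" and t: "t \<in> T" by auto
  let ?c = "chart_at s"
  let ?U = "T \<times> (\<gamma> -` fst ?c)"
  have c: "?c \<in> atlas" "\<gamma> s \<in> fst ?c" by (fact chart_at)+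
  have U: "open ?U" "(t, s) \<in> ?U" using T open_chart_times[OF c(1)] t c(2) by (auto intro: open_Times)
  have v: "continuous_on (\<gamma> -` fst ?c) (velocity ?c \<gamma>)"
    using isCont_velocity[OF c(1)] by (auto intro: continuous_at_imp_continuous_on)
  have v': "continuous_on ?U (\<lambda>p. velocity ?c \<gamma> (snd p))"
    by (rule continuous_on_compose2[OF v]) (auto intro!: continuous_intros)
  have \<alpha>': "continuous_on ?U (\<lambda>p. \<alpha> (fst p) ?c (\<gamma> (snd p)) v $$ (i, j))" for v
  proof -
    have "continuous_on ?U (\<lambda>p. (fst p, \<gamma> (snd p)))"
      by (intro continuous_intros continuous_on_compose2[OF continuous_\<gamma>]) auto
    then have "continuous_on ?U (\<lambda>p. (\<lambda>(t, x). \<alpha> t ?c x v $$ (i, j)) (fst p, \<gamma> (snd p)))"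
      by (rule continuous_on_compose2[OF cont[OF c(1)]]) auto
    then show ?thesis by simp
  qed
  have "continuous_on ?U (\<lambda>p. velocity ?c \<gamma> (snd p) powi (int i - int j) *
      (of_real (Re (velocity ?c \<gamma> (snd p))) * \<alpha> (fst p) ?c (\<gamma> (snd p)) 1 $$ (i, j) +
       of_real (Im (velocity ?c \<gamma> (snd p))) * \<alpha> (fst p) ?c (\<gamma> (snd p)) \<i> $$ (i, j)))"
    using velocity(3)[OF c(1)] by (intro continuous_intros v' \<alpha>') auto
  then have "continuous_on ?U (\<lambda>(t, s). form_along n (\<alpha> t) s $$ (i, j))"
    by (rule continuous_on_eq) (auto simp: form_along_entry[OF \<alpha> c(1) _ ij])
  then show "isCont (\<lambda>(t, s). form_along n (\<alpha> t) s $$ (i, j)) z"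
    unfolding z using U by (simp add: continuous_on_eq_continuous_at)
qed

lemma continuous_form_along_fixed:
  assumes \<alpha>: "G_form atlas n \<alpha>" and ij: "i < n" "j < n"
  shows "continuous_on S (\<lambda>s. form_along n \<alpha> s $$ (i, j))"
proof -
  have "continuous_on (UNIV \<times> UNIV) (\<lambda>(t::real, s). form_along n \<alpha> s $$ (i, j))"
  proof (rule continuous_form_along[where \<alpha> = "\<lambda>_. \<alpha>"])
    show "continuous_on (UNIV \<times> fst c) (\<lambda>(t, x). \<alpha> c x v $$ (i, j))" if c: "c \<in> atlas" for c v
    proof -
      have "smooth (snd c ` fst c) (in_chart c (\<lambda>x. \<alpha> c x v $$ (i, j)))"
        by (rule G_formD(3)[OF \<alpha> c ij])
      from this[unfolded smooth_def, rule_format, of 0]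
      have "continuous_on (snd c ` fst c) (in_chart c (\<lambda>x. \<alpha> c x v $$ (i, j)))" by (simp only: C_k.simps)
      from continuous_on_compose2[OF this chart(3)[OF c]]
      have "continuous_on (fst c) (\<lambda>x. in_chart c (\<lambda>x. \<alpha> c x v $$ (i, j)) (snd c x))" by simp
      then have "continuous_on (fst c) (\<lambda>x. \<alpha> c x v $$ (i, j))"
        by (rule continuous_on_eq) (simp add: chart(5)[OF c])
      from continuous_on_compose2[OF this, of "UNIV \<times> fst c" snd]
      show ?thesis by (simp add: case_prod_unfold continuous_on_snd subset_iff)
    qed
  qed (simp_all add: \<alpha> ij)
  from continuous_on_compose2[OF this, of S "\<lambda>s. (0, s)"]
  show ?thesis by (simp add: continuous_on_Pair)
qed

lemma form_along_derivative:
  assumes \<alpha>: "C1_family atlas n \<epsilon> \<alpha> \<alpha>'" and t: "t \<in> {- \<epsilon><..<\<epsilon>}" and ij: "i < n" "j < n"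
  shows "((\<lambda>t. form_along n (\<alpha> t) s $$ (i, j)) has_vector_derivative form_along n (\<alpha>' t) s $$ (i, j)) (at t)"
proof -
  let ?c = "chart_at s" let ?v = "velocity ?c \<gamma> s"
  have c: "?c \<in> atlas" "\<gamma> s \<in> fst ?c" by (fact chart_at)+
  have G: "G_form atlas n (\<alpha> r)" "G_form atlas n (\<alpha>' r)" if "r \<in> {- \<epsilon><..<\<epsilon>}" for r
    using conjunct1[OF \<alpha>[unfolded C1_family_def], THEN bspec, OF that] by (rule conjunct1, rule conjunct2)
  have d: "((\<lambda>t. \<alpha> t ?c (\<gamma> s) v $$ (i, j)) has_vector_derivative \<alpha>' t ?c (\<gamma> s) v $$ (i, j)) (at t)" for v
    by (rule conjunct2[OF \<alpha>[unfolded C1_family_def], THEN bspec, OF c(1), THEN spec, THEN spec, THEN mp, OF ij(1),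
        THEN spec, THEN mp, OF ij(2), THEN conjunct1, THEN bspec, OF t, THEN bspec, OF c(2)])
  have "((\<lambda>t. ?v powi (int i - int j) * (of_real (Re ?v) * \<alpha> t ?c (\<gamma> s) 1 $$ (i, j) + of_real (Im ?v) * \<alpha> t ?c (\<gamma> s) \<i> $$ (i, j)))
    has_vector_derivative form_along n (\<alpha>' t) s $$ (i, j)) (at t)"
    unfolding form_along_entry[OF G(2)[OF t] c ij]
    by (intro has_vector_derivative_mult_right has_vector_derivative_add d)
  then show ?thesis
    by (rule has_vector_derivative_transform_within_open[where S = "{- \<epsilon><..<\<epsilon>}"])
      (use t in \<open>auto simp: form_along_entry[OF G(1) c ij]\<close>)
qed

end

section \<open>Derivatives and parallel sections along the geodesic\<close>

lemma has_vector_derivative_power_int: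
  fixes f :: "real \<Rightarrow> complex"
  assumes "(f has_vector_derivative f') (at x within S)" "f x \<noteq> 0"
  shows "((\<lambda>t. f t powi m) has_vector_derivative of_int m * f x powi (m - 1) * f') (at x within S)"
  using has_derivative_power_int[OF assms(2) assms(1)[unfolded has_vector_derivative_def], of m]
  by (simp add: has_vector_derivative_def mult_ac)

lemma D_form_scale: "D_form n h c x (of_real r * v) = of_real r \<cdot>\<^sub>m D_form n h c x v"
proof (rule eq_matI)
  fix i j assume "i < dim_row (of_real r \<cdot>\<^sub>m D_form n h c x v)" "j < dim_col (of_real r \<cdot>\<^sub>m D_form n h c x v)"
  then have "i < n" "j < n" by simp_all
  then show "D_form n h c x (of_real r * v) $$ (i, j) = (of_real r \<cdot>\<^sub>m D_form n h c x v) $$ (i, j)"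
    by (simp add: D_form_entry algebra_simps)
qed simp_all

lemma index_bracket_smult_left:
  "M \<in> carrier_mat n n \<Longrightarrow> N \<in> carrier_mat n n \<Longrightarrow> i < n \<Longrightarrow> j < n \<Longrightarrow>
    bracket (k \<cdot>\<^sub>m M) N $$ (i, j) = k * bracket M N $$ (i, j)"
  by (subst (1 2) index_bracket[of _ n]) (simp_all add: sum_distrib_left algebra_simps)

lemma bracket_A_mat_add:
  assumes "H \<in> carrier_mat n n" "M \<in> carrier_mat n n" "i < n" "j < n"
  shows "bracket (k \<cdot>\<^sub>m A_mat n + H) M $$ (i, j) = k * of_int (int i - int j) * M $$ (i, j) + bracket H M $$ (i, j)"
proof -
  have c: "k \<cdot>\<^sub>m A_mat n \<in> carrier_mat n n" using A_mat_carrier by simp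
  show ?thesis
    using assms carrier_matD[OF bracket_carrier[OF assms(1,2)]] carrier_matD[OF bracket_carrier[OF c assms(2)]]
    by (simp add: bracket_add_left[OF c assms(1,2)] index_bracket_smult_left[OF A_mat_carrier] bracket_A_mat)
qed

text \<open>\<open>dir_deriv\<close> looks at one line only; the differentiability contained in
  \<open>C_k\<close> of order 1 identifies it with the Frechet derivative, to which the chain rule
  along \<gamma> applies.\<close>

lemma smooth_has_derivative:
  assumes "smooth S f" "w \<in> S"
  obtains f' where "(f has_derivative f') (at w)" "\<And>v. dir_deriv v f w = f' v"
proof -
  from assms(1)[unfolded smooth_def, rule_format, of 1] assms(2) have "f differentiable (at w)"
    by (simp add: numeral_eq_Suc)
  then obtain f' where f': "(f has_derivative f') (at w)" by (auto simp: differentiable_def)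
  have "dir_deriv v f w = f' v" for v
  proof -
    have "((\<lambda>t. w + of_real t * v) has_derivative (\<lambda>t. of_real t * v)) (at (0::real))"
      by (auto intro!: derivative_eq_intros)
    moreover have "(f has_derivative f') (at (w + of_real 0 * v))" using f' by simp
    ultimately have "((\<lambda>t. f (w + of_real t * v)) has_derivative (\<lambda>t. f' (of_real t * v))) (at 0)"
      by (rule has_derivative_compose)
    moreover have "f' (of_real t * v) = t *\<^sub>R f' v" for t
      using linear_scale[OF has_derivative_linear[OF f'], of t v] by (simp add: scaleR_conv_of_real)
    ultimately have "((\<lambda>t. f (w + of_real t * v)) has_vector_derivative f' v) (at 0)"
      by (simp add: has_vector_derivative_def)
    then show ?thesis unfolding dir_deriv_def by (rule vector_derivative_at)
  qed
  then show thesis using f' that by blast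
qed

lemma G_sectionD:
  assumes u: "G_section atlas n u" and c: "c \<in> atlas"
  shows "x \<in> fst c \<Longrightarrow> u c x \<in> sl n"
    and "i < n \<Longrightarrow> j < n \<Longrightarrow> smooth (snd c ` fst c) (in_chart c (\<lambda>x. u c x $$ (i, j)))"
    and "c' \<in> atlas \<Longrightarrow> x \<in> fst c \<inter> fst c' \<Longrightarrow> u c x = twist n (transition c c' x) (u c' x)"
proof -
  note 1 = conjunct1[OF u[unfolded G_section_def], THEN bspec, OF c]
  note 2 = conjunct2[OF u[unfolded G_section_def], THEN bspec, OF c]
  show "u c x \<in> sl n" if "x \<in> fst c"
    by (rule conjunct1[OF 1, THEN bspec, OF that])
  show "smooth (snd c ` fst c) (in_chart c (\<lambda>x. u c x $$ (i, j)))" if "i < n" "j < n"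
    by (rule conjunct2[OF 1, THEN spec, THEN mp, OF that(1), THEN spec, THEN mp, OF that(2)])
  show "u c x = twist n (transition c c' x) (u c' x)" if "c' \<in> atlas" "x \<in> fst c \<inter> fst c'"
    by (rule 2[THEN bspec, OF that(1), THEN bspec, OF that(2)])
qed

context geodesic_on_surface
begin

lemma section_along_G_section:
  assumes "G_section atlas n u" "c \<in> atlas" "\<gamma> s \<in> fst c"
  shows "section_along n u s = twist n (velocity c \<gamma> s) (u c (\<gamma> s))"
proof (rule section_along_eq[OF _ assms(2,3)])
  fix c c' assume "c \<in> atlas" "c' \<in> atlas" "\<gamma> s \<in> fst c \<inter> fst c'"
  then show "u c (\<gamma> s) = twist n (transition c c' (\<gamma> s)) (u c' (\<gamma> s))"
    by (rule G_sectionD(3)[OF assms(1)])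
qed

lemma twist_D_form_velocity:
  assumes "c \<in> atlas" "\<gamma> s \<in> fst c"
  shows "twist n (velocity c \<gamma> s) (D_form n h c (\<gamma> s) (velocity c \<gamma> s)) =
    (- d_log_h h c (\<gamma> s) * velocity c \<gamma> s) \<cdot>\<^sub>m A_mat n + H_mat n"
  by (rule twist_D_form) (rule velocity(3,2)[OF assms])+

text \<open>By the geodesic equation, the derivative of the factor V^m, for the weight m = i - j, is
  exactly the action of the Chern term of D; what remains of D besides d/ds is the bracket with
  H.\<close>

lemma section_along_has_vector_derivative:
  assumes u: "G_section atlas n u" and c: "c \<in> atlas" "\<gamma> s \<in> fst c" and ij: "i < n" "j < n"
  shows "((\<lambda>s. section_along n u s $$ (i, j)) has_vector_derivative
    twist n (velocity c \<gamma> s) (D_section n h u c (\<gamma> s) (velocity c \<gamma> s)) $$ (i, j) -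
    bracket (H_mat n) (section_along n u s) $$ (i, j)) (at s)"
proof -
  let ?V = "velocity c \<gamma> s" and ?m = "int i - int j" and ?x = "\<gamma> s"
  let ?f = "in_chart c (\<lambda>x. u c x $$ (i, j))" and ?k = "- d_log_h h c (\<gamma> s) * velocity c \<gamma> s"
  have carrier: "u c (\<gamma> s) \<in> carrier_mat n n" using G_sectionD(1)[OF u c] by (simp add: sl_def)
  have along: "section_along n u t = twist n (velocity c \<gamma> t) (u c (\<gamma> t))" if "\<gamma> t \<in> fst c" for t
    by (rule section_along_G_section[OF u c(1) that])
  obtain f' where f': "(?f has_derivative f') (at (snd c ?x))" "\<And>v. dir_deriv v ?f (snd c ?x) = f' v"
    by (rule smooth_has_derivative[OF G_sectionD(2)[OF u c(1) ij], of "snd c ?x"]) (use c in auto)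
  have "((?f \<circ> (snd c \<circ> \<gamma>)) has_vector_derivative f' ?V) (at s)"
    using vector_derivative_diff_chain_within[OF velocity(1)[OF c], of ?f f' ] f'(1)
    by (auto intro: has_derivative_at_withinI)
  from has_vector_derivative_mult[OF has_vector_derivative_power_int[OF velocity(4)[OF c] velocity(3)[OF c], of ?m] this]
  have "((\<lambda>t. velocity c \<gamma> t powi ?m * ?f (snd c (\<gamma> t))) has_vector_derivative
      ?V powi ?m * f' ?V + of_int ?m * ?V powi (?m - 1) * (- d_log_h h c ?x * ?V\<^sup>2) * u c ?x $$ (i, j)) (at s)"
    by (simp only: o_apply chart(5)[OF c])
  then have "((\<lambda>t. section_along n u t $$ (i, j)) has_vector_derivative
      ?V powi ?m * f' ?V + of_int ?m * ?V powi (?m - 1) * (- d_log_h h c ?x * ?V\<^sup>2) * u c ?x $$ (i, j)) (at s)"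
    by (rule has_vector_derivative_transform_within_open[where S = "\<gamma> -` fst c"])
      (use open_chart_times[OF c(1)] c(2) ij along chart(5)[OF c(1)] in auto)
  moreover have "twist n ?V (D_section n h u c ?x ?V) $$ (i, j) - bracket (H_mat n) (section_along n u s) $$ (i, j) =
      ?V powi ?m * f' ?V + of_int ?m * ?V powi (?m - 1) * (- d_log_h h c ?x * ?V\<^sup>2) * u c ?x $$ (i, j)"
  proof -
    have b: "?V powi ?m * bracket (D_form n h c ?x ?V) (u c ?x) $$ (i, j) =
        ?k * of_int ?m * (?V powi ?m * u c ?x $$ (i, j)) + bracket (H_mat n) (section_along n u s) $$ (i, j)"
    proof -
      have "?V powi ?m * bracket (D_form n h c ?x ?V) (u c ?x) $$ (i, j) =
          twist n ?V (bracket (D_form n h c ?x ?V) (u c ?x)) $$ (i, j)" using ij by simp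
      also have "\<dots> = bracket (?k \<cdot>\<^sub>m A_mat n + H_mat n) (section_along n u s) $$ (i, j)"
        unfolding twist_bracket[OF velocity(3)[OF c] D_form_carrier carrier]
          twist_D_form_velocity[OF c] along[OF c(2)] ..
      also have "\<dots> = ?k * of_int ?m * section_along n u s $$ (i, j) + bracket (H_mat n) (section_along n u s) $$ (i, j)"
        by (rule bracket_A_mat_add) (simp_all add: ij)
      finally show ?thesis using ij by (simp only: along[OF c(2)] index_twist)
    qed
    have D: "D_section n h u c ?x ?V $$ (i, j) = f' ?V + bracket (D_form n h c ?x ?V) (u c ?x) $$ (i, j)"
      using ij carrier_matD[OF bracket_carrier[OF D_form_carrier[of n h c ?x ?V] carrier]]
      by (simp add: D_section_def f'(2))
    have p: "?V powi (?m - 1) * ?V\<^sup>2 = ?V powi ?m * ?V"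
    proof -
      have "?V powi (?m - 1) * ?V\<^sup>2 = (?V powi (?m - 1) * ?V) * ?V" by (simp only: power2_eq_square mult.assoc)
      also have "?V powi (?m - 1) * ?V = ?V powi ?m"
        using velocity(3)[OF c] power_int_add_1[of ?V "?m - 1"] by simp
      finally show ?thesis .
    qed
    have "of_int ?m * ?V powi (?m - 1) * (- d_log_h h c ?x * ?V\<^sup>2) * u c ?x $$ (i, j) =
       - d_log_h h c ?x * of_int ?m * (?V powi (?m - 1) * ?V\<^sup>2) * u c ?x $$ (i, j)" by (simp only: mult_ac)
    also have "\<dots> = ?k * of_int ?m * (?V powi ?m * u c ?x $$ (i, j))" unfolding p by (simp only: mult_ac)
    finally show ?thesis using ij by (simp only: index_twist D distrib_left b) simp
  qed
  ultimately show ?thesis by simp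
qed

lemma section_along_periodic:
  assumes u: "G_section atlas n u"
  shows "section_along n u (s + L) = section_along n u s"
proof -
  obtain c where c: "c \<in> atlas" "\<gamma> s \<in> fst c" using chart_exists by blast
  then have c': "\<gamma> (s + L) \<in> fst c" by (simp add: periodic)
  show ?thesis
    unfolding section_along_G_section[OF u c] section_along_G_section[OF u c(1) c']
    by (simp only: velocity_periodic[OF c] periodic)
qed

lemma loop_derivative:
  assumes c: "c \<in> atlas" "\<gamma> (L * s) \<in> fst c" and s: "s \<in> {0..1}"
  shows "((snd c \<circ> closed_curve_loop \<gamma> L) has_vector_derivative of_real L * velocity c \<gamma> (L * s)) (at s within {0..1})"
    and "vector_derivative (snd c \<circ> closed_curve_loop \<gamma> L) (at s within {0..1}) = of_real L * velocity c \<gamma> (L * s)"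
proof -
  have "((snd c \<circ> \<gamma> \<circ> (\<lambda>s. L * s)) has_vector_derivative L *\<^sub>R velocity c \<gamma> (L * s)) (at s within {0..1})"
    by (rule vector_diff_chain_within)
       (auto intro!: derivative_eq_intros has_vector_derivative_at_within[OF velocity(1)[OF c]])
  then show 1: "((snd c \<circ> closed_curve_loop \<gamma> L) has_vector_derivative of_real L * velocity c \<gamma> (L * s)) (at s within {0..1})"
    by (simp add: closed_curve_loop_def o_def scaleR_conv_of_real)
  show "vector_derivative (snd c \<circ> closed_curve_loop \<gamma> L) (at s within {0..1}) = of_real L * velocity c \<gamma> (L * s)"
    by (rule vector_derivative_within_closed_interval[OF _ s 1]) simp
qed

lemma closed_curve_loop_in_loops: "closed_curve_loop \<gamma> L \<in> loops (\<gamma> 0)"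
  using periodic[of 0] unfolding loops_def path_def pathstart_def pathfinish_def closed_curve_loop_def
  by (auto intro!: continuous_on_compose2[OF continuous_\<gamma>] continuous_intros)

lemma C1_path_loop: "C1_path atlas (closed_curve_loop \<gamma> L)"
proof -
  have "(snd c \<circ> closed_curve_loop \<gamma> L) differentiable (at s within {0..1}) \<and>
      continuous (at s within {0..1}) (\<lambda>s. vector_derivative (snd c \<circ> closed_curve_loop \<gamma> L) (at s within {0..1}))"
    if c: "c \<in> atlas" and s: "s \<in> {0..1}" and "closed_curve_loop \<gamma> L s \<in> fst c" for c s
  proof
    have cs: "\<gamma> (L * s) \<in> fst c" using that by (simp add: closed_curve_loop_def)
    show "(snd c \<circ> closed_curve_loop \<gamma> L) differentiable (at s within {0..1})"
      using loop_derivative(1)[OF c cs s] by (rule differentiableI_vector)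
    have "isCont (\<lambda>r. velocity c \<gamma> (L * r)) s"
      by (rule isCont_o2[of _ "\<lambda>r. L * r"]) (use isCont_velocity[OF c cs] in auto)
    then have cont: "continuous (at s within {0..1}) (\<lambda>r. of_real L * velocity c \<gamma> (L * r))"
      by (rule continuous_mult[OF continuous_const continuous_at_imp_continuous_at_within])
    have "open ((\<lambda>r. \<gamma> (L * r)) -` fst c)"
      by (intro open_vimage chart(1)[OF c] continuous_on_compose2[OF continuous_\<gamma>] continuous_intros) auto
    then obtain e where e: "e > 0" "\<And>r. dist r s < e \<Longrightarrow> \<gamma> (L * r) \<in> fst c"
      using cs unfolding open_dist by auto
    show "continuous (at s within {0..1}) (\<lambda>s. vector_derivative (snd c \<circ> closed_curve_loop \<gamma> L) (at s within {0..1}))"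
      by (rule continuous_transform_within[OF cont e(1) s]) (simp add: loop_derivative(2)[OF c e(2)])
  qed
  then show ?thesis
    using closed_curve_loop_in_loops unfolding C1_path_def loops_def by blast
qed

text \<open>Conversely to \<open>section_along_has_vector_derivative\<close>, a traceless solution Z
  of the equation with leading part H is carried back to every chart by the inverse twist and
  becomes a parallel section there.\<close>

lemma parallel_along_loop:
  assumes \<alpha>: "G_form atlas n \<alpha>"
    and Z: "\<And>s. Z s \<in> carrier_mat n n" "\<And>s. s \<in> {0..1} \<Longrightarrow> (\<Sum>i<n. Z s $$ (i, i)) = 0"
    and dZ: "\<And>s i j. s \<in> {0..1} \<Longrightarrow> i < n \<Longrightarrow> j < n \<Longrightarrow> ((\<lambda>s. Z s $$ (i, j)) has_vector_derivative
      - of_real L * bracket (H_mat n + form_along n \<alpha> (L * s)) (Z s) $$ (i, j)) (at s within {0..1})"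
  shows "parallel_along atlas n (\<lambda>c y v. D_form n h c y v + \<alpha> c y v) (closed_curve_loop \<gamma> L)
    (\<lambda>c s. twist n (inverse (velocity c \<gamma> (L * s))) (Z s))"
  unfolding parallel_along_def
proof (intro conjI ballI allI impI)
  let ?S = "\<lambda>c s. twist n (inverse (velocity c \<gamma> (L * s))) (Z s)"
  fix c s assume c: "c \<in> atlas" and s: "s \<in> {0..1}" and "closed_curve_loop \<gamma> L s \<in> fst c"
  then have cs: "\<gamma> (L * s) \<in> fst c" by (simp add: closed_curve_loop_def)
  let ?V = "velocity c \<gamma> (L * s)" and ?x = "\<gamma> (L * s)"
  let ?k = "- d_log_h h c ?x * ?V"
  note V0 = velocity(3)[OF c cs]
  show "?S c s \<in> sl n" using Z(2)[OF s] by (simp add: sl_def)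
  fix i j assume ij: "i < n" "j < n"
  let ?m = "int i - int j"
  have inv: "inverse v powi ?m = v powi (- ?m)" for v :: complex
    by (simp only: power_int_minus power_int_inverse)
  have "((velocity c \<gamma> \<circ> (\<lambda>s. L * s)) has_vector_derivative L *\<^sub>R (- d_log_h h c ?x * ?V\<^sup>2)) (at s within {0..1})"
    by (rule vector_diff_chain_within)
       (auto intro!: derivative_eq_intros has_vector_derivative_at_within[OF velocity(4)[OF c cs, simplified]])
  then have "((\<lambda>r. velocity c \<gamma> (L * r)) has_vector_derivative of_real L * (- d_log_h h c ?x * ?V\<^sup>2)) (at s within {0..1})"
    by (simp add: o_def scaleR_conv_of_real)
  from has_vector_derivative_mult[OF has_vector_derivative_power_int[OF this V0, of "- ?m"] dZ[OF s ij]]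
  have d: "((\<lambda>r. velocity c \<gamma> (L * r) powi (- ?m) * Z r $$ (i, j)) has_vector_derivative
      ?V powi (- ?m) * (- of_real L * bracket (H_mat n + form_along n \<alpha> (L * s)) (Z s) $$ (i, j)) +
      of_int (- ?m) * ?V powi (- ?m - 1) * (of_real L * (- d_log_h h c ?x * ?V\<^sup>2)) * Z s $$ (i, j)) (at s within {0..1})" .
  let ?T = "D_form n h c ?x (of_real L * ?V) + \<alpha> c ?x (of_real L * ?V)"
  have \<alpha>c: "\<alpha> c ?x v \<in> carrier_mat n n" for v using G_formD(1)[OF \<alpha> c cs] by (simp add: sl_def)
  have "\<alpha> c ?x (of_real L * ?V) = of_real L \<cdot>\<^sub>m \<alpha> c ?x ?V"
  proof (rule eq_matI)
    fix i j assume "i < dim_row (of_real L \<cdot>\<^sub>m \<alpha> c ?x ?V)" "j < dim_col (of_real L \<cdot>\<^sub>m \<alpha> c ?x ?V)"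
    then have ij: "i < n" "j < n" using carrier_matD[OF \<alpha>c[of ?V]] by auto
    from linear_scale[OF G_formD(2)[OF \<alpha> c cs ij], of L ?V]
    show "\<alpha> c ?x (of_real L * ?V) $$ (i, j) = (of_real L \<cdot>\<^sub>m \<alpha> c ?x ?V) $$ (i, j)"
      using ij carrier_matD[OF \<alpha>c[of ?V]] by (simp add: scaleR_conv_of_real)
  qed (use carrier_matD[OF \<alpha>c] in simp_all)
  \<comment> \<open>The forms are real linear in the vector, so the speed L of the loop comes out as
    a factor.\<close>
  then have T: "?T = of_real L \<cdot>\<^sub>m (D_form n h c ?x ?V + \<alpha> c ?x ?V)"
    unfolding D_form_scale by (simp add: add_smult_distrib_left_mat[OF D_form_carrier \<alpha>c])
  have Tc: "D_form n h c ?x ?V + \<alpha> c ?x ?V \<in> carrier_mat n n" using \<alpha>c by simp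
  have tw: "twist n ?V (D_form n h c ?x ?V + \<alpha> c ?x ?V) = ?k \<cdot>\<^sub>m A_mat n + (H_mat n + form_along n \<alpha> (L * s))"
    unfolding twist_add[OF D_form_carrier \<alpha>c] twist_D_form_velocity[OF c cs] form_along_eq[OF \<alpha> c cs]
    by (rule assoc_add_mat[of _ n n]) (simp_all add: A_mat_carrier)
  have "bracket ?T (?S c s) $$ (i, j) = of_real L * bracket (D_form n h c ?x ?V + \<alpha> c ?x ?V) (?S c s) $$ (i, j)"
    unfolding T using Tc ij by (intro index_bracket_smult_left) simp_all
  also have "bracket (D_form n h c ?x ?V + \<alpha> c ?x ?V) (?S c s) =
      twist n (inverse ?V) (twist n ?V (bracket (D_form n h c ?x ?V + \<alpha> c ?x ?V) (?S c s)))"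
    unfolding twist_twist using V0 bracket_carrier[OF Tc] by (simp add: twist_one)
  also have "twist n ?V (bracket (D_form n h c ?x ?V + \<alpha> c ?x ?V) (?S c s)) =
      bracket (?k \<cdot>\<^sub>m A_mat n + (H_mat n + form_along n \<alpha> (L * s))) (Z s)"
    using V0 Z(1)[of s] by (simp add: twist_bracket[OF V0 Tc] tw twist_twist twist_one)
  also have "twist n (inverse ?V) (bracket (?k \<cdot>\<^sub>m A_mat n + (H_mat n + form_along n \<alpha> (L * s))) (Z s)) $$ (i, j) =
     ?V powi (- ?m) * (?k * of_int ?m * Z s $$ (i, j) + bracket (H_mat n + form_along n \<alpha> (L * s)) (Z s) $$ (i, j))"
    using ij Z(1)[of s] by (simp add: inv bracket_A_mat_add)
  finally have br: "bracket ?T (?S c s) $$ (i, j) = of_real L * (?V powi (- ?m) *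
     (?k * of_int ?m * Z s $$ (i, j) + bracket (H_mat n + form_along n \<alpha> (L * s)) (Z s) $$ (i, j)))" .
  have p: "?V powi (- ?m - 1) * ?V\<^sup>2 = ?V powi (- ?m) * ?V"
  proof -
    have "?V powi (- ?m - 1) * ?V\<^sup>2 = (?V powi (- ?m - 1) * ?V) * ?V" by (simp only: power2_eq_square mult.assoc)
    also have "?V powi (- ?m - 1) * ?V = ?V powi (- ?m)"
      using V0 power_int_add_1[of ?V "- ?m - 1"] by simp
    finally show ?thesis .
  qed
  \<comment> \<open>The derivative of the factor V^(-m) accounts for the \<open>A_mat\<close> part
    of the connection.\<close>
  have "of_int (- ?m) * ?V powi (- ?m - 1) * (of_real L * (- d_log_h h c ?x * ?V\<^sup>2)) * Z s $$ (i, j) =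
      of_int (- ?m) * of_real L * - d_log_h h c ?x * (?V powi (- ?m - 1) * ?V\<^sup>2) * Z s $$ (i, j)" by (simp only: mult_ac)
  also have "\<dots> = - (of_real L * (?V powi (- ?m) * (?k * of_int ?m * Z s $$ (i, j))))"
    unfolding p by (simp add: algebra_simps)
  finally have step: "of_int (- ?m) * ?V powi (- ?m - 1) * (of_real L * (- d_log_h h c ?x * ?V\<^sup>2)) * Z s $$ (i, j) =
      - (of_real L * (?V powi (- ?m) * (?k * of_int ?m * Z s $$ (i, j))))" .
  have eq: "?V powi (- ?m) * (- of_real L * bracket (H_mat n + form_along n \<alpha> (L * s)) (Z s) $$ (i, j)) +
      of_int (- ?m) * ?V powi (- ?m - 1) * (of_real L * (- d_log_h h c ?x * ?V\<^sup>2)) * Z s $$ (i, j) =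
      - bracket ?T (?S c s) $$ (i, j)"
    unfolding br step by (simp add: algebra_simps)
  have bc: "bracket ?T (?S c s) \<in> carrier_mat n n" using \<alpha>c by simp
  show "((\<lambda>s. ?S c s $$ (i, j)) has_vector_derivative
      - bracket (D_form n h c (closed_curve_loop \<gamma> L s) (vector_derivative (snd c \<circ> closed_curve_loop \<gamma> L) (at s within {0..1})) +
        \<alpha> c (closed_curve_loop \<gamma> L s) (vector_derivative (snd c \<circ> closed_curve_loop \<gamma> L) (at s within {0..1}))) (?S c s) $$ (i, j))
      (at s within {0..1})"
    using d ij unfolding eq loop_derivative(2)[OF c cs s] by (simp add: closed_curve_loop_def inv)
next
  fix c c' s assume c: "c \<in> atlas" "c' \<in> atlas" and "closed_curve_loop \<gamma> L s \<in> fst c \<inter> fst c'"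
  then have cs: "\<gamma> (L * s) \<in> fst c \<inter> fst c'" by (simp add: closed_curve_loop_def)
  then have "velocity c \<gamma> (L * s) \<noteq> 0" "velocity c' \<gamma> (L * s) \<noteq> 0" using velocity(3) c by auto
  then show "twist n (inverse (velocity c \<gamma> (L * s))) (Z s) =
      twist n (transition c c' (closed_curve_loop \<gamma> L s)) (twist n (inverse (velocity c' \<gamma> (L * s))) (Z s))"
    unfolding twist_twist velocity_transition[OF c cs] by (simp add: closed_curve_loop_def field_simps)
qed

end

section \<open>Parallel transport in the eigenbasis\<close>

lemma trace_mult_commute:
  fixes A B :: "complex mat"
  assumes "A \<in> carrier_mat n n" "B \<in> carrier_mat n n"
  shows "(\<Sum>i<n. (A * B) $$ (i, i)) = (\<Sum>i<n. (B * A) $$ (i, i))"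
proof -
  have "(\<Sum>i<n. (A * B) $$ (i, i)) = (\<Sum>i<n. \<Sum>l<n. A $$ (i, l) * B $$ (l, i))"
    using assms by (intro sum.cong) (auto simp: index_mult_mat_sum[of _ n] simp del: index_mult_mat(1))
  also have "\<dots> = (\<Sum>l<n. \<Sum>i<n. B $$ (l, i) * A $$ (i, l))"
    by (subst sum.swap) (simp add: mult.commute)
  also have "\<dots> = (\<Sum>i<n. (B * A) $$ (i, i))"
    using assms by (intro sum.cong) (auto simp: index_mult_mat_sum[of _ n] simp del: index_mult_mat(1))
  finally show ?thesis .
qed

text \<open>The matrix units off the diagonal are traceless, and commuting with them already forces
  Y to be diagonal with equal entries.\<close>

lemma commutant_traceless_scalar:
  fixes Y :: "complex mat"
  assumes n: "2 \<le> n" and Y: "Y \<in> carrier_mat n n"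
    and comm: "\<And>M. M \<in> carrier_mat n n \<Longrightarrow> (\<Sum>i<n. M $$ (i, i)) = 0 \<Longrightarrow> M * Y = Y * M"
  shows "Y = Y $$ (0, 0) \<cdot>\<^sub>m 1\<^sub>m n"
proof -
  define e where "e i j = Matrix.mat n n (\<lambda>(k, l). if k = i \<and> l = j then 1 else (0::complex))" for i j
  have eq: "(if k = i then Y $$ (j, l) else 0) = (if l = j then Y $$ (k, i) else 0)"
    if "i < n" "j < n" "i \<noteq> j" "k < n" "l < n" for i j k l
  proof -
    have c: "e i j \<in> carrier_mat n n" by (simp add: e_def)
    have "e i j * Y = Y * e i j"
      using that by (intro comm) (auto simp: e_def intro!: sum.neutral)
    then have "(e i j * Y) $$ (k, l) = (Y * e i j) $$ (k, l)" by simp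
    moreover have "(e i j * Y) $$ (k, l) = (\<Sum>r<n. e i j $$ (k, r) * Y $$ (r, l))"
      using that by (intro index_mult_mat_sum[OF c Y])
    moreover have "(\<Sum>r<n. e i j $$ (k, r) * Y $$ (r, l)) = (\<Sum>r<n. if r = j then if k = i then Y $$ (j, l) else 0 else 0)"
      using that by (intro sum.cong refl) (auto simp: e_def)
    moreover have "(Y * e i j) $$ (k, l) = (\<Sum>r<n. Y $$ (k, r) * e i j $$ (r, l))"
      using that by (intro index_mult_mat_sum[OF Y c])
    moreover have "(\<Sum>r<n. Y $$ (k, r) * e i j $$ (r, l)) = (\<Sum>r<n. if r = i then if l = j then Y $$ (k, i) else 0 else 0)"
      using that by (intro sum.cong refl) (auto simp: e_def)
    ultimately show ?thesis using that by (simp only: sum.delta finite_lessThan lessThan_iff if_True)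
  qed
  have off: "Y $$ (j, l) = 0" if "j < n" "l < n" "j \<noteq> l" for j l
    using eq[of l j l l] that by simp
  have diag: "Y $$ (j, j) = Y $$ (0, 0)" if "j < n" for j
    using eq[of 0 j 0 j] that by (cases "j = 0") auto
  show ?thesis
  proof (rule eq_matI)
    fix i j assume "i < dim_row (Y $$ (0, 0) \<cdot>\<^sub>m 1\<^sub>m n)" "j < dim_col (Y $$ (0, 0) \<cdot>\<^sub>m 1\<^sub>m n)"
    then have "i < n" "j < n" by auto
    then show "Y $$ (i, j) = (Y $$ (0, 0) \<cdot>\<^sub>m 1\<^sub>m n) $$ (i, j)"
      using off[of i j] diag[of j] by (cases "i = j") simp_all
  qed (use Y in auto)
qed

definition mat_deriv :: "nat \<Rightarrow> (real \<Rightarrow> complex mat) \<Rightarrow> complex mat \<Rightarrow> real \<Rightarrow> bool" where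
  "mat_deriv n f f' s \<longleftrightarrow> (\<forall>i<n. \<forall>j<n. ((\<lambda>s. f s $$ (i, j)) has_vector_derivative f' $$ (i, j)) (at s within {0..1}))"

lemma mat_deriv_mult:
  assumes f: "\<And>s. f s \<in> carrier_mat n n" "f' \<in> carrier_mat n n" "mat_deriv n f f' s"
    and g: "\<And>s. g s \<in> carrier_mat n n" "g' \<in> carrier_mat n n" "mat_deriv n g g' s"
  shows "mat_deriv n (\<lambda>s. f s * g s) (f' * g s + f s * g') s"
  unfolding mat_deriv_def
proof (intro allI impI)
  fix i j assume ij: "i < n" "j < n"
  have "((\<lambda>s. f s $$ (i, l) * g s $$ (l, j)) has_vector_derivative
      f s $$ (i, l) * g' $$ (l, j) + f' $$ (i, l) * g s $$ (l, j)) (at s within {0..1})" if "l \<in> {..<n}" for l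
    by (rule has_vector_derivative_mult) (use f(3) g(3) ij that in \<open>simp_all add: mat_deriv_def\<close>)
  then have "((\<lambda>s. \<Sum>l<n. f s $$ (i, l) * g s $$ (l, j)) has_vector_derivative
      (\<Sum>l<n. f s $$ (i, l) * g' $$ (l, j) + f' $$ (i, l) * g s $$ (l, j))) (at s within {0..1})"
    by (rule has_vector_derivative_sum)
  moreover have "(f' * g s + f s * g') $$ (i, j) = (\<Sum>l<n. f s $$ (i, l) * g' $$ (l, j) + f' $$ (i, l) * g s $$ (l, j))"
  proof -
    have "f s * g' \<in> carrier_mat n n" using f(1) g(2) by (rule mult_carrier_mat)
    then have "(f' * g s + f s * g') $$ (i, j) = (f' * g s) $$ (i, j) + (f s * g') $$ (i, j)"
      using ij by (simp del: index_mult_mat)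
    then show ?thesis
      using f g ij by (simp only: index_mult_mat_sum[of _ n] sum.distrib add.commute)
  qed
  moreover have "(f r * g r) $$ (i, j) = (\<Sum>l<n. f r $$ (i, l) * g r $$ (l, j))" for r
    using f(1) g(1) ij by (rule index_mult_mat_sum)
  ultimately show "((\<lambda>s. (f s * g s) $$ (i, j)) has_vector_derivative (f' * g s + f s * g') $$ (i, j)) (at s within {0..1})"
    by (simp only:)
qed

lemma mat_deriv_const: "M \<in> carrier_mat n n \<Longrightarrow> mat_deriv n (\<lambda>s. M) (0\<^sub>m n n) s"
  by (simp add: mat_deriv_def)

lemma mat_deriv_const_mult:
  assumes "M \<in> carrier_mat n n" "\<And>s. f s \<in> carrier_mat n n" "f' \<in> carrier_mat n n" "mat_deriv n f f' s"
  shows "mat_deriv n (\<lambda>s. M * f s) (M * f') s"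
proof -
  have "0\<^sub>m n n * f s + M * f' = M * f'"
    using left_mult_zero_mat[OF assms(2)] left_add_zero_mat[OF mult_carrier_mat[OF assms(1,3)]] by simp
  then show ?thesis
    using mat_deriv_mult[OF assms(1) zero_carrier_mat mat_deriv_const[OF assms(1)] assms(2-4)] by simp
qed

lemma mat_deriv_mult_const:
  assumes "M \<in> carrier_mat n n" "\<And>s. f s \<in> carrier_mat n n" "f' \<in> carrier_mat n n" "mat_deriv n f f' s"
  shows "mat_deriv n (\<lambda>s. f s * M) (f' * M) s"
proof -
  have "f' * M + f s * 0\<^sub>m n n = f' * M" 
    using assms(1,3) right_mult_zero_mat[OF assms(2)] by (simp add: right_add_zero_mat[of _ n n])
  then show ?thesis
    using mat_deriv_mult[OF assms(2-4) assms(1) zero_carrier_mat mat_deriv_const[OF assms(1)]] by simp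
qed

text \<open>R solves R' = - R C, which after transposition is a system of the same kind with
  coefficient - C^T. Then R Q has derivative 0 and stays 1, so the inverse of Q comes with its own
  differential equation.\<close>

lemma mat_ode_exists:
  fixes C :: "real \<Rightarrow> complex mat"
  assumes C: "\<And>s. C s \<in> carrier_mat n n"
    and cont: "\<And>i j. i < n \<Longrightarrow> j < n \<Longrightarrow> continuous_on {0..1} (\<lambda>s. C s $$ (i, j))"
    and bound: "\<And>s i j. s \<in> {0..1} \<Longrightarrow> i < n \<Longrightarrow> j < n \<Longrightarrow> norm (C s $$ (i, j)) \<le> \<beta>"
    and \<beta>: "0 \<le> \<beta>" "real n * \<beta> \<le> 1 / 2"
  obtains Q R where "\<And>s. Q s \<in> carrier_mat n n" "\<And>s. R s \<in> carrier_mat n n" "Q 0 = 1\<^sub>m n" "R 0 = 1\<^sub>m n"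
    "\<And>s. s \<in> {0..1} \<Longrightarrow> R s * Q s = 1\<^sub>m n"
    "\<And>s. s \<in> {0..1} \<Longrightarrow> mat_deriv n Q (C s * Q s) s"
    "\<And>s. s \<in> {0..1} \<Longrightarrow> mat_deriv n R (- (R s * C s)) s"
    "\<And>i j. i < n \<Longrightarrow> j < n \<Longrightarrow>
       norm (Q 1 $$ (i, j) - (if i = j then 1 else 0) - integral {0..1} (\<lambda>s. C s $$ (i, j))) \<le> 2 * (real n * \<beta>)\<^sup>2"
proof -
  obtain q where q: "\<And>i j. i < n \<Longrightarrow> j < n \<Longrightarrow> q 0 i j = (if i = j then 1 else 0)"
    "\<And>s i j. s \<in> {0..1} \<Longrightarrow> i < n \<Longrightarrow> j < n \<Longrightarrow>
       ((\<lambda>s. q s i j) has_vector_derivative (\<Sum>l<n. C s $$ (i, l) * q s l j)) (at s within {0..1})"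
    "\<And>i j. i < n \<Longrightarrow> j < n \<Longrightarrow>
       norm (q 1 i j - (if i = j then 1 else 0) - integral {0..1} (\<lambda>s. C s $$ (i, j))) \<le> 2 * (real n * \<beta>)\<^sup>2"
  proof (rule small_linear_ode[of n "\<lambda>s i j. C s $$ (i, j)" \<beta>])
    show "continuous_on {0..1} (\<lambda>s. C s $$ (i, j))" if "i < n" "j < n" for i j by (rule cont[OF that])
    show "norm (C s $$ (i, j)) \<le> \<beta>" if "s \<in> {0..1}" "i < n" "j < n" for s i j by (rule bound[OF that])
    fix Q assume Q: "\<And>i j. i < n \<Longrightarrow> j < n \<Longrightarrow> Q 0 i j = (if i = j then 1 else 0)"
      "\<And>s i j. s \<in> {0..1} \<Longrightarrow> i < n \<Longrightarrow> j < n \<Longrightarrow>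
       ((\<lambda>s. Q s i j) has_vector_derivative (\<Sum>l<n. C s $$ (i, l) * Q s l j)) (at s within {0..1})"
      "\<And>i j. i < n \<Longrightarrow> j < n \<Longrightarrow>
       norm (Q 1 i j - (if i = j then 1 else 0) - integral {0..1} (\<lambda>s. C s $$ (i, j))) \<le> 2 * (real n * \<beta>)\<^sup>2"
    show thesis by (rule that[of Q, OF Q])
  qed (rule \<beta>)+
  have cont': "continuous_on {0..1} (\<lambda>s. - C s $$ (j, i))" if "i < n" "j < n" for i j
    using cont that by (intro continuous_on_minus)
  have bound': "norm (- C s $$ (j, i)) \<le> \<beta>" if "s \<in> {0..1}" "i < n" "j < n" for s i j
    using bound that by simp
  obtain r where r: "\<And>i j. i < n \<Longrightarrow> j < n \<Longrightarrow> r 0 i j = (if i = j then 1 else 0)"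
    "\<And>s i j. s \<in> {0..1} \<Longrightarrow> i < n \<Longrightarrow> j < n \<Longrightarrow>
       ((\<lambda>s. r s i j) has_vector_derivative (\<Sum>l<n. - C s $$ (l, i) * r s l j)) (at s within {0..1})"
  proof (rule small_linear_ode[of n "\<lambda>s i j. - C s $$ (j, i)" \<beta>])
    show "continuous_on {0..1} (\<lambda>s. - C s $$ (j, i))" if "i < n" "j < n" for i j by (rule cont'[OF that])
    show "norm (- C s $$ (j, i)) \<le> \<beta>" if "s \<in> {0..1}" "i < n" "j < n" for s i j by (rule bound'[OF that])
    fix Q assume Q: "\<And>i j. i < n \<Longrightarrow> j < n \<Longrightarrow> Q 0 i j = (if i = j then 1 else 0)"
      "\<And>s i j. s \<in> {0..1} \<Longrightarrow> i < n \<Longrightarrow> j < n \<Longrightarrow>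
       ((\<lambda>s. Q s i j) has_vector_derivative (\<Sum>l<n. - C s $$ (l, i) * Q s l j)) (at s within {0..1})"
    show thesis by (rule that[of Q, OF Q])
  qed (rule \<beta>)+
  define Q where "Q s = Matrix.mat n n (\<lambda>(i, j). q s i j)" for s
  define R where "R s = Matrix.mat n n (\<lambda>(i, j). r s j i)" for s
  have QR: "Q s \<in> carrier_mat n n" "R s \<in> carrier_mat n n" for s by (simp_all add: Q_def R_def)
  have init: "Q 0 = 1\<^sub>m n" "R 0 = 1\<^sub>m n"
    by (intro eq_matI; auto simp: Q_def R_def q(1) r(1))+
  have dQ: "mat_deriv n Q (C s * Q s) s" if s: "s \<in> {0..1}" for s
    unfolding mat_deriv_def
  proof (intro allI impI)
    fix i j assume ij: "i < n" "j < n"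
    have "(C s * Q s) $$ (i, j) = (\<Sum>l<n. C s $$ (i, l) * q s l j)"
      unfolding index_mult_mat_sum[OF C QR(1) ij] using ij by (simp add: Q_def)
    then show "((\<lambda>s. Q s $$ (i, j)) has_vector_derivative (C s * Q s) $$ (i, j)) (at s within {0..1})"
      using q(2)[OF s ij] ij by (simp add: Q_def del: index_mult_mat(1))
  qed
  have RC: "R s * C s \<in> carrier_mat n n" for s using QR C by (intro mult_carrier_mat)
  have dR: "mat_deriv n R (- (R s * C s)) s" if s: "s \<in> {0..1}" for s
    unfolding mat_deriv_def
  proof (intro allI impI)
    fix i j assume ij: "i < n" "j < n"
    have "(- (R s * C s)) $$ (i, j) = - (R s * C s) $$ (i, j)" using carrier_matD[OF RC[of s]] ij by (simp del: index_mult_mat)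
    also have "\<dots> = (\<Sum>l<n. - C s $$ (l, j) * r s l i)"
      unfolding index_mult_mat_sum[OF QR(2) C ij] using ij by (simp add: R_def sum_negf mult.commute)
    finally show "((\<lambda>s. R s $$ (i, j)) has_vector_derivative (- (R s * C s)) $$ (i, j)) (at s within {0..1})"
      using r(2)[OF s ij(2,1)] ij by (simp add: R_def del: index_mult_mat(1))
  qed
  have inv: "R s * Q s = 1\<^sub>m n" if s: "s \<in> {0..1}" for s
  proof -
    have CQ: "C s * Q s \<in> carrier_mat n n" for s using QR C by (intro mult_carrier_mat)
    have zero: "- (R s * C s) * Q s + R s * (C s * Q s) = 0\<^sub>m n n" for s
    proof -
      have "- (R s * C s) * Q s = - (R s * (C s * Q s))"
        using assoc_mult_mat[OF QR(2) C QR(1), of s s s] carrier_matD[OF RC[of s]] carrier_matD[OF QR(1)[of s]]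
        by (subst uminus_mult_left_mat) (simp_all del: assoc_mult_mat index_mult_mat)
      then show ?thesis using uminus_l_inv_mat[OF mult_carrier_mat[OF QR(2) CQ]] by simp
    qed
    have d: "mat_deriv n (\<lambda>s. R s * Q s) (0\<^sub>m n n) s" if "s \<in> {0..1}" for s
      using mat_deriv_mult[OF QR(2) _ dR[OF that] QR(1) CQ dQ[OF that]] RC by (simp add: zero)
    show ?thesis
    proof (rule eq_matI)
      fix i j assume "i < dim_row (1\<^sub>m n)" "j < dim_col (1\<^sub>m n)"
      then have ij: "i < n" "j < n" by auto
      have "((\<lambda>s. (R s * Q s) $$ (i, j)) has_vector_derivative 0) (at s within {0..1})" if "s \<in> {0..1}" for s
        using d[OF that] ij unfolding mat_deriv_def by auto
      then obtain k where k: "\<And>s. s \<in> {0..1} \<Longrightarrow> (R s * Q s) $$ (i, j) = k"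
        using has_vector_derivative_zero_constant[of "{0..1}" "\<lambda>s. (R s * Q s) $$ (i, j)"] by auto
      have "(R s * Q s) $$ (i, j) = (R 0 * Q 0) $$ (i, j)" using k[OF s] k[of 0] by simp
      then show "(R s * Q s) $$ (i, j) = 1\<^sub>m n $$ (i, j)" by (simp add: init)
    qed (use QR[of s] in auto)
  qed
  have est: "norm (Q 1 $$ (i, j) - (if i = j then 1 else 0) - integral {0..1} (\<lambda>s. C s $$ (i, j))) \<le> 2 * (real n * \<beta>)\<^sup>2"
    if "i < n" "j < n" for i j using q(3)[OF that] that by (simp add: Q_def)
  show thesis by (rule that[OF QR init inv dQ dR est])
qed

text \<open>Joint continuity of the t-derivative gives uniform continuity on a compact rectangle;
  the mean value inequality in t then yields a remainder uniform in s.\<close>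

lemma C1_uniform_remainder:
  fixes b F :: "real \<Rightarrow> real \<Rightarrow> complex"
  assumes \<epsilon>: "\<epsilon> > 0" and F: "continuous_on ({- \<epsilon><..<\<epsilon>} \<times> {0..1}) (\<lambda>(t, s). F t s)"
    and der: "\<And>t s. t \<in> {- \<epsilon><..<\<epsilon>} \<Longrightarrow> s \<in> {0..1} \<Longrightarrow> ((\<lambda>t. b t s) has_vector_derivative F t s) (at t)"
    and b0: "\<And>s. s \<in> {0..1} \<Longrightarrow> b 0 s = 0" and \<eta>: "\<eta> > 0"
  shows "\<exists>\<delta>>0. \<forall>t. \<bar>t\<bar> < \<delta> \<longrightarrow> (\<forall>s\<in>{0..1}. norm (b t s - t *\<^sub>R F 0 s) \<le> \<bar>t\<bar> * \<eta>)"
proof -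
  \<comment> \<open>Half the radius, to have a closed interval inside the open one.\<close>
  let ?K = "{- \<epsilon> / 2..\<epsilon> / 2} \<times> {0..1::real}"
  have "continuous_on ?K (\<lambda>(t, s). F t s)"
    using F by (rule continuous_on_subset) (use \<epsilon> in auto)
  then have "uniformly_continuous_on ?K (\<lambda>(t, s). F t s)"
    by (rule compact_uniformly_continuous) (intro compact_Times compact_Icc)
  from this[unfolded uniformly_continuous_on_def, THEN spec, THEN mp, OF \<eta>]
  obtain d where d: "d > 0"
    "\<forall>x\<in>?K. \<forall>y\<in>?K. dist y x < d \<longrightarrow> dist ((\<lambda>(t, s). F t s) y) ((\<lambda>(t, s). F t s) x) < \<eta>"
    by (elim exE conjE) (rule that)
  have "norm (b t s - t *\<^sub>R F 0 s) \<le> \<bar>t\<bar> * \<eta>" if t: "\<bar>t\<bar> < min d (\<epsilon> / 2)" and s: "s \<in> {0..1}" for t s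
  proof -
    have seg: "\<bar>r\<bar> \<le> \<bar>t\<bar>" if "r \<in> closed_segment 0 t" for r
      using that by (auto simp: closed_segment_eq_real_ivl split: if_splits)
    have "norm (b t s - b 0 s - (t - 0) *\<^sub>R F 0 s) \<le> norm (t - 0) * \<eta>"
    proof (rule vector_differentiable_bound_linearization[where S = "closed_segment 0 t" and f = "\<lambda>t. b t s" and f' = "\<lambda>t. F t s"])
      fix r assume r: "r \<in> closed_segment 0 t"
      have r': "\<bar>r\<bar> < d" "\<bar>r\<bar> < \<epsilon> / 2" using seg[OF r] t by auto
      show "((\<lambda>t. b t s) has_vector_derivative F r s) (at r within closed_segment 0 t)"
        by (rule has_vector_derivative_at_within[OF der]) (use r' \<epsilon> s in auto)
      have "- \<epsilon> / 2 \<le> r" "r \<le> \<epsilon> / 2" using r'(2) by linarith+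
      then have "(r, s) \<in> ?K" "(0, s) \<in> ?K" using s \<epsilon> by simp_all
      moreover have "dist (r, s) (0, s) < d" using r'(1) by (simp add: dist_Pair_Pair dist_real_def)
      ultimately have "dist (F r s) (F 0 s) < \<eta>"
        using d(2)[THEN bspec, of "(0, s)", THEN bspec, of "(r, s)"] by simp
      then show "norm (F r s - F 0 s) \<le> \<eta>" by (simp add: dist_norm)
    qed auto
    then show ?thesis by (simp add: b0[OF s])
  qed
  then show ?thesis using d(1) \<epsilon> by (intro exI[of _ "min d (\<epsilon> / 2)"]) auto
qed

section \<open>Conjugations and the interaction picture\<close>

lemma mat_mult_assoc:
  "A \<in> carrier_mat n n \<Longrightarrow> B \<in> carrier_mat n n \<Longrightarrow> C \<in> carrier_mat n n \<Longrightarrow> (A * B) * C = A * (B * C)"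
  by (rule assoc_mult_mat)

lemma mat_mult_cancel_left:
  fixes A B C :: "complex mat"
  assumes "A \<in> carrier_mat n n" "B \<in> carrier_mat n n" "C \<in> carrier_mat n n" "A * B = 1\<^sub>m n"
  shows "A * (B * C) = C"
  unfolding mat_mult_assoc[OF assms(1-3), symmetric] assms(4) by (rule left_mult_one_mat[OF assms(3)])

lemma conj_mult:
  fixes U W X Y :: "complex mat"
  assumes c: "U \<in> carrier_mat n n" "W \<in> carrier_mat n n" "X \<in> carrier_mat n n" "Y \<in> carrier_mat n n"
    and WU: "W * U = 1\<^sub>m n"
  shows "(U * X * W) * (U * Y * W) = U * (X * Y) * W"
proof -
  note m = mult_carrier_mat[of _ n n _ n]
  have "(U * X * W) * (U * Y * W) = U * X * (W * (U * (Y * W)))"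
    using c by (simp add: m mat_mult_assoc[of _ n])
  also have "W * (U * (Y * W)) = Y * W"
    using c WU by (intro mat_mult_cancel_left[of _ n]) (auto intro: m)
  finally show ?thesis using c by (simp add: m mat_mult_assoc[of _ n])
qed

lemma conj_bracket:
  fixes U W X Y :: "complex mat"
  assumes c: "U \<in> carrier_mat n n" "W \<in> carrier_mat n n" "X \<in> carrier_mat n n" "Y \<in> carrier_mat n n"
    and WU: "W * U = 1\<^sub>m n"
  shows "U * bracket X Y * W = bracket (U * X * W) (U * Y * W)"
proof -
  have XY: "X * Y \<in> carrier_mat n n" "Y * X \<in> carrier_mat n n" using c by (auto intro: mult_carrier_mat)
  have "U * bracket X Y * W = U * (X * Y) * W - U * (Y * X) * W"
    unfolding bracket_def mult_minus_distrib_mat[OF c(1) XY]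
    using c XY by (intro minus_mult_distrib_mat[of _ n n]) (auto intro: mult_carrier_mat)
  then show ?thesis
    unfolding bracket_def conj_mult[OF c(1-4) WU] conj_mult[OF c(1,2,4,3) WU] .
qed

text \<open>Conjugation by the exponential of r times the diagonal matrix of d, see
  \<open>exp_conj_eq_conj\<close>. In the entrywise form the derivative in r and the invariance of
  the diagonal are immediate.\<close>

definition exp_conj :: "nat \<Rightarrow> (nat \<Rightarrow> real) \<Rightarrow> real \<Rightarrow> complex mat \<Rightarrow> complex mat" where
  "exp_conj n d r M = Matrix.mat n n (\<lambda>(i, j). of_real (exp (r * (d i - d j))) * M $$ (i, j))"

lemma exp_conj_carrier [simp]: "exp_conj n d r M \<in> carrier_mat n n"
  by (simp add: exp_conj_def)

lemma index_exp_conj [simp]: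
  "i < n \<Longrightarrow> j < n \<Longrightarrow> exp_conj n d r M $$ (i, j) = of_real (exp (r * (d i - d j))) * M $$ (i, j)"
  by (simp add: exp_conj_def)

lemma exp_conj_mult:
  assumes M: "M \<in> carrier_mat n n" and N: "N \<in> carrier_mat n n"
  shows "exp_conj n d r (M * N) = exp_conj n d r M * exp_conj n d r N"
proof (rule eq_matI)
  fix i j assume "i < dim_row (exp_conj n d r M * exp_conj n d r N)" "j < dim_col (exp_conj n d r M * exp_conj n d r N)"
  then have ij: "i < n" "j < n" by (auto simp: exp_conj_def)
  have e: "exp (r * (d i - d j)) = exp (r * (d i - d l)) * exp (r * (d l - d j))" for l
    by (simp add: exp_add[symmetric] algebra_simps)
  have "exp_conj n d r (M * N) $$ (i, j) = (\<Sum>l<n. of_real (exp (r * (d i - d j))) * (M $$ (i, l) * N $$ (l, j)))"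
    using ij by (simp only: index_exp_conj index_mult_mat_sum[OF M N] sum_distrib_left)
  also have "\<dots> = (\<Sum>l<n. exp_conj n d r M $$ (i, l) * exp_conj n d r N $$ (l, j))"
  proof (intro sum.cong refl)
    fix l assume "l \<in> {..<n}"
    then show "of_real (exp (r * (d i - d j))) * (M $$ (i, l) * N $$ (l, j)) = exp_conj n d r M $$ (i, l) * exp_conj n d r N $$ (l, j)"
      using ij unfolding e[of l] by simp
  qed
  also have "\<dots> = (exp_conj n d r M * exp_conj n d r N) $$ (i, j)"
    using ij by (simp only: index_mult_mat_sum[OF exp_conj_carrier exp_conj_carrier])
  finally show "exp_conj n d r (M * N) $$ (i, j) = (exp_conj n d r M * exp_conj n d r N) $$ (i, j)" .
qed (auto simp: exp_conj_def)

lemma exp_conj_bracket: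
  assumes M: "M \<in> carrier_mat n n" and N: "N \<in> carrier_mat n n"
  shows "exp_conj n d r (bracket M N) = bracket (exp_conj n d r M) (exp_conj n d r N)"
proof -
  have c: "M * N \<in> carrier_mat n n" "N * M \<in> carrier_mat n n" using M N by (auto intro: mult_carrier_mat)
  have "exp_conj n d r (M * N - N * M) = exp_conj n d r (M * N) - exp_conj n d r (N * M)"
    by (rule eq_matI) (use carrier_matD[OF c(1)] carrier_matD[OF c(2)] in \<open>simp_all add: exp_conj_def right_diff_distrib del: index_mult_mat\<close>)
  then show ?thesis unfolding bracket_def exp_conj_mult[OF M N] exp_conj_mult[OF N M] .
qed

lemma exp_conj_eq_conj:
  assumes "M \<in> carrier_mat n n"
  shows "exp_conj n d r M = mat_diag n (\<lambda>i. of_real (exp (r * d i))) * M * mat_diag n (\<lambda>i. of_real (exp (- (r * d i))))"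
proof -
  have "of_real (exp (r * (d i - d j))) * M $$ (i, j) = of_real (exp (r * d i)) * M $$ (i, j) * of_real (exp (- (r * d j)))" for i j
  proof -
    have "exp (r * (d i - d j)) = exp (r * d i) * exp (- (r * d j))"
      by (simp add: exp_add[symmetric] right_diff_distrib)
    then show ?thesis by simp
  qed
  then show ?thesis
    unfolding mat_diag_mult_left[OF assms] by (subst mat_diag_mult_right[of _ n n]) (auto simp: exp_conj_def)
qed

lemma index_bracket_mat_diag:
  fixes M :: "complex mat"
  assumes "M \<in> carrier_mat n n" "i < n" "j < n"
  shows "bracket (mat_diag n f) M $$ (i, j) = (f i - f j) * M $$ (i, j)"
  using assms unfolding bracket_def mat_diag_mult_left[OF assms(1)] mat_diag_mult_right[OF assms(1)]
  by (simp add: algebra_simps)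

lemma mat_deriv_exp_conj:
  assumes N: "\<And>s. N s \<in> carrier_mat n n" "mat_deriv n N N' s" "N' \<in> carrier_mat n n"
  shows "mat_deriv n (\<lambda>s. exp_conj n d (k * s) (N s))
    (exp_conj n d (k * s) N' + of_real k \<cdot>\<^sub>m bracket (mat_diag n (\<lambda>i. of_real (d i))) (exp_conj n d (k * s) (N s))) s"
  unfolding mat_deriv_def
proof (intro allI impI)
  fix i j assume ij: "i < n" "j < n"
  have N': "((\<lambda>s. N s $$ (i, j)) has_vector_derivative N' $$ (i, j)) (at s within {0..1})"
    using N(2) ij unfolding mat_deriv_def by blast
  have "((\<lambda>s. exp (k * s * (d i - d j))) has_vector_derivative exp (k * s * (d i - d j)) * (k * (d i - d j))) (at s within {0..1})"
    unfolding has_real_derivative_iff_has_vector_derivative[symmetric] by (auto intro!: derivative_eq_intros)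
  then have "((\<lambda>s. complex_of_real (exp (k * s * (d i - d j)))) has_vector_derivative
      of_real (exp (k * s * (d i - d j)) * (k * (d i - d j)))) (at s within {0..1})"
    by (rule bounded_linear.has_vector_derivative[OF bounded_linear_of_real])
  from has_vector_derivative_mult[OF this N']
  have "((\<lambda>s. exp_conj n d (k * s) (N s) $$ (i, j)) has_vector_derivative
      of_real (exp (k * s * (d i - d j))) * N' $$ (i, j) +
      of_real (exp (k * s * (d i - d j)) * (k * (d i - d j))) * N s $$ (i, j)) (at s within {0..1})"
    using ij by simp
  moreover have "(exp_conj n d (k * s) N' + of_real k \<cdot>\<^sub>m bracket (mat_diag n (\<lambda>i. of_real (d i))) (exp_conj n d (k * s) (N s))) $$ (i, j) =
      of_real (exp (k * s * (d i - d j))) * N' $$ (i, j) +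
      of_real (exp (k * s * (d i - d j)) * (k * (d i - d j))) * N s $$ (i, j)"
    using ij carrier_matD[OF bracket_carrier[OF mat_diag_dim exp_conj_carrier[of n d "k * s" "N s"], of "\<lambda>i. of_real (d i)"]]
    by (simp add: index_bracket_mat_diag[of _ n])
  ultimately show "((\<lambda>s. exp_conj n d (k * s) (N s) $$ (i, j)) has_vector_derivative
    (exp_conj n d (k * s) N' + of_real k \<cdot>\<^sub>m bracket (mat_diag n (\<lambda>i. of_real (d i))) (exp_conj n d (k * s) (N s))) $$ (i, j)) (at s within {0..1})"
    by simp
qed

text \<open>In the eigenbasis of \<open>H\<close> and the interaction picture the connection \<open>H + B\<close> becomes the small form \<open>C\<close>.\<close>

lemma transport_exists:
  fixes B :: "real \<Rightarrow> complex mat" and d :: "nat \<Rightarrow> real" and L :: real and n :: nat and U W H :: "complex mat"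
  defines "C \<equiv> \<lambda>s. of_real (- L) \<cdot>\<^sub>m exp_conj n d (L * s) (W * B s * U)"
  assumes c: "U \<in> carrier_mat n n" "W \<in> carrier_mat n n" "H \<in> carrier_mat n n" "\<And>s. B s \<in> carrier_mat n n"
    and inv: "W * U = 1\<^sub>m n" "U * W = 1\<^sub>m n" and HU: "H * U = U * mat_diag n (\<lambda>i. of_real (d i))"
    and cont: "\<And>i j. i < n \<Longrightarrow> j < n \<Longrightarrow> continuous_on {0..1} (\<lambda>s. C s $$ (i, j))"
    and bound: "\<And>s i j. s \<in> {0..1} \<Longrightarrow> i < n \<Longrightarrow> j < n \<Longrightarrow> norm (C s $$ (i, j)) \<le> \<beta>"
    and \<beta>: "0 \<le> \<beta>" "real n * \<beta> \<le> 1 / 2"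
  obtains Q R where "Q \<in> carrier_mat n n" "R \<in> carrier_mat n n" "R * Q = 1\<^sub>m n"
    "\<And>i j. i < n \<Longrightarrow> j < n \<Longrightarrow>
       norm (Q $$ (i, j) - (if i = j then 1 else 0) - integral {0..1} (\<lambda>s. C s $$ (i, j))) \<le> 2 * (real n * \<beta>)\<^sup>2"
    "\<And>M. M \<in> carrier_mat n n \<Longrightarrow> \<exists>Z. (\<forall>s. Z s \<in> carrier_mat n n) \<and>
       (\<forall>s\<in>{0..1}. (\<Sum>i<n. Z s $$ (i, i)) = (\<Sum>i<n. M $$ (i, i))) \<and>
       (\<forall>s\<in>{0..1}. mat_deriv n Z (of_real (- L) \<cdot>\<^sub>m bracket (H + B s) (Z s)) s) \<and>
       Z 0 = U * M * W \<and> Z 1 = U * exp_conj n d (- L) (Q * M * R) * W"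
proof -
  note m = mult_carrier_mat[of _ n n _ n]
  have WBU: "W * B s * U \<in> carrier_mat n n" for s using c by (auto intro: m)
  have C: "C s \<in> carrier_mat n n" for s by (simp add: C_def)
  obtain Q R where Q: "\<And>s. Q s \<in> carrier_mat n n" "\<And>s. R s \<in> carrier_mat n n" "Q 0 = 1\<^sub>m n" "R 0 = 1\<^sub>m n"
    "\<And>s. s \<in> {0..1} \<Longrightarrow> R s * Q s = 1\<^sub>m n"
    "\<And>s. s \<in> {0..1} \<Longrightarrow> mat_deriv n Q (C s * Q s) s"
    "\<And>s. s \<in> {0..1} \<Longrightarrow> mat_deriv n R (- (R s * C s)) s"
    "\<And>i j. i < n \<Longrightarrow> j < n \<Longrightarrow>
       norm (Q 1 $$ (i, j) - (if i = j then 1 else 0) - integral {0..1} (\<lambda>s. C s $$ (i, j))) \<le> 2 * (real n * \<beta>)\<^sup>2"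
  proof (rule mat_ode_exists[OF C cont bound \<beta>])
    fix Q R assume "\<And>s. Q s \<in> carrier_mat n n" "\<And>s. R s \<in> carrier_mat n n" "Q 0 = 1\<^sub>m n" "R 0 = 1\<^sub>m n"
      "\<And>s. s \<in> {0..1} \<Longrightarrow> R s * Q s = 1\<^sub>m n"
      "\<And>s. s \<in> {0..1} \<Longrightarrow> mat_deriv n Q (C s * Q s) s"
      "\<And>s. s \<in> {0..1} \<Longrightarrow> mat_deriv n R (- (R s * C s)) s"
      "\<And>i j. i < n \<Longrightarrow> j < n \<Longrightarrow>
         norm (Q 1 $$ (i, j) - (if i = j then 1 else 0) - integral {0..1} (\<lambda>s. C s $$ (i, j))) \<le> 2 * (real n * \<beta>)\<^sup>2"
    then show thesis by (rule that)
  qed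
  have Z: "\<exists>Z. (\<forall>s. Z s \<in> carrier_mat n n) \<and>
       (\<forall>s\<in>{0..1}. (\<Sum>i<n. Z s $$ (i, i)) = (\<Sum>i<n. M $$ (i, i))) \<and>
       (\<forall>s\<in>{0..1}. mat_deriv n Z (of_real (- L) \<cdot>\<^sub>m bracket (H + B s) (Z s)) s) \<and>
       Z 0 = U * M * W \<and> Z 1 = U * exp_conj n d (- L) (Q 1 * M * R 1) * W" if M: "M \<in> carrier_mat n n" for M
  proof -
    \<comment> \<open>N solves N' = [C, N] with N 0 = M. Undoing first the interaction picture and
      then the eigenbasis gives the solution Z of the original equation.\<close>
    define N where "N s = Q s * M * R s" for s
    define Z where "Z s = U * exp_conj n d (- L * s) (N s) * W" for s
    have NZ: "N = (\<lambda>s. Q s * M * R s)" "Z = (\<lambda>s. U * exp_conj n d (- L * s) (N s) * W)"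
      by (simp_all add: N_def Z_def fun_eq_iff)
    have N: "N s \<in> carrier_mat n n" for s unfolding N_def using Q M by (auto intro: m)
    have Zc: "Z s \<in> carrier_mat n n" for s unfolding Z_def using c by (auto intro: m)
    have tr: "(\<Sum>i<n. Z s $$ (i, i)) = (\<Sum>i<n. M $$ (i, i))" if s: "s \<in> {0..1}" for s
    proof -
      let ?X = "exp_conj n d (- L * s) (N s)"
      have UX: "U * ?X \<in> carrier_mat n n" using c by (auto intro: m)
      have QM: "Q s * M \<in> carrier_mat n n" using Q M by (auto intro: m)
      have "(\<Sum>i<n. Z s $$ (i, i)) = (\<Sum>i<n. (W * (U * ?X)) $$ (i, i))"
        unfolding Z_def by (rule trace_mult_commute[OF UX c(2)])
      also have "W * (U * ?X) = ?X"
        by (rule mat_mult_cancel_left[OF c(2,1) exp_conj_carrier inv(1)])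
      also have "(\<Sum>i<n. ?X $$ (i, i)) = (\<Sum>i<n. N s $$ (i, i))" by simp
      also have "\<dots> = (\<Sum>i<n. (R s * (Q s * M)) $$ (i, i))"
        unfolding N_def by (rule trace_mult_commute[OF QM Q(2)])
      also have "R s * (Q s * M) = M"
        by (rule mat_mult_cancel_left[OF Q(2,1) M Q(5)[OF s]])
      finally show ?thesis .
    qed
    have dZ: "mat_deriv n Z (of_real (- L) \<cdot>\<^sub>m bracket (H + B s) (Z s)) s" if s: "s \<in> {0..1}" for s
    proof -
      let ?D = "mat_diag n (\<lambda>i. complex_of_real (d i))" let ?X = "exp_conj n d (- L * s) (N s)"
      have CQ: "C s * Q s \<in> carrier_mat n n" "R s * C s \<in> carrier_mat n n" using C Q by (auto intro: m)
      have "mat_deriv n (\<lambda>s. Q s * M) (C s * Q s * M) s"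
        by (rule mat_deriv_mult_const[OF M Q(1) CQ(1) Q(6)[OF s]])
      from mat_deriv_mult[OF m[OF Q(1) M] m[OF CQ(1) M] this Q(2) _ Q(7)[OF s]] CQ
      have dN: "mat_deriv n N (C s * Q s * M * R s + Q s * M * (- (R s * C s))) s"
        by (simp only: NZ(1) uminus_carrier_iff_mat)
      have "C s * Q s * M * R s + Q s * M * (- (R s * C s)) = bracket (C s) (N s)"
      proof -
        have QM: "Q s * M \<in> carrier_mat n n" using Q M by (auto intro: m)
        have 1: "C s * Q s * M * R s = C s * N s"
          unfolding N_def using C Q M by (simp add: m mat_mult_assoc[of _ n])
        have "Q s * M * (R s * C s) = N s * C s"
          unfolding N_def using C Q M by (simp add: m mat_mult_assoc[of _ n])
        moreover have "Q s * M * (- (R s * C s)) = - (Q s * M * (R s * C s))"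
          using carrier_matD[OF QM] carrier_matD[OF CQ(2)] by (simp del: index_mult_mat)
        ultimately show ?thesis
          unfolding 1 bracket_def by (simp add: minus_add_uminus_mat[OF m[OF C N] m[OF N C]])
      qed
      then have dN: "mat_deriv n N (bracket (C s) (N s)) s" using dN by simp
      have eq: "exp_conj n d (- L * s) (bracket (C s) (N s)) + of_real (- L) \<cdot>\<^sub>m bracket ?D ?X =
          of_real (- L) \<cdot>\<^sub>m bracket (?D + W * B s * U) ?X"
      proof (rule eq_matI)
        fix i j assume "i < dim_row (of_real (- L) \<cdot>\<^sub>m bracket (?D + W * B s * U) ?X)"
          "j < dim_col (of_real (- L) \<cdot>\<^sub>m bracket (?D + W * B s * U) ?X)"
        moreover have bc: "bracket (?D + W * B s * U) ?X \<in> carrier_mat n n" "bracket ?D ?X \<in> carrier_mat n n"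
            "bracket (W * B s * U) ?X \<in> carrier_mat n n"
          using WBU by (auto intro!: bracket_carrier)
        ultimately have ij: "i < n" "j < n" using carrier_matD[OF bc(1)] by auto
        \<comment> \<open>Conjugating back removes the exponentials from C, so that both brackets
          have the common factor - L.\<close>
        have "exp_conj n d (- L * s) (C s) = of_real (- L) \<cdot>\<^sub>m (W * B s * U)"
          unfolding C_def
        proof (rule eq_matI)
          fix i j assume "i < dim_row (of_real (- L) \<cdot>\<^sub>m (W * B s * U))" "j < dim_col (of_real (- L) \<cdot>\<^sub>m (W * B s * U))"
          then have ij: "i < n" "j < n" using carrier_matD[OF WBU[of s]] by (auto simp del: index_mult_mat)
          have "complex_of_real (exp (- L * s * (d i - d j))) * of_real (exp (L * s * (d i - d j))) = 1"
            unfolding of_real_mult[symmetric] exp_add[symmetric] by simp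
          then have "of_real (exp (- L * s * (d i - d j))) * (of_real (exp (L * s * (d i - d j))) * z) = z" for z :: complex
            by (simp only: mult.assoc[symmetric] mult_1_left)
          then show "exp_conj n d (- L * s) (of_real (- L) \<cdot>\<^sub>m exp_conj n d (L * s) (W * B s * U)) $$ (i, j) =
              (of_real (- L) \<cdot>\<^sub>m (W * B s * U)) $$ (i, j)"
            using ij carrier_matD[OF WBU[of s]] carrier_matD[OF exp_conj_carrier[of n d "L * s" "W * B s * U"]]
            by (simp add: mult.left_commute[of _ "complex_of_real L"] del: index_mult_mat)
        qed (use carrier_matD[OF WBU[of s]] in \<open>simp_all add: exp_conj_def del: index_mult_mat\<close>)
        then have "exp_conj n d (- L * s) (bracket (C s) (N s)) $$ (i, j) = of_real (- L) * bracket (W * B s * U) ?X $$ (i, j)"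
          unfolding exp_conj_bracket[OF C N] by (simp only: index_bracket_smult_left[OF WBU exp_conj_carrier ij])
        then show "(exp_conj n d (- L * s) (bracket (C s) (N s)) + of_real (- L) \<cdot>\<^sub>m bracket ?D ?X) $$ (i, j) =
            (of_real (- L) \<cdot>\<^sub>m bracket (?D + W * B s * U) ?X) $$ (i, j)"
          using ij carrier_matD[OF bc(2)] carrier_matD[OF bc(3)]
          unfolding bracket_add_left[OF mat_diag_dim WBU exp_conj_carrier] by (simp add: algebra_simps)
      next
        have bc: "bracket (?D + W * B s * U) ?X \<in> carrier_mat n n" "bracket ?D ?X \<in> carrier_mat n n"
          using WBU by (auto intro!: bracket_carrier)
        show "dim_row (exp_conj n d (- L * s) (bracket (C s) (N s)) + of_real (- L) \<cdot>\<^sub>m bracket ?D ?X) =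
          dim_row (of_real (- L) \<cdot>\<^sub>m bracket (?D + W * B s * U) ?X)"
          "dim_col (exp_conj n d (- L * s) (bracket (C s) (N s)) + of_real (- L) \<cdot>\<^sub>m bracket ?D ?X) =
          dim_col (of_real (- L) \<cdot>\<^sub>m bracket (?D + W * B s * U) ?X)"
          using carrier_matD[OF bc(1)] carrier_matD[OF bc(2)] by simp_all
      qed
      have bX: "bracket (?D + W * B s * U) ?X \<in> carrier_mat n n" using WBU by (auto intro!: bracket_carrier)
      from mat_deriv_exp_conj[OF N dN bracket_carrier[OF C N], of d "- L"]
      have dX: "mat_deriv n (\<lambda>s. exp_conj n d (- L * s) (N s)) (of_real (- L) \<cdot>\<^sub>m bracket (?D + W * B s * U) ?X) s"
        unfolding eq .
      have bX': "of_real (- L) \<cdot>\<^sub>m bracket (?D + W * B s * U) ?X \<in> carrier_mat n n" using bX by simp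
      note step = mat_deriv_const_mult[OF c(1) exp_conj_carrier bX' dX]
      have "mat_deriv n Z (U * (of_real (- L) \<cdot>\<^sub>m bracket (?D + W * B s * U) ?X) * W) s"
        unfolding NZ(2) by (rule mat_deriv_mult_const[OF c(2) m[OF c(1) exp_conj_carrier] m[OF c(1) bX'] step])
      moreover have "U * (of_real (- L) \<cdot>\<^sub>m bracket (?D + W * B s * U) ?X) * W =
          of_real (- L) \<cdot>\<^sub>m (U * bracket (?D + W * B s * U) ?X * W)"
        unfolding mult_smult_distrib[OF c(1) bX] by (rule mult_smult_assoc_mat[OF m[OF c(1) bX] c(2)])
      moreover have "U * bracket (?D + W * B s * U) ?X * W = bracket (U * (?D + W * B s * U) * W) (Z s)"
        unfolding Z_def using WBU by (intro conj_bracket[OF c(1,2) _ exp_conj_carrier inv(1)]) auto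
      moreover have "U * (?D + W * B s * U) * W = H + B s"
      proof -
        have UD: "U * ?D \<in> carrier_mat n n" "U * (W * B s * U) \<in> carrier_mat n n" using c WBU by (auto intro!: m)
        have "U * (?D + W * B s * U) * W = U * ?D * W + U * (W * B s * U) * W"
          unfolding mult_add_distrib_mat[OF c(1) mat_diag_dim WBU] by (rule add_mult_distrib_mat[OF UD c(2)])
        also have "U * ?D * W = H * (U * W)" unfolding HU[symmetric] by (rule mat_mult_assoc[OF c(3,1,2)])
        also have "\<dots> = H" using c(3) by (simp add: inv)
        also have "U * (W * B s * U) * W = U * (W * (B s * (U * W)))"
          using c by (simp add: m mat_mult_assoc[of _ n])
        also have "\<dots> = B s" unfolding inv(2) using c(4)[of s] mat_mult_cancel_left[OF c(1,2) c(4) inv(2)] by simp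
        finally show ?thesis .
      qed
      ultimately show ?thesis by simp
    qed
    have "exp_conj n d 0 X = X" if "X \<in> carrier_mat n n" for X
      by (rule eq_matI) (use that in \<open>auto simp: exp_conj_def\<close>)
    then have "Z 0 = U * M * W" using M by (simp add: Z_def N_def Q(3,4))
    moreover have "Z 1 = U * exp_conj n d (- L) (Q 1 * M * R 1) * W" by (simp add: Z_def N_def)
    ultimately show ?thesis using Zc tr dZ by blast
  qed
  show thesis by (rule that[OF Q(1,2) Q(5) Q(8) Z]) simp_all
qed

section \<open>Holonomy along the geodesic\<close>

lemma index_conj:
  assumes "W \<in> carrier_mat n n" "X \<in> carrier_mat n n" "U \<in> carrier_mat n n" "i < n" "j < n"
  shows "(W * X * U) $$ (i, j) = (\<Sum>r<n. \<Sum>l<n. W $$ (i, r) * X $$ (r, l) * U $$ (l, j))"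
proof -
  have "(W * X * U) $$ (i, j) = (\<Sum>l<n. (\<Sum>r<n. W $$ (i, r) * X $$ (r, l)) * U $$ (l, j))"
    unfolding index_mult_mat_sum[OF mult_carrier_mat[OF assms(1,2)] assms(3-5)]
    using assms by (intro sum.cong refl) (simp add: index_mult_mat_sum[of _ n] del: index_mult_mat(1))
  then show ?thesis unfolding sum_distrib_right by (subst sum.swap)
qed

text \<open>In this form the frame change at the base point can be absorbed into the conjugating
  matrix of \<open>monodromy_similar\<close>.\<close>

lemma twist_eq_conj:
  assumes "l \<noteq> 0" "M \<in> carrier_mat n n"
  shows "twist n l M = mat_diag n (\<lambda>i. l ^ i) * M * mat_diag n (\<lambda>i. inverse l ^ i)"
proof -
  have "l powi (int i - int j) = l ^ i * inverse l ^ j" for i j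
    using assms(1) by (simp add: power_int_diff divide_inverse power_inverse)
  then show ?thesis
    unfolding mat_diag_mult_left[OF assms(2)] by (subst mat_diag_mult_right[of _ n n]) (auto simp: twist_def mult_ac)
qed

lemma D_section_carrier:
  "u c x \<in> carrier_mat n n \<Longrightarrow> D_section n h u c x v \<in> carrier_mat n n"
  unfolding D_section_def by (intro add_carrier_mat bracket_carrier D_form_carrier)

context geodesic_on_surface
begin

text \<open>In the eigenbasis [H, u] is a bracket with a diagonal matrix and has zero diagonal.
  Hence the diagonal entries of D u are plain s-derivatives of those of u, and what remains is the
  part of \<open>psi0\<close>, the sum of a number and its conjugate times
  \<open>E_diag\<close>.\<close>

lemma diagonal_pairing:
  assumes u: "G_section atlas n u" and k: "1 \<le> k" and a: "a < n"
    and \<alpha>: "\<And>c y v. c \<in> atlas \<Longrightarrow> y \<in> fst c \<Longrightarrow> \<alpha> c y v = psi0 n k h q c y v + D_section n h u c y v"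
  shows "((\<lambda>s. (eigenbasis_inv n * section_along n u s * eigenbasis n) $$ (a, a)) has_vector_derivative
    (eigenbasis_inv n * form_along n \<alpha> s * eigenbasis n) $$ (a, a) -
      of_real (2 * E_diag n (k - 1) a * Re (eval_differential atlas k q \<gamma> s))) (at s)"
proof -
  let ?W = "eigenbasis_inv n" and ?U = "eigenbasis n" and ?c = "chart_at s"
  let ?V = "velocity ?c \<gamma> s" and ?Q = "eval_differential atlas k q \<gamma> s"
  have c: "?c \<in> atlas" "\<gamma> s \<in> fst ?c" by (fact chart_at)+
  let ?X = "twist n ?V (psi0 n k h q ?c (\<gamma> s) ?V)" and ?Y = "twist n ?V (D_section n h u ?c (\<gamma> s) ?V)"
  let ?B = "bracket (H_mat n) (section_along n u s)"
  have Q: "?Q = q ?c (\<gamma> s) * ?V ^ k"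
    unfolding eval_differential_def chart_at_def by (simp add: Let_def)
  have uc: "u ?c (\<gamma> s) \<in> carrier_mat n n" using G_sectionD(1)[OF u c] by (simp add: sl_def)
  have psic: "psi0 n k h q ?c (\<gamma> s) ?V \<in> carrier_mat n n"
    unfolding psi0_def cartan_involution_def by (intro minus_carrier_mat) simp
  have Dc: "D_section n h u ?c (\<gamma> s) ?V \<in> carrier_mat n n" by (rule D_section_carrier) (rule uc)
  have F: "form_along n \<alpha> s = ?X + ?Y"
    unfolding form_along_def section_along_def \<alpha>[OF c] by (rule twist_add[OF psic Dc])
  have Bc: "?B \<in> carrier_mat n n" by (intro bracket_carrier) simp_all
  have X: "?X $$ (i, j) = ?Q * E_mat n (k - 1) $$ (i, j) + cnj ?Q * cnj (E_mat n (k - 1) $$ (j, i))"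
    if "i < n" "j < n" for i j
    unfolding Q by (rule twist_psi0(1), rule velocity(3)[OF c], rule velocity(2)[OF c], rule k, rule that(1), rule that(2))
  have "(\<Sum>i<n. \<Sum>j<n. ?W $$ (a, i) * ?X $$ (i, j) * ?U $$ (j, a)) =
      (\<Sum>i<n. \<Sum>j<n. ?Q * (?W $$ (a, i) * E_mat n (k - 1) $$ (i, j) * ?U $$ (j, a)) +
        cnj ?Q * (?W $$ (a, i) * cnj (E_mat n (k - 1) $$ (j, i)) * ?U $$ (j, a)))"
    by (intro sum.cong refl) (simp add: X algebra_simps del: index_twist(1))
  also have "\<dots> = ?Q * of_real (E_diag n (k - 1) a) + cnj ?Q * of_real (E_diag n (k - 1) a)"
    unfolding sum.distrib sum_distrib_left[symmetric] E_mat_diag[OF a] ..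
  also have "\<dots> = (?Q + cnj ?Q) * of_real (E_diag n (k - 1) a)" by (simp only: distrib_right)
  also have "\<dots> = of_real (2 * E_diag n (k - 1) a * Re ?Q)"
    unfolding complex_add_cnj by (simp only: of_real_mult[symmetric] mult_ac)
  finally have WXU: "(\<Sum>i<n. \<Sum>j<n. ?W $$ (a, i) * ?X $$ (i, j) * ?U $$ (j, a)) = of_real (2 * E_diag n (k - 1) a * Re ?Q)" .
  have WHU: "?W * H_mat n * ?U = mat_diag n (\<lambda>a. of_real (H_eigenvalue n a))"
    unfolding mat_mult_assoc[OF eigenbasis_carrier(2,3,1)] H_mat_eigenbasis
    by (rule mat_mult_cancel_left[OF eigenbasis_carrier(2,1) mat_diag_dim eigenbasis_inverse(1)])
  have "(?W * ?B * ?U) $$ (a, a) = 0"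
    unfolding conj_bracket[OF eigenbasis_carrier(2,1,3) section_along_carrier(1) eigenbasis_inverse(2)] WHU
    using a by (subst index_bracket_mat_diag[of _ n]) (auto intro!: mult_carrier_mat[of _ n n])
  then have WBU: "(\<Sum>i<n. \<Sum>j<n. ?W $$ (a, i) * ?B $$ (i, j) * ?U $$ (j, a)) = 0"
    unfolding index_conj[OF eigenbasis_carrier(2) Bc eigenbasis_carrier(1) a a] .
  have term_deriv: "((\<lambda>s. ?W $$ (a, i) * section_along n u s $$ (i, j) * ?U $$ (j, a)) has_vector_derivative
      ?W $$ (a, i) * (?Y $$ (i, j) - ?B $$ (i, j)) * ?U $$ (j, a)) (at s)" if "i \<in> {..<n}" "j \<in> {..<n}" for i j
    by (rule has_vector_derivative_mult_left, rule has_vector_derivative_mult_right,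
        rule section_along_has_vector_derivative[OF u c]) (use that in auto)
  have "((\<lambda>s. \<Sum>i<n. \<Sum>j<n. ?W $$ (a, i) * section_along n u s $$ (i, j) * ?U $$ (j, a)) has_vector_derivative
      (\<Sum>i<n. \<Sum>j<n. ?W $$ (a, i) * (?Y $$ (i, j) - ?B $$ (i, j)) * ?U $$ (j, a))) (at s)"
    by (rule has_vector_derivative_sum, rule has_vector_derivative_sum, rule term_deriv)
  moreover have "(\<Sum>i<n. \<Sum>j<n. ?W $$ (a, i) * (?Y $$ (i, j) - ?B $$ (i, j)) * ?U $$ (j, a)) =
      (?W * form_along n \<alpha> s * ?U) $$ (a, a) - of_real (2 * E_diag n (k - 1) a * Re ?Q)"
  proof -
    have "(?W * form_along n \<alpha> s * ?U) $$ (a, a) =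
        (\<Sum>i<n. \<Sum>j<n. ?W $$ (a, i) * ?X $$ (i, j) * ?U $$ (j, a) + ?W $$ (a, i) * ?Y $$ (i, j) * ?U $$ (j, a))"
      unfolding index_conj[OF eigenbasis_carrier(2) section_along_carrier(2) eigenbasis_carrier(1) a a]
      unfolding F by (intro sum.cong refl) (simp add: algebra_simps del: index_twist(1))
    also have "\<dots> = of_real (2 * E_diag n (k - 1) a * Re ?Q) + (\<Sum>i<n. \<Sum>j<n. ?W $$ (a, i) * ?Y $$ (i, j) * ?U $$ (j, a))"
      unfolding sum.distrib WXU ..
    finally have 1: "(?W * form_along n \<alpha> s * ?U) $$ (a, a) = \<dots>" .
    have "(\<Sum>i<n. \<Sum>j<n. ?W $$ (a, i) * (?Y $$ (i, j) - ?B $$ (i, j)) * ?U $$ (j, a)) =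
        (\<Sum>i<n. \<Sum>j<n. ?W $$ (a, i) * ?Y $$ (i, j) * ?U $$ (j, a) - ?W $$ (a, i) * ?B $$ (i, j) * ?U $$ (j, a))"
      by (simp only: left_diff_distrib right_diff_distrib)
    also have "\<dots> = (\<Sum>i<n. \<Sum>j<n. ?W $$ (a, i) * ?Y $$ (i, j) * ?U $$ (j, a))"
      unfolding sum_subtractf WBU by simp
    finally show ?thesis unfolding 1 by simp
  qed
  ultimately show ?thesis
    unfolding index_conj[OF eigenbasis_carrier(2) section_along_carrier(1) eigenbasis_carrier(1) a a] by simp
qed

text \<open>Let T be the holonomy, P the total frame and E = e^(-L H). The monodromy condition says
  that conjugation by E Q agrees with the adjoint action of P' T P on every traceless matrix; so (E
  Q)^(-1) P' T P commutes with all of these and is a scalar.\<close>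

lemma monodromy_similar:
  assumes n: "2 \<le> n" and \<alpha>: "G_form atlas n \<alpha>"
    and \<rho>: "\<rho> (closed_curve_loop \<gamma> L) \<in> carrier_mat n n"
    and mono: "monodromy atlas n (\<lambda>c y v. D_form n h c y v + \<alpha> c y v) (\<gamma> 0) \<rho>"
    and Q: "Q \<in> carrier_mat n n" "R \<in> carrier_mat n n" "R * Q = 1\<^sub>m n"
    and transport: "\<And>M. M \<in> carrier_mat n n \<Longrightarrow> \<exists>Z. (\<forall>s. Z s \<in> carrier_mat n n) \<and>
       (\<forall>s\<in>{0..1}. (\<Sum>i<n. Z s $$ (i, i)) = (\<Sum>i<n. M $$ (i, i))) \<and>
       (\<forall>s\<in>{0..1}. mat_deriv n Z (of_real (- L) \<cdot>\<^sub>m bracket (H_mat n + form_along n \<alpha> (L * s)) (Z s)) s) \<and>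
       Z 0 = eigenbasis n * M * eigenbasis_inv n \<and>
       Z 1 = eigenbasis n * exp_conj n (H_eigenvalue n) (- L) (Q * M * R) * eigenbasis_inv n"
  shows "\<exists>\<omega>. similar_mat (map_mat complex_of_real (\<rho> (closed_curve_loop \<gamma> L)))
    (\<omega> \<cdot>\<^sub>m (mat_diag n (\<lambda>i. of_real (exp (- L * H_eigenvalue n i))) * Q))"
proof -
  let ?p = "closed_curve_loop \<gamma> L" and ?U = "eigenbasis n" and ?W = "eigenbasis_inv n"
  note m = mult_carrier_mat[of _ n n _ n] and assoc = mat_mult_assoc[of _ n]
  define T where "T = map_mat complex_of_real (\<rho> ?p)"
  have T: "T \<in> carrier_mat n n" using \<rho> by (simp add: T_def)
  from mono[unfolded monodromy_def] obtain c g g' where c: "c \<in> atlas" "\<gamma> 0 \<in> fst c"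
    and g: "g \<in> carrier_mat n n" "g' \<in> carrier_mat n n" "g * g' = 1\<^sub>m n" "g' * g = 1\<^sub>m n"
    and tr: "\<forall>p\<in>loops (\<gamma> 0). C1_path atlas p \<longrightarrow> (\<forall>S. parallel_along atlas n (\<lambda>c y v. D_form n h c y v + \<alpha> c y v) p S \<longrightarrow>
        (let R = map_mat complex_of_real (\<rho> p) in (g * S c 1 * g') * R = R * (g * S c 0 * g')))"
    by (elim bexE conjE exE)
  let ?V = "velocity c \<gamma> 0"
  define l where "l = inverse ?V"
  have l: "l \<noteq> 0" using velocity(3)[OF c] by (simp add: l_def)
  define \<Delta> where "\<Delta> = mat_diag n (\<lambda>i. l ^ i)"
  define \<Delta>' where "\<Delta>' = mat_diag n (\<lambda>i. inverse l ^ i)"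
  have \<Delta>: "\<Delta> \<in> carrier_mat n n" "\<Delta>' \<in> carrier_mat n n" by (simp_all add: \<Delta>_def \<Delta>'_def)
  have \<Delta>inv: "\<Delta> * \<Delta>' = 1\<^sub>m n" "\<Delta>' * \<Delta> = 1\<^sub>m n"
    using l by (simp_all add: \<Delta>_def \<Delta>'_def power_mult_distrib[symmetric])
  \<comment> \<open>P collects three changes of basis: the eigenbasis, the twist to the chart c at
    the base point, and the identification g from \<open>monodromy\<close>.\<close>
  define P where "P = g * (\<Delta> * ?U)"
  define P' where "P' = ?W * (\<Delta>' * g')"
  have P: "P \<in> carrier_mat n n" "P' \<in> carrier_mat n n" unfolding P_def P'_def using g \<Delta> by (auto intro!: m)
  have PP: "P' * P = 1\<^sub>m n"
  proof -
    have "P' * P = ?W * (\<Delta>' * (g' * (g * (\<Delta> * ?U))))"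
      unfolding P_def P'_def using g \<Delta> by (simp add: m assoc)
    also have "g' * (g * (\<Delta> * ?U)) = \<Delta> * ?U" using g \<Delta> by (intro mat_mult_cancel_left[of _ n]) (auto intro!: m)
    also have "\<Delta>' * (\<Delta> * ?U) = ?U" using \<Delta> \<Delta>inv by (intro mat_mult_cancel_left[of _ n]) auto
    finally show ?thesis by (simp add: eigenbasis_inverse)
  qed
  have PP': "P * P' = 1\<^sub>m n" by (rule mat_mult_left_right_inverse[OF P(2,1) PP])
  define E where "E = mat_diag n (\<lambda>i. complex_of_real (exp (- L * H_eigenvalue n i)))"
  define E' where "E' = mat_diag n (\<lambda>i. complex_of_real (exp (- (- L * H_eigenvalue n i))))"
  have E: "E \<in> carrier_mat n n" "E' \<in> carrier_mat n n" by (simp_all add: E_def E'_def)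
  have EE: "E' * E = 1\<^sub>m n" "E * E' = 1\<^sub>m n"
    unfolding E_def E'_def mat_diag_diag of_real_mult[symmetric] exp_add[symmetric] by simp_all
  have frame: "g * twist n l (?U * X * ?W) * g' = P * (X * P')" if X: "X \<in> carrier_mat n n" for X
  proof -
    have "twist n l (?U * X * ?W) = \<Delta> * (?U * X * ?W) * \<Delta>'"
      unfolding \<Delta>_def \<Delta>'_def by (rule twist_eq_conj[OF l]) (use X in \<open>auto intro!: m\<close>)
    then show ?thesis unfolding P_def P'_def using g \<Delta> X by (simp add: m assoc)
  qed
  have key: "P * (exp_conj n (H_eigenvalue n) (- L) (Q * M * R) * P') * T = T * (P * (M * P'))"
    if M: "M \<in> carrier_mat n n" "(\<Sum>i<n. M $$ (i, i)) = 0" for M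
  proof -
    from transport[OF M(1)] obtain Z where Z: "\<forall>s. Z s \<in> carrier_mat n n"
      "\<forall>s\<in>{0..1}. (\<Sum>i<n. Z s $$ (i, i)) = (\<Sum>i<n. M $$ (i, i))"
      "\<forall>s\<in>{0..1}. mat_deriv n Z (of_real (- L) \<cdot>\<^sub>m bracket (H_mat n + form_along n \<alpha> (L * s)) (Z s)) s"
      "Z 0 = ?U * M * ?W" "Z 1 = ?U * exp_conj n (H_eigenvalue n) (- L) (Q * M * R) * ?W"
      by (elim exE conjE)
    let ?S = "\<lambda>c s. twist n (inverse (velocity c \<gamma> (L * s))) (Z s)"
    have "parallel_along atlas n (\<lambda>c y v. D_form n h c y v + \<alpha> c y v) ?p ?S"
    proof (rule parallel_along_loop[OF \<alpha>])
      show "Z s \<in> carrier_mat n n" for s using Z(1) ..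
      show "(\<Sum>i<n. Z s $$ (i, i)) = 0" if "s \<in> {0..1}" for s using bspec[OF Z(2) that] M(2) by simp
      show "((\<lambda>s. Z s $$ (i, j)) has_vector_derivative
          - of_real L * bracket (H_mat n + form_along n \<alpha> (L * s)) (Z s) $$ (i, j)) (at s within {0..1})"
        if s: "s \<in> {0..1}" and ij: "i < n" "j < n" for s i j
      proof -
        have "bracket (H_mat n + form_along n \<alpha> (L * s)) (Z s) \<in> carrier_mat n n"
          using Z(1) by (intro bracket_carrier) simp_all
        then have "(of_real (- L) \<cdot>\<^sub>m bracket (H_mat n + form_along n \<alpha> (L * s)) (Z s)) $$ (i, j) =
            - of_real L * bracket (H_mat n + form_along n \<alpha> (L * s)) (Z s) $$ (i, j)"
          using ij by (simp add: carrier_matD)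
        then show ?thesis
          using bspec[OF Z(3) s, unfolded mat_deriv_def, THEN spec, THEN mp, OF ij(1), THEN spec, THEN mp, OF ij(2)]
          by (simp only:)
      qed
    qed
    then have "(g * ?S c 1 * g') * T = T * (g * ?S c 0 * g')"
      using bspec[OF tr closed_curve_loop_in_loops] C1_path_loop unfolding Let_def T_def by blast
    moreover have "?S c 0 = twist n l (?U * M * ?W)" by (simp add: l_def Z(4))
    \<comment> \<open>The velocity at time L equals that at time 0, so both ends of the loop are
      compared in the same frame.\<close>
    moreover have "?S c 1 = twist n l (?U * exp_conj n (H_eigenvalue n) (- L) (Q * M * R) * ?W)"
      using velocity_periodic[OF c] by (simp add: l_def Z(5))
    ultimately show ?thesis by (simp only: frame[OF M(1)] frame[OF exp_conj_carrier])
  qed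
  \<comment> \<open>The inverse of E Q times P' T P, the candidate for the scalar matrix.\<close>
  define Y where "Y = R * (E' * (P' * (T * P)))"
  have Y: "Y \<in> carrier_mat n n" unfolding Y_def using Q E P T by (auto intro!: m)
  have "M * Y = Y * M" if M: "M \<in> carrier_mat n n" "(\<Sum>i<n. M $$ (i, i)) = 0" for M
  proof -
    have QMR: "Q * M * R \<in> carrier_mat n n" using Q M by (auto intro!: m)
    have "exp_conj n (H_eigenvalue n) (- L) (Q * M * R) = E * (Q * M * R) * E'"
      unfolding E_def E'_def by (rule exp_conj_eq_conj[OF QMR])
    then have "P * (E * (Q * (M * (R * (E' * (P' * T)))))) = T * (P * (M * P'))"
      using key[OF M] Q E P T M by (simp add: m assoc)
    then have "R * (E' * (P' * (P * (E * (Q * (M * (R * (E' * (P' * T))))))))) = R * (E' * (P' * (T * (P * (M * P')))))" by simp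
    also have "P' * (P * (E * (Q * (M * (R * (E' * (P' * T))))))) = E * (Q * (M * (R * (E' * (P' * T)))))"
      using Q E P T M by (intro mat_mult_cancel_left[OF _ _ _ PP]) (auto intro!: m)
    also have "E' * (E * (Q * (M * (R * (E' * (P' * T)))))) = Q * (M * (R * (E' * (P' * T))))"
      using Q E P T M by (intro mat_mult_cancel_left[OF _ _ _ EE(1)]) (auto intro!: m)
    also have "R * (Q * (M * (R * (E' * (P' * T))))) = M * (R * (E' * (P' * T)))"
      using Q E P T M by (intro mat_mult_cancel_left[OF _ _ _ Q(3)]) (auto intro!: m)
    finally have "M * (R * (E' * (P' * T))) * P = R * (E' * (P' * (T * (P * (M * P'))))) * P" by simp
    also have "\<dots> = R * (E' * (P' * (T * (P * (M * (P' * P))))))"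
      using Q E P T M by (simp add: m assoc)
    also have "\<dots> = Y * M" unfolding PP Y_def using Q E P T M by (simp add: m assoc right_mult_one_mat)
    finally show ?thesis unfolding Y_def using Q E P T M by (simp add: m assoc)
  qed
  then have Y1: "Y = Y $$ (0, 0) \<cdot>\<^sub>m 1\<^sub>m n" by (rule commutant_traceless_scalar[OF n Y])
  let ?\<omega> = "Y $$ (0, 0)"
  have QR: "Q * R = 1\<^sub>m n" by (rule mat_mult_left_right_inverse[OF Q(2,1,3)])
  have EQ: "E * Q \<in> carrier_mat n n" using E Q by (auto intro!: m)
  have "E * (Q * Y) = P' * (T * P)"
  proof -
    have "Q * Y = E' * (P' * (T * P))"
      unfolding Y_def using Q E P T by (intro mat_mult_cancel_left[OF _ _ _ QR]) (auto intro!: m)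
    then show ?thesis using E P T by (simp only:) (intro mat_mult_cancel_left[OF _ _ _ EE(2)], auto intro!: m)
  qed
  moreover have "E * (Q * Y) = ?\<omega> \<cdot>\<^sub>m (E * Q)"
  proof -
    have "E * (Q * Y) = (E * Q) * Y" using assoc[OF E(1) Q(1) Y] by simp
    also have "\<dots> = (E * Q) * (?\<omega> \<cdot>\<^sub>m 1\<^sub>m n)" using Y1 by simp
    also have "\<dots> = ?\<omega> \<cdot>\<^sub>m (E * Q)"
      unfolding mult_smult_distrib[OF EQ one_carrier_mat] right_mult_one_mat[OF EQ] ..
    finally show ?thesis .
  qed
  ultimately have eq: "?\<omega> \<cdot>\<^sub>m (E * Q) = P' * (T * P)" by simp
  have "T = P * (?\<omega> \<cdot>\<^sub>m (E * Q)) * P'"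
  proof -
    have "P * (P' * (T * P)) * P' = T * P * P'"
      using mat_mult_cancel_left[OF P m[OF T P(1)] PP'] by simp
    also have "\<dots> = T * (P * P')" by (rule assoc[OF T P])
    also have "\<dots> = T" unfolding PP' by (rule right_mult_one_mat[OF T])
    finally show ?thesis unfolding eq ..
  qed
  then have "similar_mat T (?\<omega> \<cdot>\<^sub>m (E * Q))"
    by (intro similar_matI[of _ _ P P' n]) (use T P PP PP' EQ in auto)
  then show ?thesis unfolding T_def E_def by blast
qed

end

section \<open>The first variation\<close>

lemma has_vector_derivative_at_0_I:
  fixes f :: "real \<Rightarrow> 'b::real_normed_vector"
  assumes "\<And>\<eta>. \<eta> > 0 \<Longrightarrow> \<exists>\<delta>>0. \<forall>t. \<bar>t\<bar> < \<delta> \<longrightarrow> norm (f t - f 0 - t *\<^sub>R d) \<le> \<bar>t\<bar> * \<eta>"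
  shows "(f has_vector_derivative d) (at 0)"
  unfolding has_vector_derivative_def has_derivative_at_alt
  using assms by (auto simp: bounded_linear_scaleR_left mult.commute)

context geodesic_on_surface
begin

text \<open>The transport Q t is found for each t separately, and its derivative at 0 follows from
  two estimates alone: the quadratic tail of the Picard series and the uniform first-order remainder
  of the family of forms.\<close>

lemma first_variation:
  assumes n: "2 \<le> n" and k: "2 \<le> k" and p: "1 \<le> p" "p \<le> n"
    and def: "hitchin_deformation atlas h n (\<gamma> 0) (psi0 n k h q) \<delta>"
  shows "((\<lambda>t. ln (nth_eigenvalue p (\<delta> t (closed_curve_loop \<gamma> L)))) has_real_derivative
    - 2 * E_diag n (k - 1) (p - 1) * integral {0..L} (\<lambda>s. Re (eval_differential atlas k q \<gamma> s))) (at 0)"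
proof -
  let ?p = "closed_curve_loop \<gamma> L" and ?U = "eigenbasis n" and ?W = "eigenbasis_inv n"
  let ?d = "H_eigenvalue n"
  note m = mult_carrier_mat[of _ n n _ n]
  from def[unfolded hitchin_deformation_def] obtain \<epsilon> \<alpha> \<alpha>' u where \<epsilon>: "\<epsilon> > 0"
    and fam: "C1_family atlas n \<epsilon> \<alpha> \<alpha>'" and u: "G_section atlas n u"
    and init: "\<forall>c\<in>atlas. \<forall>y\<in>fst c. \<forall>v. \<alpha> 0 c y v = 0\<^sub>m n n \<and> \<alpha>' 0 c y v = psi0 n k h q c y v + D_section n h u c y v"
    and rep: "\<forall>t\<in>{- \<epsilon><..<\<epsilon>}. hitchin_rep n (\<gamma> 0) (\<delta> t) \<and>
           monodromy atlas n (\<lambda>c y v. D_form n h c y v + \<alpha> t c y v) (\<gamma> 0) (\<delta> t)"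
    by (elim conjE exE)
  have G: "G_form atlas n (\<alpha> t)" "G_form atlas n (\<alpha>' t)" if "t \<in> {- \<epsilon><..<\<epsilon>}" for t
    using conjunct1[OF fam[unfolded C1_family_def], THEN bspec, OF that] by (rule conjunct1, rule conjunct2)
  have z: "0 \<in> {- \<epsilon><..<\<epsilon>}" using \<epsilon> by simp
  define B where "B t s = form_along n (\<alpha> t) (L * s)" for t s
  define F where "F t s = form_along n (\<alpha>' t) (L * s)" for t s
  have BF: "B t s \<in> carrier_mat n n" "F t s \<in> carrier_mat n n" for t s by (simp_all add: B_def F_def)
  \<comment> \<open>The coefficient in the interaction picture over the unit interval; - L combines
    the speed of the loop with the sign of the transport equation.\<close>
  define C where "C t s = of_real (- L) \<cdot>\<^sub>m exp_conj n ?d (L * s) (?W * B t s * ?U)" for t s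
  define C' where "C' t s = of_real (- L) \<cdot>\<^sub>m exp_conj n ?d (L * s) (?W * F t s * ?U)" for t s
  let ?e = "\<lambda>s i j. - of_real L * (of_real (exp (L * s * (?d i - ?d j))) :: complex)"
  have C: "C t s $$ (i, j) = ?e s i j * (\<Sum>r<n. \<Sum>l<n. ?W $$ (i, r) * B t s $$ (r, l) * ?U $$ (l, j))"
    and C': "C' t s $$ (i, j) = ?e s i j * (\<Sum>r<n. \<Sum>l<n. ?W $$ (i, r) * F t s $$ (r, l) * ?U $$ (l, j))"
    if "i < n" "j < n" for t s i j
    using that carrier_matD[OF exp_conj_carrier[of n ?d "L * s"]]
    unfolding C_def C'_def index_conj[OF eigenbasis_carrier(2) BF(1) eigenbasis_carrier(1) that, symmetric]
      index_conj[OF eigenbasis_carrier(2) BF(2) eigenbasis_carrier(1) that, symmetric]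
    by (simp_all del: index_mult_mat)
  have exp_cont: "continuous_on S (\<lambda>s. ?e s i j)" for S i j
    by (intro continuous_intros)
  have B_cont: "continuous_on {0..1} (\<lambda>s. B t s $$ (i, j))" if "t \<in> {- \<epsilon><..<\<epsilon>}" "i < n" "j < n" for t i j
    unfolding B_def
    by (rule continuous_on_compose2[OF continuous_form_along_fixed[OF G(1)[OF that(1)] that(2,3), of UNIV]])
       (auto intro!: continuous_intros)
  have C_cont: "continuous_on {0..1} (\<lambda>s. C t s $$ (i, j))" if "t \<in> {- \<epsilon><..<\<epsilon>}" "i < n" "j < n" for t i j
    unfolding C[OF that(2,3)]
    by (rule continuous_on_mult[OF exp_cont], rule continuous_on_sum, rule continuous_on_sum,
        rule continuous_on_mult_right, rule continuous_on_mult_left, rule B_cont) (use that in auto)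
  have F_cont: "continuous_on ({- \<epsilon><..<\<epsilon>} \<times> {0..1}) (\<lambda>(t, s). F t s $$ (i, j))" if ij: "i < n" "j < n" for i j
  proof -
    have "continuous_on ({- \<epsilon><..<\<epsilon>} \<times> fst c) (\<lambda>(t, x). \<alpha>' t c x v $$ (i, j))" if "c \<in> atlas" for c v
      by (rule conjunct2[OF fam[unfolded C1_family_def], THEN bspec, OF that, THEN spec, THEN spec, THEN mp, OF ij(1),
        THEN spec, THEN mp, OF ij(2), THEN conjunct2])
    then have "continuous_on ({- \<epsilon><..<\<epsilon>} \<times> UNIV) (\<lambda>(t, s). form_along n (\<alpha>' t) s $$ (i, j))"
      using G(2) ij by (intro continuous_form_along) auto
    then have "continuous_on ({- \<epsilon><..<\<epsilon>} \<times> {0..1}) (\<lambda>x. (\<lambda>(t, s). form_along n (\<alpha>' t) s $$ (i, j)) (fst x, L * snd x))"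
      by (rule continuous_on_compose2[where f = "\<lambda>x. (fst x, L * snd x)"]) (auto intro!: continuous_intros)
    then show ?thesis by (simp add: F_def case_prod_unfold)
  qed
  have C'_cont: "continuous_on ({- \<epsilon><..<\<epsilon>} \<times> {0..1}) (\<lambda>(t, s). C' t s $$ (i, j))" if ij: "i < n" "j < n" for i j
  proof -
    have "continuous_on ({- \<epsilon><..<\<epsilon>} \<times> {0..1}) (\<lambda>x. ?e (snd x) i j)" by (intro continuous_intros)
    then have "continuous_on ({- \<epsilon><..<\<epsilon>} \<times> {0..1}) (\<lambda>x. ?e (snd x) i j *
        (\<Sum>r<n. \<Sum>l<n. ?W $$ (i, r) * F (fst x) (snd x) $$ (r, l) * ?U $$ (l, j)))"
      by (rule continuous_on_mult, intro continuous_on_sum continuous_on_mult_left continuous_on_mult_right)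
         (use F_cont[unfolded case_prod_unfold] in auto)
    then show ?thesis by (simp add: C'[OF ij] case_prod_unfold)
  qed
  have C_der: "((\<lambda>t. C t s $$ (i, j)) has_vector_derivative C' t s $$ (i, j)) (at t)"
    if "t \<in> {- \<epsilon><..<\<epsilon>}" "i < n" "j < n" for t s i j
    unfolding C[OF that(2,3)] C'[OF that(2,3)] B_def F_def
    by (rule has_vector_derivative_mult_right, rule has_vector_derivative_sum, rule has_vector_derivative_sum,
        rule has_vector_derivative_mult_left, rule has_vector_derivative_mult_right,
        rule form_along_derivative[OF fam that(1)]) auto
  have C0: "C 0 s $$ (i, j) = 0" if ij: "i < n" "j < n" for s i j
  proof -
    have "\<alpha> 0 (chart_at r) (\<gamma> r) v = 0\<^sub>m n n" for r v
      using init[THEN bspec, OF chart_at(1), THEN bspec, OF chart_at(2)] by blast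
    then have "B 0 s $$ (r, l) = 0" if "r < n" "l < n" for r l
      using that by (simp add: B_def form_along_def section_along_def)
    then show ?thesis unfolding C[OF ij] by (simp add: sum.neutral)
  qed
  have rem: "\<exists>\<delta>>0. \<forall>t. \<bar>t\<bar> < \<delta> \<longrightarrow> (\<forall>s\<in>{0..1}. norm (C t s $$ (i, j) - t *\<^sub>R C' 0 s $$ (i, j)) \<le> \<bar>t\<bar> * \<eta>)"
    if "i < n" "j < n" "\<eta> > 0" for i j \<eta>
    by (rule C1_uniform_remainder[OF \<epsilon> C'_cont[OF that(1,2)] C_der[OF _ that(1,2)] C0[OF that(1,2)] that(3)])
  have rem_all: "\<exists>\<delta>>0. \<forall>t. \<bar>t\<bar> < \<delta> \<longrightarrow> (\<forall>i<n. \<forall>j<n. \<forall>s\<in>{0..1}. norm (C t s $$ (i, j) - t *\<^sub>R C' 0 s $$ (i, j)) \<le> \<bar>t\<bar> * \<eta>)"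
    if "\<eta> > 0" for \<eta>
  proof -
    have "\<forall>x\<in>{..<n} \<times> {..<n}. \<exists>\<delta>>0. \<forall>t. \<bar>t\<bar> < \<delta> \<longrightarrow>
        (\<forall>s\<in>{0..1}. norm (C t s $$ x - t *\<^sub>R C' 0 s $$ x) \<le> \<bar>t\<bar> * \<eta>)"
      using rem that by auto
    from bchoice[OF this] obtain \<delta>f where \<delta>f: "\<forall>x\<in>{..<n} \<times> {..<n}. \<delta>f x > 0 \<and> (\<forall>t. \<bar>t\<bar> < \<delta>f x \<longrightarrow>
        (\<forall>s\<in>{0..1}. norm (C t s $$ x - t *\<^sub>R C' 0 s $$ x) \<le> \<bar>t\<bar> * \<eta>))" by (elim exE) (rule that)
    have "\<exists>e>0. \<forall>x\<in>{..<n} \<times> {..<n}. e \<le> \<delta>f x"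
      by (rule finite_positive_lower_bound) (simp, rule conjunct1[OF bspec[OF \<delta>f]])
    then obtain e where e: "e > 0" "\<And>x. x \<in> {..<n} \<times> {..<n} \<Longrightarrow> e \<le> \<delta>f x" by blast
    show ?thesis
    proof (intro exI[of _ e] conjI allI impI ballI e(1))
      fix t i j s assume *: "\<bar>t\<bar> < e" "i < n" "j < n" "s \<in> {0..1::real}"
      then have ij: "(i, j) \<in> {..<n} \<times> {..<n}" by simp
      then have "\<bar>t\<bar> < \<delta>f (i, j)" using e(2)[OF ij] *(1) by linarith
      then show "norm (C t s $$ (i, j) - t *\<^sub>R C' 0 s $$ (i, j)) \<le> \<bar>t\<bar> * \<eta>"
        using bspec[OF \<delta>f ij, THEN conjunct2, THEN spec, THEN mp, THEN bspec, OF _ *(4)] by simp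
    qed
  qed
  have C'0_cont: "continuous_on {0..1} (\<lambda>s. C' 0 s $$ (i, j))" if "i < n" "j < n" for i j
  proof -
    have "continuous_on {0..1} (\<lambda>s. (\<lambda>(t, s). C' t s $$ (i, j)) (0, s))"
      by (rule continuous_on_compose2[OF C'_cont[OF that], of _ "\<lambda>s. (0, s)"]) (use z in \<open>auto intro!: continuous_intros\<close>)
    then show ?thesis by simp
  qed
  obtain K where K: "\<And>s i j. s \<in> {0..1} \<Longrightarrow> i < n \<Longrightarrow> j < n \<Longrightarrow> norm (C' 0 s $$ (i, j)) \<le> K" and "K \<ge> 0"
  proof -
    have "\<exists>b. \<forall>s\<in>{0..1}. norm (C' 0 s $$ (i, j)) \<le> b" if "i < n" "j < n" for i j
      using compact_imp_bounded[OF compact_continuous_image[OF C'0_cont[OF that] compact_Icc]]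
      by (auto simp: bounded_iff)
    then have "\<forall>x\<in>{..<n} \<times> {..<n}. \<exists>b. \<forall>s\<in>{0..1}. norm (C' 0 s $$ x) \<le> b" by auto
    then obtain b where b: "\<And>x. x \<in> {..<n} \<times> {..<n} \<Longrightarrow> \<forall>s\<in>{0..1}. norm (C' 0 s $$ x) \<le> b x"
      unfolding bchoice_iff by blast
    have bd: "norm (C' 0 s $$ (i, j)) \<le> (\<Sum>x\<in>{..<n} \<times> {..<n}. \<bar>b x\<bar>)" if "s \<in> {0..1}" "i < n" "j < n" for s i j
    proof -
      have "norm (C' 0 s $$ (i, j)) \<le> \<bar>b (i, j)\<bar>" using b[of "(i, j)"] that by force
      also have "\<dots> \<le> (\<Sum>x\<in>{..<n} \<times> {..<n}. \<bar>b x\<bar>)" using that by (intro member_le_sum) auto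
      finally show ?thesis .
    qed
    show thesis
    proof (rule that)
      show "norm (C' 0 s $$ (i, j)) \<le> (\<Sum>x\<in>{..<n} \<times> {..<n}. \<bar>b x\<bar>)" if "s \<in> {0..1}" "i < n" "j < n" for s i j
        by (rule bd[OF that])
      show "0 \<le> (\<Sum>x\<in>{..<n} \<times> {..<n}. \<bar>b x\<bar>)" by (rule sum_nonneg) simp
    qed
  qed
  \<comment> \<open>K bounds the derivative, and the extra 1 is the first-order remainder taken with
    \<eta> = 1.\<close>
  define K1 where "K1 = K + 1"
  have K1: "K1 > 0" using \<open>K \<ge> 0\<close> by (simp add: K1_def)
  obtain \<delta>1 where \<delta>1: "\<delta>1 > 0" "\<And>t i j s. \<bar>t\<bar> < \<delta>1 \<Longrightarrow> i < n \<Longrightarrow> j < n \<Longrightarrow> s \<in> {0..1} \<Longrightarrow>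
      norm (C t s $$ (i, j) - t *\<^sub>R C' 0 s $$ (i, j)) \<le> \<bar>t\<bar> * 1"
    using rem_all[of 1] by auto
  have C_bound: "norm (C t s $$ (i, j)) \<le> \<bar>t\<bar> * K1" if "\<bar>t\<bar> < \<delta>1" "s \<in> {0..1}" "i < n" "j < n" for t s i j
  proof -
    have "norm (C t s $$ (i, j)) \<le> norm (t *\<^sub>R C' 0 s $$ (i, j)) + norm (C t s $$ (i, j) - t *\<^sub>R C' 0 s $$ (i, j))"
      by (rule norm_triangle_sub)
    also have "\<dots> \<le> \<bar>t\<bar> * K + \<bar>t\<bar> * 1"
      using \<delta>1(2)[OF that(1,3,4,2)] K[OF that(2-4)] by (intro add_mono) (auto intro: mult_left_mono)
    finally show ?thesis by (simp add: K1_def distrib_left)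
  qed
  \<comment> \<open>The bounds on t ensure, in turn, that the family exists, that |C| is at most |t|
    K1, and that n |t| K1 <= 1/2 as the Picard series demands.\<close>
  define \<delta>0 where "\<delta>0 = min (min \<epsilon> \<delta>1) (1 / (2 * (real n * K1)))"
  have \<delta>0: "\<delta>0 > 0" using \<epsilon> \<delta>1(1) K1 n by (simp add: \<delta>0_def)
  let ?E = "mat_diag n (\<lambda>i. complex_of_real (exp (- L * ?d i)))"
  let ?T = "\<lambda>t. map_mat complex_of_real (\<delta> t ?p)"
  have hrep: "\<delta> t ?p \<in> carrier_mat n n \<and> Determinant.det (\<delta> t ?p) = 1" if "t \<in> {- \<epsilon><..<\<epsilon>}" for t
  proof -
    from rep[THEN bspec, OF that] obtain r where "\<forall>s\<in>{0..1::real}. representation n (\<gamma> 0) (r s)"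
        "\<forall>p\<in>loops (\<gamma> 0). r 0 p = \<delta> t p"
      unfolding hitchin_rep_def by (elim conjE exE)
    then have "representation n (\<gamma> 0) (r 0)" "r 0 ?p = \<delta> t ?p" using closed_curve_loop_in_loops by auto
    then show ?thesis 
      using conjunct1[OF \<open>representation n (\<gamma> 0) (r 0)\<close>[unfolded representation_def], THEN bspec, OF closed_curve_loop_in_loops]
      by simp
  qed
  have ex: "\<exists>Q. Q \<in> carrier_mat n n \<and> (\<exists>\<omega>. similar_mat (?T t) (\<omega> \<cdot>\<^sub>m (?E * Q))) \<and>
      (\<forall>i<n. \<forall>j<n. norm (Q $$ (i, j) - (if i = j then 1 else 0) - integral {0..1} (\<lambda>s. C t s $$ (i, j)))
        \<le> 2 * (real n * (\<bar>t\<bar> * K1))\<^sup>2)" if t: "\<bar>t\<bar> < \<delta>0" for t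
  proof -
    have t': "t \<in> {- \<epsilon><..<\<epsilon>}" "\<bar>t\<bar> < \<delta>1" using t by (auto simp: \<delta>0_def)
    have "\<bar>t\<bar> * (2 * (real n * K1)) \<le> 1"
      using t K1 n by (simp add: \<delta>0_def pos_less_divide_eq)
    then have small: "real n * (\<bar>t\<bar> * K1) \<le> 1 / 2" by (simp add: mult_ac)
    show ?thesis
    proof (rule transport_exists[of ?U n ?W "H_mat n" "B t" ?d L "\<bar>t\<bar> * K1"])
      fix Q R assume Q: "Q \<in> carrier_mat n n" "R \<in> carrier_mat n n" "R * Q = 1\<^sub>m n"
        and est: "\<And>i j. i < n \<Longrightarrow> j < n \<Longrightarrow>
          norm (Q $$ (i, j) - (if i = j then 1 else 0) - integral {0..1} (\<lambda>s. (of_real (- L) \<cdot>\<^sub>m exp_conj n ?d (L * s) (?W * B t s * ?U)) $$ (i, j)))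
           \<le> 2 * (real n * (\<bar>t\<bar> * K1))\<^sup>2"
        and Z: "\<And>M. M \<in> carrier_mat n n \<Longrightarrow> \<exists>Z. (\<forall>s. Z s \<in> carrier_mat n n) \<and>
         (\<forall>s\<in>{0..1}. (\<Sum>i<n. Z s $$ (i, i)) = (\<Sum>i<n. M $$ (i, i))) \<and>
         (\<forall>s\<in>{0..1}. mat_deriv n Z (of_real (- L) \<cdot>\<^sub>m bracket (H_mat n + B t s) (Z s)) s) \<and>
         Z 0 = ?U * M * ?W \<and> Z 1 = ?U * exp_conj n ?d (- L) (Q * M * R) * ?W"
      have "\<exists>\<omega>. similar_mat (?T t) (\<omega> \<cdot>\<^sub>m (?E * Q))"
        by (rule monodromy_similar[OF n G(1)[OF t'(1)] conjunct1[OF hrep[OF t'(1)]] conjunct2[OF rep[THEN bspec, OF t'(1)]] Q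
            Z[unfolded B_def]])
      then show ?thesis using Q(1) est unfolding C_def by (intro exI[of _ Q] conjI allI impI)
    next
      show "norm ((of_real (- L) \<cdot>\<^sub>m exp_conj n ?d (L * s) (?W * B t s * ?U)) $$ (i, j)) \<le> \<bar>t\<bar> * K1"
        if "s \<in> {0..1}" "i < n" "j < n" for s i j
        using C_bound[OF t'(2) that] unfolding C_def .
      show "continuous_on {0..1} (\<lambda>s. (of_real (- L) \<cdot>\<^sub>m exp_conj n ?d (L * s) (?W * B t s * ?U)) $$ (i, j))"
        if "i < n" "j < n" for i j
        using C_cont[OF t'(1) that] unfolding C_def .
    qed (use K1 small BF H_mat_eigenbasis eigenbasis_inverse in auto)
  qed
  \<comment> \<open>The value outside the range makes Q t an n by n matrix for every t, as the
    eigenvalue lemma asks.\<close>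
  define Q where "Q t = (if \<bar>t\<bar> < \<delta>0 then SOME Q. Q \<in> carrier_mat n n \<and> (\<exists>\<omega>. similar_mat (?T t) (\<omega> \<cdot>\<^sub>m (?E * Q))) \<and>
      (\<forall>i<n. \<forall>j<n. norm (Q $$ (i, j) - (if i = j then 1 else 0) - integral {0..1} (\<lambda>s. C t s $$ (i, j)))
        \<le> 2 * (real n * (\<bar>t\<bar> * K1))\<^sup>2) else 1\<^sub>m n)" for t
  have Q: "Q t \<in> carrier_mat n n \<and> (\<exists>\<omega>. similar_mat (?T t) (\<omega> \<cdot>\<^sub>m (?E * Q t))) \<and>
      (\<forall>i<n. \<forall>j<n. norm (Q t $$ (i, j) - (if i = j then 1 else 0) - integral {0..1} (\<lambda>s. C t s $$ (i, j)))
        \<le> 2 * (real n * (\<bar>t\<bar> * K1))\<^sup>2)" if "\<bar>t\<bar> < \<delta>0" for t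
    using someI_ex[OF ex[OF that]] that by (simp add: Q_def)
  have Qc: "Q t \<in> carrier_mat n n" for t using Q[of t] by (cases "\<bar>t\<bar> < \<delta>0") (auto simp: Q_def)
  \<comment> \<open>At t = 0 both C and the error bound vanish, which determines the chosen
    matrix.\<close>
  have Q0: "Q 0 = 1\<^sub>m n"
  proof (rule eq_matI)
    fix i j assume "i < dim_row (1\<^sub>m n)" "j < dim_col (1\<^sub>m n)"
    then have ij: "i < n" "j < n" by auto
    have "norm (Q 0 $$ (i, j) - (if i = j then 1 else 0) - integral {0..1} (\<lambda>s. C 0 s $$ (i, j))) \<le> 2 * (real n * (\<bar>0\<bar> * K1))\<^sup>2"
      using Q[of 0] \<delta>0 ij by auto
    then show "Q 0 $$ (i, j) = 1\<^sub>m n $$ (i, j)" using ij by (simp add: C0)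
  qed (use Qc[of 0] in auto)
  define I where "I i j = integral {0..1} (\<lambda>s. C' 0 s $$ (i, j))" for i j
  have dQ: "((\<lambda>t. Q t $$ (i, j)) has_vector_derivative I i j) (at 0)" if ij: "i < n" "j < n" for i j
  proof (rule has_vector_derivative_at_0_I)
    fix \<eta> :: real assume \<eta>: "\<eta> > 0"
    obtain \<delta>2 where \<delta>2: "\<delta>2 > 0" "\<And>t s. \<bar>t\<bar> < \<delta>2 \<Longrightarrow> s \<in> {0..1} \<Longrightarrow>
        norm (C t s $$ (i, j) - t *\<^sub>R C' 0 s $$ (i, j)) \<le> \<bar>t\<bar> * (\<eta> / 2)"
      using rem[OF ij, of "\<eta> / 2"] \<eta> by auto
    \<comment> \<open>The tail of the series is at most t^2 \<open>?c\<close>, and |t| < \<eta> / (2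
      \<open>?c\<close>) makes it at most half of |t| \<eta>; the other half comes from the uniform
      remainder.\<close>
    let ?c = "2 * (real n * K1)\<^sup>2"
    have c: "?c > 0" using n K1 by simp
    define \<delta>3 where "\<delta>3 = min (min \<delta>0 \<delta>2) (\<eta> / (2 * ?c))"
    have "norm (Q t $$ (i, j) - Q 0 $$ (i, j) - t *\<^sub>R I i j) \<le> \<bar>t\<bar> * \<eta>" if t: "\<bar>t\<bar> < \<delta>3" for t
    proof -
      have t': "\<bar>t\<bar> < \<delta>0" "\<bar>t\<bar> < \<delta>2" "\<bar>t\<bar> < \<eta> / (2 * ?c)" "t \<in> {- \<epsilon><..<\<epsilon>}"
        using t by (auto simp: \<delta>3_def \<delta>0_def)
      have 1: "norm (Q t $$ (i, j) - (if i = j then 1 else 0) - integral {0..1} (\<lambda>s. C t s $$ (i, j))) \<le> \<bar>t\<bar> * (\<eta> / 2)"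
      proof -
        have "norm (Q t $$ (i, j) - (if i = j then 1 else 0) - integral {0..1} (\<lambda>s. C t s $$ (i, j))) \<le> 2 * (real n * (\<bar>t\<bar> * K1))\<^sup>2"
          using Q[OF t'(1)] ij by blast
        also have "\<dots> = \<bar>t\<bar> * (\<bar>t\<bar> * ?c)" by (simp add: power_mult_distrib power2_eq_square)
        also have "\<dots> \<le> \<bar>t\<bar> * (\<eta> / 2)"
        proof (rule mult_left_mono)
          have "\<bar>t\<bar> * (2 * ?c) < \<eta>" using t'(3) c by (simp only: pos_less_divide_eq mult_pos_pos zero_less_numeral)
          then show "\<bar>t\<bar> * ?c \<le> \<eta> / 2" by simp
        qed simp
        finally show ?thesis .
      qed
      have int: "(\<lambda>s. C t s $$ (i, j)) integrable_on {0..1}" "(\<lambda>s. t *\<^sub>R C' 0 s $$ (i, j)) integrable_on {0..1}"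
        using C_cont[OF t'(4) ij] C'0_cont[OF ij] by (auto intro!: integrable_continuous_real continuous_intros)
      have "norm (integral {0..1} (\<lambda>s. C t s $$ (i, j) - t *\<^sub>R C' 0 s $$ (i, j))) \<le> \<bar>t\<bar> * (\<eta> / 2) * (1 - 0)"
        using \<delta>2(2)[OF t'(2)] C_cont[OF t'(4) ij] C'0_cont[OF ij]
        by (intro integral_bound) (auto intro!: continuous_intros)
      then have 2: "norm (integral {0..1} (\<lambda>s. C t s $$ (i, j)) - t *\<^sub>R I i j) \<le> \<bar>t\<bar> * (\<eta> / 2)"
        unfolding I_def integral_cmul[symmetric] Henstock_Kurzweil_Integration.integral_diff[OF int, symmetric] by simp
      have eq: "Q t $$ (i, j) - Q 0 $$ (i, j) - t *\<^sub>R I i j =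
          (Q t $$ (i, j) - (if i = j then 1 else 0) - integral {0..1} (\<lambda>s. C t s $$ (i, j))) +
          (integral {0..1} (\<lambda>s. C t s $$ (i, j)) - t *\<^sub>R I i j)"
        using ij by (simp add: Q0)
      have "norm (Q t $$ (i, j) - Q 0 $$ (i, j) - t *\<^sub>R I i j) \<le> \<bar>t\<bar> * (\<eta> / 2) + \<bar>t\<bar> * (\<eta> / 2)"
        unfolding eq by (rule norm_triangle_mono[OF 1 2])
      then show ?thesis by (simp only: distrib_left[symmetric] field_sum_of_halves)
    qed
    moreover have "\<delta>3 > 0" using \<delta>0 \<delta>2(1) \<eta> c by (simp add: \<delta>3_def)
    ultimately show "\<exists>\<delta>>0. \<forall>t. \<bar>t\<bar> < \<delta> \<longrightarrow> norm (Q t $$ (i, j) - Q 0 $$ (i, j) - t *\<^sub>R I i j) \<le> \<bar>t\<bar> * \<eta>"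
      by blast
  qed
  \<comment> \<open>Decreasing in i, because \<open>H_eigenvalue n i\<close> increases and L > 0; so
    index p - 1 is the p-th largest.\<close>
  define \<mu> where "\<mu> i = exp (- L * ?d i)" for i
  have EQ: "?E * Q t = Matrix.mat n n (\<lambda>(i, j). of_real (\<mu> i) * Q t $$ (i, j))" for t
    unfolding \<mu>_def by (rule mat_diag_mult_left[OF Qc])
  \<comment> \<open>Conjugation preserves the trace and the forms take values in
    \<open>sl n\<close>; this is the condition that eliminates the unknown scalar.\<close>
  have trace_I: "(\<Sum>i<n. I i i) = 0"
  proof -
    have "(\<Sum>i<n. I i i) = integral {0..1} (\<lambda>s. \<Sum>i<n. C' 0 s $$ (i, i))"
      unfolding I_def by (rule integral_sum[symmetric]) (use C'0_cont in \<open>auto intro: integrable_continuous_real\<close>)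
    moreover have "(\<Sum>i<n. C' 0 s $$ (i, i)) = 0" for s
    proof -
      have WF: "?W * F 0 s \<in> carrier_mat n n" using BF by (intro m) auto
      have "(\<Sum>i<n. C' 0 s $$ (i, i)) = - of_real L * (\<Sum>i<n. (?W * F 0 s * ?U) $$ (i, i))"
        unfolding sum_distrib_left
        by (intro sum.cong refl) (simp add: C' index_conj[OF eigenbasis_carrier(2) BF(2) eigenbasis_carrier(1)] del: index_mult_mat)
      also have "(\<Sum>i<n. (?W * F 0 s * ?U) $$ (i, i)) = (\<Sum>i<n. (?U * (?W * F 0 s)) $$ (i, i))"
        by (rule trace_mult_commute[OF WF eigenbasis_carrier(1)])
      also have "?U * (?W * F 0 s) = F 0 s"
        by (rule mat_mult_cancel_left[OF eigenbasis_carrier(1,2) BF(2) eigenbasis_inverse(2)])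
      also have "(\<Sum>i<n. F 0 s $$ (i, i)) = 0" unfolding F_def by (rule trace_form_along[OF G(2)[OF z]])
      finally show ?thesis by simp
    qed
    ultimately show ?thesis by simp
  qed
  have main: "((\<lambda>t. ln (nth_eigenvalue p (\<delta> t ?p))) has_real_derivative
      Re (of_real (\<mu> (p - 1)) * I (p - 1) (p - 1)) / \<mu> (p - 1)) (at 0)"
  proof (rule ln_nth_eigenvalue_has_real_derivative[where A = "\<lambda>t. ?E * Q t" and M = "\<lambda>i j. of_real (\<mu> i) * I i j"])
    show "?E * Q t \<in> carrier_mat n n" for t unfolding EQ by simp
    show "?E * Q 0 = mat_diag n (\<lambda>i. of_real (\<mu> i))"
      unfolding Q0 by (rule eq_matI) (auto simp: \<mu>_def mat_diag_def)
    show "\<mu> i > 0" for i by (simp add: \<mu>_def)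
    show "\<mu> j < \<mu> i" if "i < j" for i j
      using that L_pos unfolding \<mu>_def H_eigenvalue_def by (simp add: divide_strict_right_mono)
    show "((\<lambda>t. (?E * Q t) $$ (i, j)) has_vector_derivative of_real (\<mu> i) * I i j) (at 0)" if "i < n" "j < n" for i j
      unfolding EQ using that by (simp add: has_vector_derivative_mult_right[OF dQ[OF that]])
    show "(\<Sum>i<n. Re (of_real (\<mu> i) * I i i) / \<mu> i) = 0"
    proof -
      have "(\<Sum>i<n. Re (of_real (\<mu> i) * I i i) / \<mu> i) = Re (\<Sum>i<n. I i i)" by (simp add: \<mu>_def)
      then show ?thesis by (simp add: trace_I)
    qed
    show "\<forall>\<^sub>F t in nhds 0. \<delta> t ?p \<in> carrier_mat n n \<and> Determinant.det (\<delta> t ?p) = 1 \<and>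
        (\<exists>c. similar_mat (?T t) (c \<cdot>\<^sub>m (?E * Q t)))"
      unfolding eventually_nhds_metric
    proof (intro exI[of _ \<delta>0] conjI \<delta>0 allI impI)
      fix t :: real assume "dist t 0 < \<delta>0"
      then have t: "\<bar>t\<bar> < \<delta>0" by simp
      then have "t \<in> {- \<epsilon><..<\<epsilon>}" by (auto simp: \<delta>0_def)
      then show "\<delta> t ?p \<in> carrier_mat n n" "Determinant.det (\<delta> t ?p) = 1" using hrep by auto
      show "\<exists>c. similar_mat (?T t) (c \<cdot>\<^sub>m (?E * Q t))" using Q[OF t] by blast
    qed
  qed (use p in auto)
  have "Re (I (p - 1) (p - 1)) = - 2 * E_diag n (k - 1) (p - 1) * integral {0..L} (\<lambda>s. Re (eval_differential atlas k q \<gamma> s))"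
  proof -
    let ?a = "p - 1" and ?R = "\<lambda>s. Re (eval_differential atlas k q \<gamma> s)"
    have a: "?a < n" using p by simp
    \<comment> \<open>On the diagonal the exponentials of the interaction picture are 1, so
      \<open>I ?a ?a\<close> becomes an integral of this function.\<close>
    define f where "f s = (?W * form_along n (\<alpha>' 0) s * ?U) $$ (?a, ?a)" for s
    define v where "v s = (?W * section_along n u s * ?U) $$ (?a, ?a)" for s
    have f_cont: "continuous_on {0..L} f"
      unfolding f_def index_conj[OF eigenbasis_carrier(2) section_along_carrier(2) eigenbasis_carrier(1) a a]
      by (rule continuous_on_sum, rule continuous_on_sum, rule continuous_on_mult_right, rule continuous_on_mult_left,
          rule continuous_form_along_fixed[OF G(2)[OF z]]) auto
    then have f_int: "(f has_integral integral {0..L} f) {0..L}"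
      by (intro integrable_integral integrable_continuous_real)
    have v: "(v has_vector_derivative f s - of_real (2 * E_diag n (k - 1) ?a * ?R s)) (at s)" for s
      unfolding v_def f_def by (rule diagonal_pairing[OF u _ a]) (use init k in auto)
    have "((\<lambda>s. f s - of_real (2 * E_diag n (k - 1) ?a * ?R s)) has_integral (v L - v 0)) {0..L}"
      using L_pos v by (intro fundamental_theorem_of_calculus) (auto intro: has_vector_derivative_at_within)
    moreover have "v L = v 0" using section_along_periodic[OF u, of 0] by (simp add: v_def)
    ultimately have "((\<lambda>s. f s - of_real (2 * E_diag n (k - 1) ?a * ?R s)) has_integral 0) {0..L}" by simp
    from has_integral_Re[OF has_integral_diff[OF f_int this]]
    have "((\<lambda>s. 2 * E_diag n (k - 1) ?a * ?R s) has_integral Re (integral {0..L} f)) {0..L}" by simp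
    from integral_unique[OF this]
    have 1: "Re (integral {0..L} f) = 2 * E_diag n (k - 1) ?a * integral {0..L} ?R"
      by (simp only: integral_mult_right)
    \<comment> \<open>The substitution brings a factor 1/L, which cancels the L in
      \<open>C'\<close>.\<close>
    have "((\<lambda>s. f (L * s)) has_integral (1 / \<bar>L\<bar>) *\<^sub>R integral {0..L} f) ((\<lambda>x. x / L) ` {0..L})"
      using has_integral_stretch_real[OF f_int, of L] L_pos by simp
    moreover have "(\<lambda>x. x / L) ` {0..L} = {0..1}"
      using L_pos by (simp add: image_divide_atLeastAtMost)
    ultimately have "((\<lambda>s. f (L * s)) has_integral (1 / L) *\<^sub>R integral {0..L} f) {0..1}"
      using L_pos by simp
    from has_integral_mult_right[OF this, of "- of_real L"]
    have "((\<lambda>s. - of_real L * f (L * s)) has_integral - integral {0..L} f) {0..1}"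
      using L_pos by (simp add: scaleR_conv_of_real)
    moreover have "C' 0 s $$ (?a, ?a) = - of_real L * f (L * s)" for s
      unfolding C'[OF a a] f_def F_def index_conj[OF eigenbasis_carrier(2) section_along_carrier(2) eigenbasis_carrier(1) a a]
      by simp
    ultimately have "I ?a ?a = - integral {0..L} f" unfolding I_def by (simp only: integral_unique)
    then show ?thesis using 1 by simp
  qed
  moreover have "Re (of_real (\<mu> (p - 1)) * I (p - 1) (p - 1)) / \<mu> (p - 1) = Re (I (p - 1) (p - 1))"
    by (simp add: \<mu>_def)
  ultimately show ?thesis using main by simp
qed

end

theorem theorem4p0p1:
  fixes atlas :: "'a::t2_space chart set"
    and h :: "'a chart \<Rightarrow> 'a \<Rightarrow> real"
    and q :: "'a chart \<Rightarrow> 'a \<Rightarrow> complex"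
    and \<gamma> :: "real \<Rightarrow> 'a"
    and L :: real
    and g n k :: nat
  assumes "closed_riemann_surface atlas"
    and "has_genus (euclidean :: 'a topology) g" and "g \<ge> 2"
    and "hyperbolic_metric atlas h"
    and "n \<ge> 2" and "2 \<le> k" and "k \<le> n"
    and "holomorphic_differential atlas k q"
    and "simple_closed_geodesic atlas h \<gamma> L"
  shows
    "first_variation_log_eigenvalue atlas h n \<gamma> L 1 (psi0 n k h q)
       ((- 1) ^ k * fact (n - 1) / (2 ^ (k - 2) * fact (n - k)) *
        integral {0..L} (\<lambda>s. Re (eval_differential atlas k q \<gamma> s))) \<and>
     (\<forall>p. 1 \<le> p \<and> p \<le> n \<longrightarrow>
       first_variation_log_eigenvalue atlas h n \<gamma> L p (psi0 n k h q)
         (eigenvalue_const n k p *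
          integral {0..L} (\<lambda>s. Re (eval_differential atlas k q \<gamma> s)))) \<and>
     (k = n \<longrightarrow> (\<forall>p. 1 \<le> p \<and> p \<le> n \<longrightarrow>
       first_variation_log_eigenvalue atlas h n \<gamma> L p (psi0 n n h q)
         ((- 1) ^ (p + n + 1) * (fact (n - 1) / 2 ^ (n - 2)) * real ((n - 1) choose (p - 1)) *
          integral {0..L} (\<lambda>s. Re (eval_differential atlas n q \<gamma> s)))))"
  proof -
  have surface: "riemann_surface atlas"
    using assms(1) by (simp add: closed_riemann_surface_def)
  interpret geodesic_on_surface atlas h \<gamma> L
    using surface assms(9) by unfold_locales
  \<comment> \<open>All three claims are instances of this one: for p = 1 and for k = n the sum in
    \<open>eigenvalue_const\<close> reduces to a single term.\<close>
  have main: "first_variation_log_eigenvalue atlas h n \<gamma> L p (psi0 n k h q)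
      (eigenvalue_const n k p * integral {0..L} (\<lambda>s. Re (eval_differential atlas k q \<gamma> s)))"
    if p: "1 \<le> p" "p \<le> n" for p
    unfolding first_variation_log_eigenvalue_def eigenvalue_const_eq_E_diag[OF assms(6,7) p]
    using first_variation[OF assms(5,6) p] by blast
  have one: "1 \<le> (1::nat)" "1 \<le> n" using assms(5) by simp_all
  show ?thesis
  proof (intro conjI allI impI)
    show "first_variation_log_eigenvalue atlas h n \<gamma> L 1 (psi0 n k h q)
       ((- 1) ^ k * fact (n - 1) / (2 ^ (k - 2) * fact (n - k)) *
        integral {0..L} (\<lambda>s. Re (eval_differential atlas k q \<gamma> s)))"
      using main[OF one] unfolding eigenvalue_const_first[OF assms(6,7)] .
    show "first_variation_log_eigenvalue atlas h n \<gamma> L p (psi0 n k h q)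
         (eigenvalue_const n k p * integral {0..L} (\<lambda>s. Re (eval_differential atlas k q \<gamma> s)))"
      if "1 \<le> p \<and> p \<le> n" for p
      using main that by blast
    show "first_variation_log_eigenvalue atlas h n \<gamma> L p (psi0 n n h q)
         ((- 1) ^ (p + n + 1) * (fact (n - 1) / 2 ^ (n - 2)) * real ((n - 1) choose (p - 1)) *
          integral {0..L} (\<lambda>s. Re (eval_differential atlas n q \<gamma> s)))"
      if "k = n" "1 \<le> p \<and> p \<le> n" for p
      using main[of p] that eigenvalue_const_top[OF assms(5), of p] by simp
  qed
qed

end
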